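(* Let $0<\rho\leq 1$, $0\leq \delta\leq 1$, $\ell\in\mathbb{N}$, $k:=[\frac{n}{2}]+1$, and let $A:C^{\infty}(\mathbb{T}^n)\rightarrow C^{\infty}(\mathbb{T}^n)$ be a pseudo-differential operator with symbol $\sigma:\mathbb{T}^n\times\mathbb{Z}^n\to\mathbb{C}$ satisfying $$\vert \partial_x^\beta\Delta_{\xi}^{\alpha}\sigma(x,\xi)\vert\leq C_{\alpha}\langle \xi \rangle^{-m-\rho|\alpha|+\delta|\beta|},\qquad (x,\xi)\in\mathbb{T}^n\times\mathbb{Z}^n,$$ for all multi-indices $\alpha,\beta\in\mathbb{N}_0^n$ with $|\alpha| \leq k$ and $|\beta|\leq \ell$. Then $A$ extends to a bounded linear operator $\Lambda^s(\mathbb{T}^n)\rightarrow \Lambda^s(\mathbb{T}^n)$ for all $0<s<1$ provided that $m\geq \delta \ell+\frac{n}{2}(1-\rho)$.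
   Context: $\mathbb{T}^n=\mathbb{R}^n/\mathbb{Z}^n$, $[\cdot]$ is the integer part, $\langle\xi\rangle=(1+|\xi|^2)^{1/2}$, and $m$ is a real number. The difference operators are $\Delta_{\xi_j}f(\xi)=f(\xi+e_j)-f(\xi)$ for $f:\mathbb{Z}^n\to\mathbb{C}$, with $(e_j)$ the canonical basis, and $\Delta_\xi^\alpha=\Delta_{\xi_1}^{\alpha_1}\cdots\Delta_{\xi_n}^{\alpha_n}$. The periodic pseudo-differential operator $A$ with symbol $\sigma$ is $Af(x)=\sum_{\xi\in\mathbb{Z}^n}e^{i2\pi\langle x,\xi\rangle}\sigma(x,\xi)\hat f(\xi)$, $f\in C^\infty(\mathbb{T}^n)$, where $\hat f(\xi)=\int_{\mathbb{T}^n}e^{-i2\pi\langle x,\xi\rangle}f(x)\,dx$. For $0<s\leq1$, $\Lambda^s(\mathbb{T}^n)$ is the Banach space of functions $f:\mathbb{T}^n\to\mathbb{C}$ with $|f|_{\Lambda^s}=\sup_{x,h\in\mathbb{T}^n}|f(x+h)-f(x)|\,|h|^{-s}<\infty$, with norm $\Vert f\Vert_{\Lambda^s}=|f|_{\Lambda^s}+\sup_{x\in\mathbb{T}^n}|f(x)|$. *)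

theory Defs
  imports "HOL-Analysis.Analysis"
begin

text \<open>
  Functions on the torus \<open>\<real>\<^sup>n / \<int>\<^sup>n\<close> are represented by \<open>\<int>\<^sup>n\<close>-periodic functions on \<open>real ^ 'n\<close>,
  with \<open>n = CARD('n)\<close>. The index type is linearly ordered so that the products of powers
  of coordinate operators attached to a multi-index can be taken in the order of the coordinates.
\<close>

definition of_lattice :: "int ^ 'n \<Rightarrow> real ^ 'n" where
  "of_lattice z = (\<chi> j. of_int (z $ j))"

definition periodic :: "(real ^ 'n \<Rightarrow> complex) \<Rightarrow> bool" where
  "periodic f \<longleftrightarrow> (\<forall>x z. f (x + of_lattice z) = f x)"

definition mi_length :: "nat ^ 'n \<Rightarrow> nat" where
  "mi_length \<alpha> = (\<Sum>j\<in>UNIV. \<alpha> $ j)"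

definition mi_compose ::
    "('n \<Rightarrow> 'f \<Rightarrow> 'f) \<Rightarrow> nat ^ ('n :: {finite, linorder}) \<Rightarrow> 'f \<Rightarrow> 'f" where
  "mi_compose D \<alpha> = foldr (\<lambda>j. D j ^^ (\<alpha> $ j)) (sorted_list_of_set UNIV)"

definition partial_deriv :: "'n \<Rightarrow> (real ^ 'n \<Rightarrow> complex) \<Rightarrow> real ^ 'n \<Rightarrow> complex" where
  "partial_deriv j f x = vector_derivative (\<lambda>t. f (x + t *\<^sub>R axis j 1)) (at 0)"

definition difference :: "'n \<Rightarrow> (int ^ 'n \<Rightarrow> complex) \<Rightarrow> int ^ 'n \<Rightarrow> complex" where
  "difference j f \<xi> = f (\<xi> + axis j 1) - f \<xi>"

text \<open>
  All iterated partial derivatives, in any order, are required to be (Frechet) differentiable;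
  in particular they all exist and are continuous.
\<close>

definition smooth_torus :: "(real ^ 'n \<Rightarrow> complex) set" where
  "smooth_torus = {f. periodic f \<and> (\<forall>js. foldr partial_deriv js f differentiable_on UNIV)}"

definition japanese_bracket :: "int ^ 'n \<Rightarrow> real" where
  "japanese_bracket \<xi> = sqrt (1 + (norm (of_lattice \<xi>))\<^sup>2)"

definition fourier_coeff :: "(real ^ 'n \<Rightarrow> complex) \<Rightarrow> int ^ 'n \<Rightarrow> complex" where
  "fourier_coeff f \<xi> = integral (cbox 0 One) (\<lambda>x. cis (- (2 * pi * (x \<bullet> of_lattice \<xi>))) * f x)"

text \<open>
  Since the characters \<open>e\<^sub>\<xi>(x) = cis (2\<pi>\<langle>x,\<xi>\<rangle>)\<close> are smooth and \<open>A e\<^sub>\<xi> = \<sigma>(\<cdot>,\<xi>) e\<^sub>\<xi>\<close>, the requirement that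
  \<open>A\<close> preserve \<open>C\<^sup>\<infinity>\<close> makes every \<open>\<sigma>(\<cdot>,\<xi>)\<close> smooth, so its partial derivatives exist.
\<close>

definition psdo_with_symbol ::
    "((real ^ 'n \<Rightarrow> complex) \<Rightarrow> (real ^ 'n \<Rightarrow> complex)) \<Rightarrow>
     (real ^ 'n \<Rightarrow> int ^ 'n \<Rightarrow> complex) \<Rightarrow> bool" where
  "psdo_with_symbol A \<sigma> \<longleftrightarrow>
     (\<forall>f\<in>smooth_torus. A f \<in> smooth_torus \<and>
        (\<forall>x. A f x = (\<Sum>\<^sub>\<infinity>\<xi>. cis (2 * pi * (x \<bullet> of_lattice \<xi>)) * \<sigma> x \<xi> * fourier_coeff f \<xi>)))"

text \<open>The length \<open>|h|\<close> of (the class of) \<open>h\<close> in the torus: its distance to \<open>\<int>\<^sup>n\<close>.\<close>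

definition torus_norm :: "real ^ 'n \<Rightarrow> real" where
  "torus_norm h = (INF z. norm (h - of_lattice z))"

text \<open>
  For \<open>h \<in> \<int>\<^sup>n\<close>, i.e. \<open>h = 0\<close> in the torus, the quotient below is \<open>0\<close> and does not affect the supremum.
\<close>

definition holder_quotient :: "real \<Rightarrow> (real ^ 'n \<Rightarrow> complex) \<Rightarrow> (real ^ 'n) \<times> (real ^ 'n) \<Rightarrow> real" where
  "holder_quotient s f = (\<lambda>(x, h). norm (f (x + h) - f x) * torus_norm h powr (- s))"

definition holder_space :: "real \<Rightarrow> (real ^ 'n \<Rightarrow> complex) set" where
  "holder_space s = {f. periodic f \<and> bdd_above (range (holder_quotient s f))}"

definition holder_norm :: "real \<Rightarrow> (real ^ 'n \<Rightarrow> complex) \<Rightarrow> real" where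
  "holder_norm s f = (SUP p. holder_quotient s f p) + (SUP x. norm (f x))"

definition bounded_operator_on ::
    "('a \<Rightarrow> complex) set \<Rightarrow> (('a \<Rightarrow> complex) \<Rightarrow> real) \<Rightarrow> (('a \<Rightarrow> complex) \<Rightarrow> ('a \<Rightarrow> complex)) \<Rightarrow> bool" where
  "bounded_operator_on V N T \<longleftrightarrow>
     (\<forall>f\<in>V. T f \<in> V) \<and>
     (\<forall>f\<in>V. \<forall>g\<in>V. T (\<lambda>x. f x + g x) = (\<lambda>x. T f x + T g x)) \<and>
     (\<forall>c. \<forall>f\<in>V. T (\<lambda>x. c * f x) = (\<lambda>x. c * T f x)) \<and>
     (\<exists>B. \<forall>f\<in>V. N (T f) \<le> B * N f)"

end

theory Submission
  imports Defs
begin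

text \<open>
  Only \<open>|\<beta>| \<le> 1\<close> and \<open>\<alpha> = i e\<^sub>j\<close> are needed: \<open>m - \<delta> \<ge> n (1 - \<rho>) / 2\<close>, so \<open>\<sigma>\<close> and its first
  derivatives in \<open>x\<close> have order \<open>- n (1 - \<rho>) / 2\<close>. Split the frequencies dyadically, \<open>|\<xi>| \<approx> R = 2\<^sup>j\<close>, with
  cutoffs \<open>\<phi>\<^sub>R\<close>. By Parseval and the Cauchy-Schwarz inequality with weight \<open>1 + (R\<^sup>\<rho> |z|)\<^sup>2\<^sup>k\<close>, where \<open>2k > n\<close>,
  the kernel of the piece of the operator at frequency \<open>R\<close> is bounded in \<open>L\<^sup>1\<close> uniformly in \<open>R\<close>. The same
  estimate with \<open>\<rho> = 1\<close>, applied to \<open>\<phi>\<^sub>R\<close> alone, shows that the dyadic pieces of \<open>f \<in> \<Lambda>\<^sup>s\<close> have size \<open>R\<^sup>-\<^sup>s\<close>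
  and increments of size \<open>|h| R\<^sup>1\<^sup>-\<^sup>s\<close>. Hence the pieces of \<open>A f\<close> have the same sizes, and summing
  \<open>min 1 (R |h|) R\<^sup>-\<^sup>s\<close> over \<open>R\<close> gives \<open>|h|\<^sup>s\<close> because \<open>0 < s < 1\<close>.
\<close>

section \<open>Periodic functions and characters\<close>

text \<open>By Parseval the kernel of a symbol of size M supported in |\<xi>| <= N has L^2 norm
  about M N^(n/2), and the weight confines it to |z| <= 1/r with r = R^\<rho>, a set of volume
  r^(-n). Its L^1 norm is therefore of order M (N/r)^(n/2). For N of order R this is a loss of
  R^(n(1-\<rho>)/2), exactly what the order -n(1-\<rho>)/2 of the symbol pays for.

  The obstacle is that this leaves no room for the exponent s. Integrating |z|^s against the kernel
  of the symbol itself would give R^(-\<rho> s) instead of R^(-s), and in general would require more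
  than the k available differences. So increments of f are integrated only against kernels of pure
  cutoffs, which live at scale 1/R and have q = k + 1 differences; the symbol then acts on a piece
  of f that is already small, and only its supremum enters. To make this factorization exact, each
  block carries two cutoffs: a narrow one acting on f, and a wide one, equal to 1 on the support of
  the narrow one, multiplying the symbol.\<close>

definition ones :: "real ^ 'n" where "ones = (\<chi> i. 1)"

lemma ones_nth [simp]: "ones $ i = 1"
  by (simp add: ones_def)

lemma One_eq_ones: "One = (ones :: real ^ 'n)"
proof -
  have "One $ i = (1 :: real)" for i :: 'n
    using inner_sum_Basis[of "axis i 1 :: real ^ 'n"] by (simp add: cart_eq_inner_axis axis_in_Basis_iff)
  then show ?thesis by (simp add: vec_eq_iff)
qed

lemma of_lattice_nth [simp]: "of_lattice z $ i = of_int (z $ i)"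
  by (simp add: of_lattice_def)

lemma of_lattice_0 [simp]: "of_lattice 0 = 0"
  and of_lattice_add: "of_lattice (z + w) = of_lattice z + of_lattice w"
  and of_lattice_minus: "of_lattice (- z) = - of_lattice z"
  and of_lattice_axis: "of_lattice (axis j k) = axis j (of_int k)"
  by (simp_all add: vec_eq_iff axis_def)

lemma periodicD: "periodic f \<Longrightarrow> f (x + of_lattice z) = f x"
  by (simp add: periodic_def)

text \<open>Cut the box from \<open>a\<close> to \<open>a + axis j t + ones\<close> across
  coordinate j in two ways. At height \<open>a $ j + 1\<close> it falls into the cube at
  \<open>a\<close> and a slab, at height \<open>a $ j + t\<close> into a slab and the shifted cube.
  The slabs are translates of each other by the period \<open>axis j 1\<close>, so the cubes have
  equal integrals.\<close>

lemma integral_unit_cube_shift_axis: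
  fixes f :: "real ^ 'n \<Rightarrow> complex"
  assumes cont: "continuous_on UNIV f" and per: "periodic f" and t: "0 \<le> t" "t \<le> 1"
  shows "integral (cbox (a + axis j t) (a + axis j t + ones)) f = integral (cbox a (a + ones)) f"
proof -
  let ?e = "axis j 1 :: real ^ 'n"
  let ?B = "cbox a (a + axis j t + ones)"
  have int: "f integrable_on cbox u v" for u v
    by (rule integrable_continuous[OF continuous_on_subset[OF cont]]) simp
  have e: "?e \<in> Basis" by (auto simp: Basis_vec_def)
  have nth: "x \<bullet> ?e = x $ j" for x by (simp add: cart_eq_inner_axis)
  have mem: "x \<in> cbox u v \<longleftrightarrow> (u $ j \<le> x $ j \<and> x $ j \<le> v $ j) \<and>
      (\<forall>i. i \<noteq> j \<longrightarrow> u $ i \<le> x $ i \<and> x $ i \<le> v $ i)" for x u v :: "real ^ 'n"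
    by (auto simp: mem_box_cart)
  have 1: "?B \<inter> {x. x $ j \<le> a $ j + 1} = cbox a (a + ones)"
    using t by (auto simp: set_eq_iff mem axis_def)
  have 2: "?B \<inter> {x. x $ j \<ge> a $ j + 1} = cbox (a + ?e) (a + axis j t + ones)"
    using t by (auto simp: set_eq_iff mem axis_def)
  have 3: "?B \<inter> {x. x $ j \<le> a $ j + t} = cbox a (a + axis j t + ones - ?e)"
    using t by (auto simp: set_eq_iff mem axis_def)
  have 4: "?B \<inter> {x. x $ j \<ge> a $ j + t} = cbox (a + axis j t) (a + axis j t + ones)"
    using t by (auto simp: set_eq_iff mem axis_def)
  have "integral (cbox (a + ?e) (a + axis j t + ones)) f
      = integral (cbox a (a + axis j t + ones - ?e)) (\<lambda>x. f (x + ?e))"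
    using integral_shift_cbox[of "a + ?e" ?e "a + axis j t + ones" f] by simp
  also have "(\<lambda>x. f (x + ?e)) = f"
    using periodicD[OF per, of _ "axis j 1"] by (simp add: of_lattice_axis)
  finally have 5: "integral (cbox (a + ?e) (a + axis j t + ones)) f
      = integral (cbox a (a + axis j t + ones - ?e)) f" .
  show ?thesis
    using integral_split[OF int e, of a "a + axis j t + ones" "a $ j + 1"]
      integral_split[OF int e, of a "a + axis j t + ones" "a $ j + t"] 5
    by (simp only: nth 1 2 3 4) (metis add.commute add_right_cancel)
qed

text \<open>After a lattice translation the corner \<open>t\<close> has coordinates in [0,1]; the
  induction over \<open>J\<close> moves the cube from 0 to \<open>t\<close> one coordinate at a
  time.\<close>

lemma integral_unit_cube:
  fixes f :: "real ^ 'n \<Rightarrow> complex"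
  assumes cont: "continuous_on UNIV f" and per: "periodic f"
  shows "integral (cbox a (a + ones)) f = integral (cbox 0 One) f"
proof -
  define z where "z = (\<chi> i. \<lfloor>a $ i\<rfloor>)"
  define t where "t = a - of_lattice z"
  have t01: "0 \<le> t $ i" "t $ i \<le> 1" for i
    using frac_unique_iff[of "a $ i" "frac (a $ i)"] by (auto simp: t_def z_def) linarith
  have "integral (cbox ((\<Sum>j\<in>J. axis j (t $ j))) ((\<Sum>j\<in>J. axis j (t $ j)) + ones)) f
      = integral (cbox 0 (0 + ones)) f" if "finite J" for J :: "'n set"
    using that
  proof induction
    case (insert j J)
    then show ?case
      using integral_unit_cube_shift_axis[OF cont per t01(1) t01(2), of "\<Sum>j\<in>J. axis j (t $ j)" j j]
      by (simp add: add.commute)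
  qed simp
  from this[OF finite, of UNIV]
  have "integral (cbox (\<Sum>j\<in>UNIV. axis j (t $ j)) ((\<Sum>j\<in>UNIV. axis j (t $ j)) + ones)) f
      = integral (cbox 0 One) f" by (simp add: One_eq_ones)
  moreover have "(\<Sum>j\<in>UNIV. axis j (t $ j)) = t"
    by (simp add: vec_eq_iff axis_def)
  ultimately have "integral (cbox t (t + ones)) f = integral (cbox 0 One) f"
    by simp
  moreover have "integral (cbox a (a + ones)) f
      = integral (cbox (a - of_lattice z) (a + ones - of_lattice z)) (\<lambda>x. f (x + of_lattice z))"
    by (simp add: integral_shift_cbox)
  ultimately show ?thesis
    by (simp add: periodicD[OF per] t_def algebra_simps)
qed

lemma integral_periodic_shift:
  fixes f :: "real ^ 'n \<Rightarrow> complex"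
  assumes "continuous_on UNIV f" and "periodic f"
  shows "integral (cbox a (a + ones)) (\<lambda>x. f (x + h)) = integral (cbox 0 One) f"
  using integral_shift_cbox[of "a + h" h "a + h + ones" f] integral_unit_cube[OF assms, of "a + h"]
  by (simp add: algebra_simps)

definition character :: "int ^ 'n \<Rightarrow> real ^ 'n \<Rightarrow> complex" where
  "character \<xi> x = cis (2 * pi * (x \<bullet> of_lattice \<xi>))"

lemma character_add: "character \<xi> (x + y) = character \<xi> x * character \<xi> y"
  and character_add_freq: "character (\<xi> + \<eta>) x = character \<xi> x * character \<eta> x"
  by (simp_all add: character_def cis_mult of_lattice_add inner_add_left inner_add_right distrib_left)

lemma character_0 [simp]: "character \<xi> 0 = 1" and character_0_freq [simp]: "character 0 x = 1"
  by (simp_all add: character_def)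

lemma norm_character [simp]: "norm (character \<xi> x) = 1"
  by (simp add: character_def)

lemma character_minus: "character \<xi> (- x) = cis (- (2 * pi * (x \<bullet> of_lattice \<xi>)))"
  by (simp add: character_def)

lemma character_minus_freq: "character (- \<xi>) x = character \<xi> (- x)"
  by (simp add: character_def of_lattice_minus)

lemma cnj_character: "cnj (character \<xi> x) = character \<xi> (- x)"
  by (simp add: character_def cis_cnj)

lemma character_cancel [simp]: "character \<xi> x * character \<xi> (- x) = 1"
  by (simp flip: character_add)

lemma character_lattice [simp]: "character \<xi> (of_lattice z) = 1"
proof -
  have "of_lattice z \<bullet> of_lattice \<xi> = of_int (\<Sum>i\<in>UNIV. z $ i * \<xi> $ i)"
    by (simp add: inner_vec_def)
  then show ?thesis
    by (metis character_def cis_multiple_2pi Ints_of_int)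
qed

lemma periodic_character: "periodic (character \<xi>)"
  by (simp add: periodic_def character_add)

lemma continuous_on_character [continuous_intros]:
  "continuous_on S f \<Longrightarrow> continuous_on S (\<lambda>x. character \<xi> (f x))"
  unfolding character_def by (intro continuous_intros)

lemma fourier_coeff_character_def:
  "fourier_coeff f \<xi> = integral (cbox 0 One) (\<lambda>x. character \<xi> (- x) * f x)"
  by (simp add: fourier_coeff_def character_minus)

lemma integral_character:
  "integral (cbox 0 One) (character \<xi>) = (if \<xi> = 0 then 1 else 0)"
proof (cases "\<xi> = 0")
  case True
  then show ?thesis
    by (simp add: fun_eq_iff content_cbox_cart One_eq_ones)
       (simp add: character_def[abs_def] content_cbox_cart interval_eq_empty_cart box_ne_empty)
next
  case False
  then obtain j where j: "\<xi> $ j \<noteq> 0" by (auto simp: vec_eq_iff)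
  \<comment> \<open>Half a period in a direction where the frequency is nonzero: the translation
    flips the sign of the character but preserves its integral.\<close>
  define h where "h = (axis j (1 / (2 * of_int (\<xi> $ j))) :: real ^ 'a)"
  have h: "character \<xi> h = - 1"
    using j by (simp add: character_def h_def inner_axis')
  have "integral (cbox 0 One) (character \<xi>)
      = integral (cbox 0 (0 + ones)) (\<lambda>x. character \<xi> (x + h))"
    by (rule integral_periodic_shift[symmetric])
       (auto intro!: continuous_intros simp: periodic_character)
  also have "\<dots> = - integral (cbox 0 One) (character \<xi>)"
    by (simp add: character_add h One_eq_ones)
  finally have "integral (cbox 0 One) (character \<xi>) = 0" by simp
  with False show ?thesis by simp
qed

section \<open>Trigonometric polynomials\<close>

text \<open>Convolution kernel of the Fourier multiplier \<open>b\<close>, reflected in z so that it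
  is integrated against \<open>f (z + x)\<close>.\<close>

definition trig :: "(int ^ 'n \<Rightarrow> complex) \<Rightarrow> real ^ 'n \<Rightarrow> complex" where
  "trig b z = (\<Sum>\<xi> | b \<xi> \<noteq> 0. b \<xi> * character \<xi> (- z))"

lemma trig_eq_sum:
  assumes "finite S" and "{\<xi>. b \<xi> \<noteq> 0} \<subseteq> S"
  shows "trig b z = (\<Sum>\<xi>\<in>S. b \<xi> * character \<xi> (- z))"
  unfolding trig_def using assms by (intro sum.mono_neutral_left) auto

lemma continuous_on_trig [continuous_intros]:
  "continuous_on S f \<Longrightarrow> continuous_on S (\<lambda>x. trig b (f x))"
  unfolding trig_def by (intro continuous_intros)

lemma integrable_continuous_UNIV:
  fixes f :: "'a::euclidean_space \<Rightarrow> 'b::banach"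
  shows "continuous_on UNIV f \<Longrightarrow> f integrable_on cbox a b"
  by (rule integrable_continuous[OF continuous_on_subset]) auto

lemma periodic_mult: "periodic f \<Longrightarrow> periodic g \<Longrightarrow> periodic (\<lambda>x. f x * g x)"
  by (simp add: periodic_def)

lemma periodic_character_minus: "periodic (\<lambda>x. character \<xi> (- x))"
  using periodic_character[of "- \<xi>"] by (simp add: character_minus_freq[abs_def] periodic_def)

text \<open>For fixed x the coefficients \<open>b\<close> may be a symbol frozen at x, so operators
  with x-dependent symbols are covered. The free corner \<open>a\<close> lets z range over the cube
  centred at the origin, where |z| is the distance to 0 in the torus.\<close>

lemma sum_character_fourier_coeff:
  assumes "finite S" "{\<xi>. b \<xi> \<noteq> 0} \<subseteq> S"
    and cont: "continuous_on UNIV f" and per: "periodic f"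
  shows "(\<Sum>\<xi>\<in>S. character \<xi> x * b \<xi> * fourier_coeff f \<xi>)
    = integral (cbox a (a + ones)) (\<lambda>z. trig b z * f (z + x))"
proof -
  have *: "integral (cbox a (a + ones)) (\<lambda>z. character \<xi> (- z) * f (z + x))
      = character \<xi> x * fourier_coeff f \<xi>" for \<xi>
  proof -
    have "integral (cbox a (a + ones)) (\<lambda>z. character \<xi> (- (z + x)) * f (z + x)) = fourier_coeff f \<xi>"
      unfolding fourier_coeff_character_def
      by (rule integral_periodic_shift[where f="\<lambda>x. character \<xi> (- x) * f x"])
         (intro continuous_intros cont periodic_mult periodic_character_minus per)+
    moreover have "character \<xi> (- z) * f (z + x)
        = character \<xi> x * (character \<xi> (- (z + x)) * f (z + x))" for z
      using character_add[of \<xi> x "- (z + x)"] by simp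
    then have "(\<lambda>z. character \<xi> (- z) * f (z + x))
        = (\<lambda>z. character \<xi> x * (character \<xi> (- (z + x)) * f (z + x)))"
      by (rule ext)
    ultimately show ?thesis by (simp only: integral_mult_right)
  qed
  have "integral (cbox a (a + ones)) (\<lambda>z. trig b z * f (z + x))
      = integral (cbox a (a + ones)) (\<lambda>z. \<Sum>\<xi>\<in>S. b \<xi> * (character \<xi> (- z) * f (z + x)))"
    by (simp add: trig_eq_sum[OF assms(1,2)] sum_distrib_right mult.assoc)
  also have "\<dots> = (\<Sum>\<xi>\<in>S. integral (cbox a (a + ones)) (\<lambda>z. b \<xi> * (character \<xi> (- z) * f (z + x))))"
    by (rule integral_sum[OF assms(1)], rule integrable_continuous_UNIV)
       (intro continuous_intros continuous_on_compose2[OF cont]; simp)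
  also have "\<dots> = (\<Sum>\<xi>\<in>S. character \<xi> x * b \<xi> * fourier_coeff f \<xi>)"
    by (simp add: * mult_ac)
  finally show ?thesis ..
qed

lemma parseval:
  assumes "finite S" "{\<xi>. b \<xi> \<noteq> 0} \<subseteq> S"
  shows "integral (cbox a (a + ones)) (\<lambda>z. (norm (trig b z))\<^sup>2) = (\<Sum>\<xi>\<in>S. (norm (b \<xi>))\<^sup>2)"
proof -
  let ?F = "\<lambda>z. trig b z * cnj (trig b z)"
  have F: "?F z = (\<Sum>\<xi>\<in>S. \<Sum>\<eta>\<in>S. b \<xi> * cnj (b \<eta>) * character (\<eta> - \<xi>) z)" for z
  proof -
    have "character (\<eta> - \<xi>) z = character \<xi> (- z) * character \<eta> z" for \<xi> \<eta>
      by (metis character_add_freq character_minus_freq diff_conv_add_uminus mult.commute)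
    then show ?thesis
      by (simp add: trig_eq_sum[OF assms] sum_product cnj_character mult_ac)
  qed
  have I: "integral (cbox a (a + ones)) (character \<xi>) = (if \<xi> = 0 then 1 else 0)" for \<xi> :: "int ^ 'a"
    by (subst integral_unit_cube)
       (auto intro!: continuous_intros simp: periodic_character integral_character)
  have cF: "continuous_on UNIV ?F" by (intro continuous_intros)
  have "integral (cbox a (a + ones)) ?F
      = (\<Sum>\<xi>\<in>S. \<Sum>\<eta>\<in>S. integral (cbox a (a + ones)) (\<lambda>z. b \<xi> * cnj (b \<eta>) * character (\<eta> - \<xi>) z))"
    unfolding F
    by (subst integral_sum, rule assms, rule integrable_continuous_UNIV, intro continuous_intros,
        intro sum.cong refl integral_sum, rule assms, rule integrable_continuous_UNIV, intro continuous_intros)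
  also have "\<dots> = (\<Sum>\<xi>\<in>S. b \<xi> * cnj (b \<xi>))"
    using assms(1) by (auto simp: I intro!: sum.cong simp: if_distrib[of "(*) _"] cong: if_cong)
  finally have *: "integral (cbox a (a + ones)) ?F = (\<Sum>\<xi>\<in>S. b \<xi> * cnj (b \<xi>))" .
  have "integral (cbox a (a + ones)) (Re \<circ> ?F) = Re (integral (cbox a (a + ones)) ?F)"
    by (rule integral_linear[OF integrable_continuous_UNIV[OF cF] bounded_linear_Re])
  also have "Re \<circ> ?F = (\<lambda>z. (norm (trig b z))\<^sup>2)"
    by (simp add: fun_eq_iff complex_mult_cnj cmod_power2)
  finally show ?thesis
    by (simp only: *) (simp add: complex_mult_cnj cmod_power2)
qed

section \<open>Differences in frequency and finite boxes\<close>

lemma difference_eq_0: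
  "(\<And>i. i \<le> p \<Longrightarrow> f (\<xi> + axis j (int i)) = 0) \<Longrightarrow> (difference j ^^ p) f \<xi> = 0"
proof (induction p arbitrary: \<xi>)
  case (Suc p)
  have shift: "\<xi> + axis j 1 + axis j (int i) = \<xi> + axis j (int (Suc i))" for i
    by (simp add: vec_eq_iff axis_def)
  have "(difference j ^^ p) f \<xi> = 0" using Suc by simp
  moreover have "(difference j ^^ p) f (\<xi> + axis j 1) = 0"
    by (rule Suc.IH) (simp only: shift, rule Suc.prems, simp)
  ultimately show ?case by (simp add: difference_def[of j "(difference j ^^ p) f"])
next
  case 0
  have "axis j 0 = (0 :: int ^ 'a)" by (simp add: vec_eq_iff axis_def)
  with 0[of 0] show ?case by simp
qed

definition lattice_box :: "nat \<Rightarrow> (int ^ 'n) set" where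
  "lattice_box N = {\<xi>. \<forall>i. \<bar>\<xi> $ i\<bar> \<le> int N}"

lemma lattice_box_eq_image:
  "lattice_box N = vec_lambda ` (PiE UNIV (\<lambda>_. {- int N..int N}))"
proof (intro set_eqI iffI)
  fix \<xi> :: "int ^ 'n" assume "\<xi> \<in> lattice_box N"
  then show "\<xi> \<in> vec_lambda ` (PiE UNIV (\<lambda>_. {- int N..int N}))"
    by (intro image_eqI[of _ _ "vec_nth \<xi>"]) (auto simp: lattice_box_def abs_le_iff minus_le_iff)
qed (auto simp: lattice_box_def abs_le_iff minus_le_iff Ball_def PiE_iff)

lemma finite_lattice_box [simp]: "finite (lattice_box N :: (int ^ 'n) set)"
  unfolding lattice_box_eq_image by (intro finite_imageI finite_PiE) auto

lemma card_lattice_box_le: "card (lattice_box N :: (int ^ 'n) set) \<le> (2 * N + 1) ^ CARD('n)"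
proof -
  have "card (lattice_box N :: (int ^ 'n) set) \<le> card (PiE (UNIV :: 'n set) (\<lambda>_. {- int N..int N}))"
    unfolding lattice_box_eq_image by (intro card_image_le finite_PiE) auto
  also have "\<dots> = (2 * N + 1) ^ CARD('n)"
    by (simp add: card_PiE nat_add_distrib nat_mult_distrib)
  finally show ?thesis .
qed

lemma difference_outside_box:
  assumes "\<And>\<xi>. \<xi> \<notin> lattice_box N \<Longrightarrow> b \<xi> = 0" and "\<xi> \<notin> lattice_box (N + p)"
  shows "(difference j ^^ p) b \<xi> = 0"
proof (rule difference_eq_0)
  fix i assume i: "i \<le> p"
  obtain l where "\<bar>\<xi> $ l\<bar> > int (N + p)" using assms(2) by (auto simp: lattice_box_def not_le)
  then have "\<bar>(\<xi> + axis j (int i)) $ l\<bar> > int N" using i by (auto simp: axis_def)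
  then have "\<xi> + axis j (int i) \<notin> lattice_box N" by (auto simp: lattice_box_def not_le)
  then show "b (\<xi> + axis j (int i)) = 0" by (rule assms(1))
qed

text \<open>Summation by parts. This is the discrete form of the rule that derivatives in frequency
  become multiplication by the space variable: the factor \<open>character (axis j 1) z - 1\<close>
  stands for 2 pi i z_j.\<close>

lemma trig_difference:
  assumes "finite {\<xi>. b \<xi> \<noteq> 0}"
  shows "trig (difference j b) z = (character (axis j 1) z - 1) * trig b z"
proof -
  let ?e = "axis j 1 :: int ^ 'a" and ?S = "{\<xi>. b \<xi> \<noteq> 0}"
  let ?S' = "?S \<union> (\<lambda>\<xi>. \<xi> - ?e) ` ?S"
  have fin: "finite ?S'" using assms by simp
  have "trig (difference j b) z = (\<Sum>\<xi>\<in>?S'. difference j b \<xi> * character \<xi> (- z))"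
    by (rule trig_eq_sum[OF fin]) (force simp: difference_def image_iff)
  also have "\<dots> = (\<Sum>\<xi>\<in>?S'. b (\<xi> + ?e) * character \<xi> (- z)) - trig b z"
    by (subst trig_eq_sum[OF fin, of b]) (auto simp: difference_def left_diff_distrib sum_subtractf)
  also have "(\<Sum>\<xi>\<in>?S'. b (\<xi> + ?e) * character \<xi> (- z))
      = (\<Sum>\<xi>\<in>(\<lambda>\<xi>. \<xi> + ?e) ` ?S'. b \<xi> * character (\<xi> - ?e) (- z))"
    by (subst sum.reindex) (auto simp: inj_on_def)
  also have "\<dots> = (\<Sum>\<xi>\<in>(\<lambda>\<xi>. \<xi> + ?e) ` ?S'. character ?e z * (b \<xi> * character \<xi> (- z)))"
  proof (intro sum.cong refl)
    fix \<xi>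
    have "character (\<xi> - ?e) (- z) = character ?e z * character \<xi> (- z)"
      using character_add_freq[of \<xi> "- ?e" "- z"] by (simp add: character_minus_freq mult.commute)
    then show "b \<xi> * character (\<xi> - ?e) (- z) = character ?e z * (b \<xi> * character \<xi> (- z))" by simp
  qed
  also have "\<dots> = character ?e z * trig b z"
  proof -
    have "finite ((\<lambda>\<xi>. \<xi> + ?e) ` ?S')" using fin by simp
    moreover have "?S \<subseteq> (\<lambda>\<xi>. \<xi> + ?e) ` ?S'"
    proof
      fix \<xi> assume "\<xi> \<in> ?S"
      then show "\<xi> \<in> (\<lambda>\<xi>. \<xi> + ?e) ` ?S'" by (intro image_eqI[of _ _ "\<xi> - ?e"]) auto
    qed
    ultimately show ?thesis by (subst trig_eq_sum[where b=b]) (auto simp: sum_distrib_left)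
  qed
  finally show ?thesis by (simp add: algebra_simps)
qed

lemma trig_difference_funpow:
  assumes "finite {\<xi>. b \<xi> \<noteq> 0}"
  shows "trig ((difference j ^^ p) b) z = (character (axis j 1) z - 1) ^ p * trig b z
    \<and> finite {\<xi>. (difference j ^^ p) b \<xi> \<noteq> 0}"
proof (induction p)
  case (Suc p)
  let ?d = "(difference j ^^ p) b"
  have "{\<xi>. difference j ?d \<xi> \<noteq> 0} \<subseteq> {\<xi>. ?d \<xi> \<noteq> 0} \<union> (\<lambda>\<xi>. \<xi> - axis j 1) ` {\<xi>. ?d \<xi> \<noteq> 0}"
    by (force simp: difference_def image_iff)
  with Suc have "finite {\<xi>. difference j ?d \<xi> \<noteq> 0}"
    by (meson finite_UnI finite_imageI finite_subset)
  with Suc show ?case by (simp add: trig_difference)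
qed (simp add: assms)

section \<open>The kernel estimate\<close>

text \<open>Kept in the form \<open>cbox a (a + ones)\<close> of the integral lemmas above. The
  corners are -1/2 and 1/2, which is the range of \<open>norm_cis_minus_1_ge\<close>.\<close>

definition centered_cube :: "(real ^ 'n) set" where
  "centered_cube = cbox (- (1/2) *\<^sub>R ones) (- (1/2) *\<^sub>R ones + ones)"

lemma mem_centered_cube: "z \<in> centered_cube \<longleftrightarrow> (\<forall>i. \<bar>z $ i\<bar> \<le> 1/2)"
proof -
  have "(- (1/2) *\<^sub>R ones) $ i \<le> z $ i \<and> z $ i \<le> (- (1/2) *\<^sub>R ones + ones) $ i \<longleftrightarrow> \<bar>z $ i\<bar> \<le> 1/2" for i
    by (auto simp: abs_if)
  then show ?thesis by (simp only: centered_cube_def mem_box_cart)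
qed

text \<open>The chord has length 2 |sin (pi t)|, so sin x >= x / pi on [0, pi/2] is enough. Up to
  pi/3, where the cosine has come down to 1/2, the function sin x - x/2 is nondecreasing; beyond,
  sin x >= 1/2 >= x / pi.\<close>

lemma norm_cis_minus_1_ge:
  assumes "\<bar>t\<bar> \<le> 1/2"
  shows "norm (cis (2 * pi * t) - 1) \<ge> 2 * \<bar>t\<bar>"
proof -
  have *: "sin x \<ge> x / pi" if x: "0 \<le> x" "x \<le> pi / 2" for x :: real
  proof (cases "x \<le> pi / 3")
    case True
    have "(\<lambda>x. sin x - x / 2) 0 \<le> (\<lambda>x. sin x - x / 2) x"
    proof (rule DERIV_nonneg_imp_nondecreasing[OF x(1)])
      fix y assume y: "0 \<le> y" "y \<le> x"
      have "cos (pi / 3) \<le> cos y" using y True by (intro cos_monotone_0_pi_le) auto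
      moreover have "((\<lambda>x. sin x - x / 2) has_real_derivative cos y - 1 / 2) (at y)"
        by (auto intro!: derivative_eq_intros)
      ultimately show "\<exists>d. ((\<lambda>x. sin x - x / 2) has_real_derivative d) (at y) \<and> 0 \<le> d"
        by (intro exI[of _ "cos y - 1 / 2"]) (simp add: cos_60)
    qed
    moreover have "x / pi \<le> x / 2" using x pi_gt3 by (intro divide_left_mono) auto
    ultimately have "x / 2 \<le> sin x" "x / pi \<le> x / 2" by simp_all
    then show ?thesis by (rule order_trans[rotated])
  next
    case False
    have "sin (pi / 6) \<le> sin x" using x False by (intro sin_monotone_2pi_le) auto
    moreover have "x / pi \<le> 1 / 2" using x by (simp add: field_simps)
    ultimately show ?thesis by (simp only: sin_30)
  qed
  have "norm (cis (2 * pi * t) - 1) = 2 * \<bar>sin (pi * t)\<bar>"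
    using dist_exp_i_1[of "2 * pi * t"] by (simp add: cis_conv_exp)
  moreover have "\<bar>sin (pi * t)\<bar> = sin (pi * \<bar>t\<bar>)"
  proof -
    have "0 \<le> sin (pi * \<bar>t\<bar>)" using assms by (intro sin_ge_zero) auto
    then show ?thesis by (cases "t \<ge> 0") auto
  qed
  moreover have "sin (pi * \<bar>t\<bar>) \<ge> \<bar>t\<bar>"
    using *[of "pi * \<bar>t\<bar>"] assms by auto
  ultimately show ?thesis by simp
qed

lemma indicator_cbox_has_integral:
  "((indicator (cbox c d) :: 'a::euclidean_space \<Rightarrow> real) has_integral measure lborel (cbox a b \<inter> cbox c d)) (cbox a b)"
proof -
  obtain u v where uv: "cbox a b \<inter> cbox c d = cbox u v" using Int_interval by blast
  have "((\<lambda>x. 1 :: real) has_integral measure lborel (cbox u v)) (cbox u v)"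
    using has_integral_const[of "1 :: real" u v] by simp
  then have "((\<lambda>x. if x \<in> cbox u v then 1 else 0 :: real) has_integral measure lborel (cbox u v)) (cbox a b)"
    by (rule has_integral_restrict_closed_subinterval) (use uv in auto)
  then show ?thesis
    unfolding uv[symmetric] by (rule has_integral_eq[rotated]) (auto simp: indicator_def)
qed

lemma content_Int_le:
  "measure lborel (cbox a b \<inter> cbox c d) \<le> measure lborel (cbox c d)"
proof -
  obtain u v where uv: "cbox a b \<inter> cbox c d = cbox u v" using Int_interval by blast
  then have "cbox u v \<subseteq> cbox c d" by blast
  then show ?thesis unfolding uv by (rule content_subset)
qed

text \<open>Periodic version of 1 + (r |z|)^(2p). The chords
  \<open>norm (character (axis j 1) z - 1)\<close> are comparable to |z_j| on the centred cube, and
  by \<open>trig_difference_funpow\<close> their powers turn into p-th differences of the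
  coefficients without any error term.\<close>

definition weight :: "nat \<Rightarrow> real \<Rightarrow> real ^ 'n \<Rightarrow> real" where
  "weight p r z = 1 + (\<Sum>j\<in>UNIV. (r * norm (character (axis j 1) z - 1)) ^ (2 * p))"

lemma weight_ge_1: "weight p r z \<ge> 1"
  by (simp add: weight_def sum_nonneg zero_le_even_power)

lemma continuous_on_weight [continuous_intros]: "continuous_on S (weight p r)"
  unfolding weight_def[abs_def] by (intro continuous_intros)

text \<open>Parseval for \<open>b\<close> and for its p-th difference in each of the n directions,
  hence the factor 1 + n. All these coefficients live in the box of radius N + p, which has at most
  (2 (N + p) + 1)^n <= (5 N)^n points.\<close>

lemma integral_trig_weight_le:
  fixes b :: "int ^ 'n \<Rightarrow> complex"
  assumes supp: "\<And>\<xi>. \<xi> \<notin> lattice_box N \<Longrightarrow> b \<xi> = 0" and N: "1 \<le> N" "p \<le> N" and r: "0 < r"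
    and bM: "\<And>\<xi>. norm (b \<xi>) \<le> M"
    and dM: "\<And>j \<xi>. r ^ p * norm ((difference j ^^ p) b \<xi>) \<le> M"
  shows "integral centered_cube (\<lambda>z. (norm (trig b z))\<^sup>2 * weight p r z)
    \<le> (1 + real CARD('n)) * 5 ^ CARD('n) * M\<^sup>2 * real N ^ CARD('n)"
proof -
  let ?Q = "centered_cube :: (real ^ 'n) set" and ?d = "\<lambda>j. (difference j ^^ p) b"
  let ?K = "5 ^ CARD('n) * real N ^ CARD('n) * M\<^sup>2"
  have M: "M \<ge> 0" using bM[of 0] norm_ge_zero order_trans by blast
  have fin: "finite {\<xi>. b \<xi> \<noteq> 0}"
    by (rule finite_subset[OF _ finite_lattice_box[of N]]) (use supp in auto)
  have energy: "integral ?Q (\<lambda>z. (norm (trig c z))\<^sup>2) \<le> (5 * real N) ^ CARD('n) * D\<^sup>2"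
    if c: "\<And>\<xi>. \<xi> \<notin> lattice_box (N + p) \<Longrightarrow> c \<xi> = 0" and D: "\<And>\<xi>. norm (c \<xi>) \<le> D" for c :: "int ^ 'n \<Rightarrow> complex" and D
  proof -
    let ?B = "lattice_box (N + p) :: (int ^ 'n) set"
    have "integral ?Q (\<lambda>z. (norm (trig c z))\<^sup>2) = (\<Sum>\<xi>\<in>?B. (norm (c \<xi>))\<^sup>2)"
      unfolding centered_cube_def by (rule parseval) (use c in auto)
    also have "\<dots> \<le> (\<Sum>\<xi>\<in>?B. D\<^sup>2)"
      by (intro sum_mono power_mono D) auto
    also have "\<dots> = real (card ?B) * D\<^sup>2" by simp
    also have "real (card ?B) \<le> real ((2 * (N + p) + 1) ^ CARD('n))"
      using card_lattice_box_le by (rule of_nat_mono)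
    also have "\<dots> \<le> (5 * real N) ^ CARD('n)"
      unfolding of_nat_power by (intro power_mono) (use N in auto)
    finally show ?thesis by (simp add: mult_right_mono)
  qed
  have cont: "continuous_on UNIV (\<lambda>z. (norm (trig c z))\<^sup>2)" for c :: "int ^ 'n \<Rightarrow> complex"
    by (intro continuous_intros)
  have int: "(\<lambda>z. (norm (trig c z))\<^sup>2) integrable_on ?Q" for c :: "int ^ 'n \<Rightarrow> complex"
    unfolding centered_cube_def by (rule integrable_continuous_UNIV[OF cont])
  have eq: "(norm (trig b z))\<^sup>2 * weight p r z
      = (norm (trig b z))\<^sup>2 + (\<Sum>j\<in>UNIV. r ^ (2 * p) * (norm (trig (?d j) z))\<^sup>2)" for z
  proof -
    have "norm (trig (?d j) z) = norm (character (axis j 1) z - 1) ^ p * norm (trig b z)" for j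
      by (simp add: trig_difference_funpow[OF fin, THEN conjunct1] norm_mult norm_power)
    then have "(norm (trig (?d j) z))\<^sup>2 = norm (character (axis j 1) z - 1) ^ (2 * p) * (norm (trig b z))\<^sup>2" for j
      by (simp add: power_mult_distrib mult.commute[of 2] flip: power_mult)
    then show ?thesis
      by (simp add: weight_def distrib_left sum_distrib_left power_mult_distrib mult_ac)
  qed
  have "integral ?Q (\<lambda>z. (norm (trig b z))\<^sup>2 * weight p r z)
     = integral ?Q (\<lambda>z. (norm (trig b z))\<^sup>2)
      + (\<Sum>j\<in>UNIV. r ^ (2 * p) * integral ?Q (\<lambda>z. (norm (trig (?d j) z))\<^sup>2))"
    unfolding eq
    by (subst integral_add, rule int, intro integrable_sum integrable_on_mult_right int, simp,
        subst integral_sum, simp, intro integrable_on_mult_right int, simp)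
  also have "integral ?Q (\<lambda>z. (norm (trig b z))\<^sup>2) \<le> ?K"
  proof -
    have "b \<xi> = 0" if "\<xi> \<notin> lattice_box (N + p)" for \<xi>
      using that by (intro supp) (auto simp: lattice_box_def intro: order_trans)
    from energy[of b M, OF this bM] show ?thesis by (simp add: power_mult_distrib)
  qed
  also have "(\<Sum>j\<in>UNIV. r ^ (2 * p) * integral ?Q (\<lambda>z. (norm (trig (?d j) z))\<^sup>2)) \<le> (\<Sum>j\<in>(UNIV :: 'n set). ?K)"
  proof (intro sum_mono)
    fix j :: 'n
    have "integral ?Q (\<lambda>z. (norm (trig (?d j) z))\<^sup>2) \<le> (5 * real N) ^ CARD('n) * (M / r ^ p)\<^sup>2"
      using r dM[of j] by (intro energy difference_outside_box[OF supp]) (auto simp: field_simps)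
    then have "r ^ (2 * p) * integral ?Q (\<lambda>z. (norm (trig (?d j) z))\<^sup>2)
        \<le> r ^ (2 * p) * ((5 * real N) ^ CARD('n) * (M / r ^ p)\<^sup>2)"
      using r by (intro mult_left_mono) auto
    also have "\<dots> = ?K" using r by (simp add: power_divide power_mult_distrib power_mult[symmetric] mult.commute[of p])
    finally show "r ^ (2 * p) * integral ?Q (\<lambda>z. (norm (trig (?d j) z))\<^sup>2) \<le> ?K" .
  qed
  finally show ?thesis by (simp add: algebra_simps)
qed

text \<open>Take the least \<open>i\<close> for which the cube condition holds. If i > 0, minimality
  gives a coordinate with |z_l| r > 2^(i-1), and the chord bound 2 |z_l| recovers the missing factor
  2.\<close>

lemma weight_dyadic:
  fixes z :: "real ^ 'n"
  assumes r: "0 < r" and I: "r \<le> 2 ^ I" and z: "z \<in> centered_cube"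
  obtains i where "i \<le> I" "\<And>l. \<bar>z $ l\<bar> * r \<le> 2 ^ i" "2 ^ (2 * p * i) \<le> weight p r z"
proof -
  define P where "P i \<longleftrightarrow> (\<forall>l. \<bar>z $ l\<bar> * r \<le> 2 ^ i)" for i
  have zl: "\<bar>z $ l\<bar> \<le> 1/2" for l using z by (simp add: mem_centered_cube)
  have PI: "P I" unfolding P_def
  proof
    fix l
    have "\<bar>z $ l\<bar> * r \<le> 1 * 2 ^ I" using zl[of l] r I by (intro mult_mono) auto
    then show "\<bar>z $ l\<bar> * r \<le> 2 ^ I" by simp
  qed
  define i where "i = (LEAST i. P i)"
  have "P i" "i \<le> I" unfolding i_def using PI by (auto intro: LeastI Least_le)
  moreover have "2 ^ (2 * p * i) \<le> weight p r z"
  proof (cases i)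
    case 0
    then show ?thesis using weight_ge_1 by simp
  next
    case (Suc i')
    then have "\<not> P i'" unfolding i_def using not_less_Least[of i' P] by (auto simp: i_def)
    then obtain l where l: "2 ^ i' < \<bar>z $ l\<bar> * r" by (auto simp: P_def not_le)
    have "character (axis l 1) z = cis (2 * pi * (z $ l))"
      by (simp add: character_def of_lattice_axis inner_axis)
    then have "2 * \<bar>z $ l\<bar> \<le> norm (character (axis l 1) z - 1)"
      using norm_cis_minus_1_ge[OF zl[of l]] by simp
    then have "r * (2 * \<bar>z $ l\<bar>) \<le> r * norm (character (axis l 1) z - 1)"
      using r by (intro mult_left_mono) auto
    with l have "2 ^ i \<le> r * norm (character (axis l 1) z - 1)"
      by (simp add: Suc mult_ac)
    then have "(2 ^ i) ^ (2 * p) \<le> (r * norm (character (axis l 1) z - 1)) ^ (2 * p)"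
      by (intro power_mono) auto
    also have "\<dots> \<le> (\<Sum>j\<in>UNIV. (r * norm (character (axis j 1) z - 1)) ^ (2 * p))"
      by (rule member_le_sum) (auto simp: zero_le_even_power)
    also have "\<dots> \<le> weight p r z" by (simp add: weight_def)
    finally show ?thesis by (simp add: power_mult[symmetric] mult_ac)
  qed
  ultimately show ?thesis using that unfolding P_def by blast
qed

text \<open>At dyadic level i the integrand is at most G^2 2^(i (2s - 2p)) and the cube has volume
  (2 * 2^i / r)^n. The hypothesis on \<open>p\<close> makes the exponent 2s - 2p + n at most -1, so
  the levels sum to at most twice the term at i = 0.\<close>

lemma integral_div_weight_le:
  fixes g :: "real ^ 'n \<Rightarrow> complex"
  assumes r: "0 < r" and p: "real CARD('n) + 2 * s + 1 \<le> 2 * real p"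
    and cont: "continuous_on UNIV g"
    and g: "\<And>i z. z \<in> centered_cube \<Longrightarrow> (\<And>l. \<bar>z $ l\<bar> * r \<le> 2 ^ i) \<Longrightarrow> norm (g z) \<le> G * 2 powr (real i * s)"
  shows "integral centered_cube (\<lambda>z. (norm (g z))\<^sup>2 / weight p r z) \<le> 2 * 2 ^ CARD('n) * G\<^sup>2 / r ^ CARD('n)"
proof -
  let ?n = "CARD('n)" and ?Q = "centered_cube :: (real ^ 'n) set"
  obtain I where I: "r \<le> 2 ^ I" using real_arch_pow[of 2 r] by (auto intro: less_imp_le)
  define C where "C i = cbox (- (2 ^ i / r) *\<^sub>R ones) ((2 ^ i / r) *\<^sub>R ones :: real ^ 'n)" for i :: nat
  have memC: "z \<in> C i \<longleftrightarrow> (\<forall>l. \<bar>z $ l\<bar> * r \<le> 2 ^ i)" for z i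
  proof -
    have "(- (2 ^ i / r) *\<^sub>R ones) $ l \<le> z $ l \<and> z $ l \<le> ((2 ^ i / r) *\<^sub>R ones) $ l \<longleftrightarrow> \<bar>z $ l\<bar> * r \<le> 2 ^ i" for l
      using pos_le_divide_eq[OF r, of "\<bar>z $ l\<bar>" "2 ^ i"] by (simp add: abs_le_iff) linarith
    then show ?thesis by (simp only: C_def mem_box_cart)
  qed
  have contC: "measure lborel (C i) = (2 * 2 ^ i / r) ^ ?n" for i
  proof -
    have "0 \<in> C i" by (simp add: memC)
    then have "C i \<noteq> {}" by auto
    then show ?thesis unfolding C_def by (subst content_cbox_cart) auto
  qed
  define c where "c i = G\<^sup>2 * 2 powr (real i * (2 * s - 2 * real p))" for i :: nat
  \<comment> \<open>Whole cubes replace dyadic shells: all terms are nonnegative, so the single term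
    with the index found for z already dominates the integrand at z.\<close>
  define h where "h z = (\<Sum>i\<le>I. c i * indicator (C i) z)" for z
  have "((\<lambda>z. c i * indicator (C i) z) has_integral c i * measure lborel (?Q \<inter> C i)) ?Q" for i
    unfolding C_def centered_cube_def by (intro has_integral_mult_right indicator_cbox_has_integral)
  then have h: "(h has_integral (\<Sum>i\<le>I. c i * measure lborel (?Q \<inter> C i))) ?Q"
    unfolding h_def[abs_def] by (intro has_integral_sum) auto
  have "integral ?Q (\<lambda>z. (norm (g z))\<^sup>2 / weight p r z) \<le> integral ?Q h"
  proof (rule integral_le)
    have "weight p r z \<noteq> 0" for z :: "real ^ 'n" using weight_ge_1[of p r z] by simp
    then show "(\<lambda>z. (norm (g z))\<^sup>2 / weight p r z) integrable_on ?Q"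
      unfolding centered_cube_def
      by (intro integrable_continuous_UNIV continuous_intros cont) auto
    show "h integrable_on ?Q" using h by blast
    fix z assume z: "z \<in> ?Q"
    obtain i where i: "i \<le> I" "\<And>l. \<bar>z $ l\<bar> * r \<le> 2 ^ i" "2 ^ (2 * p * i) \<le> weight p r z"
      using weight_dyadic[OF r I z] by blast
    have "(norm (g z))\<^sup>2 / weight p r z \<le> (G * 2 powr (real i * s))\<^sup>2 / 2 ^ (2 * p * i)"
      by (intro frac_le power_mono g z i) auto
    also have "(2 :: real) ^ (2 * p * i) = 2 powr (real i * (2 * real p))"
      by (simp add: powr_realpow[symmetric] mult_ac)
    also have "(G * 2 powr (real i * s))\<^sup>2 / 2 powr (real i * (2 * real p)) = c i"
    proof -
      have "(2 powr (real i * s))\<^sup>2 / 2 powr (real i * (2 * real p)) = 2 powr (real i * s + real i * s - real i * (2 * real p))"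
        by (simp only: power2_eq_square powr_add powr_diff)
      then show ?thesis
        by (simp only: c_def power_mult_distrib times_divide_eq_right[symmetric]) (simp add: algebra_simps)
    qed
    also have "\<dots> = c i * indicator (C i) z" using i by (simp add: memC)
    also have "\<dots> \<le> h z"
      unfolding h_def using i by (intro member_le_sum) (auto simp: c_def)
    finally show "(norm (g z))\<^sup>2 / weight p r z \<le> h z" .
  qed
  also have "\<dots> = (\<Sum>i\<le>I. c i * measure lborel (?Q \<inter> C i))" using h by blast
  also have "\<dots> \<le> (\<Sum>i\<le>I. 2 ^ ?n * G\<^sup>2 / r ^ ?n * (1/2) ^ i)"
  proof (intro sum_mono)
    fix i
    have "c i * measure lborel (?Q \<inter> C i) \<le> c i * (2 * 2 ^ i / r) ^ ?n"
      unfolding contC[symmetric] unfolding C_def centered_cube_def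
      by (intro mult_left_mono content_Int_le) (simp add: c_def)
    also have "\<dots> = 2 ^ ?n * G\<^sup>2 / r ^ ?n * (2 powr (real i * (2 * s - 2 * real p)) * 2 powr (real i * real ?n))"
    proof -
      have "(2 ^ i) ^ ?n = (2 :: real) powr (real i * real ?n)"
        by (simp add: powr_realpow flip: power_mult of_nat_mult)
      then show ?thesis by (simp add: c_def power_divide power_mult_distrib)
    qed
    also have "2 powr (real i * (2 * s - 2 * real p)) * 2 powr (real i * real ?n)
        = 2 powr (real i * (2 * s - 2 * real p + real ?n))"
      by (simp add: powr_add[symmetric] distrib_left)
    also have "\<dots> \<le> 2 powr (real i * (-1))"
      using p by (intro powr_mono mult_left_mono) auto
    also have "\<dots> = (1/2) ^ i"
      by (simp add: powr_minus powr_realpow power_one_over inverse_eq_divide)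
    finally show "c i * measure lborel (?Q \<inter> C i) \<le> 2 ^ ?n * G\<^sup>2 / r ^ ?n * (1/2) ^ i"
      using r by (simp add: mult_left_mono divide_right_mono)
  qed
  also have "\<dots> = 2 ^ ?n * G\<^sup>2 / r ^ ?n * (\<Sum>i\<le>I. (1/2) ^ i)"
    by (simp add: sum_distrib_left)
  also have "(\<Sum>i\<le>I. (1/2 :: real) ^ i) \<le> 2"
    by (simp only: sum_gp0) simp
  finally show ?thesis using r by (simp add: mult_left_mono divide_right_mono mult_right_mono mult_ac)
qed

lemma axis_zero [simp]: "axis j 0 = 0"
  by (simp add: vec_eq_iff axis_def)

text \<open>The weighted Cauchy-Schwarz inequality balances an energy of order M^2 N^n for
  \<open>b\<close> against one of order G^2 / r^n for \<open>g\<close>, whence (N/r)^(n/2). The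
  exponent \<open>s\<close> is the growth of \<open>g\<close> measured in units of 1/r: 0 for
  bounded functions, the Hoelder exponent for increments.\<close>

lemma kernel_bound:
  fixes b :: "int ^ 'n \<Rightarrow> complex" and g :: "real ^ 'n \<Rightarrow> complex"
  assumes supp: "\<And>\<xi>. \<xi> \<notin> lattice_box N \<Longrightarrow> b \<xi> = 0" and N: "1 \<le> N" "p \<le> N" and r: "0 < r"
    and p: "real CARD('n) + 2 * s + 1 \<le> 2 * real p"
    and bM: "\<And>\<xi>. norm (b \<xi>) \<le> M" and dM: "\<And>j \<xi>. r ^ p * norm ((difference j ^^ p) b \<xi>) \<le> M"
    and cont: "continuous_on UNIV g"
    and g: "\<And>i z. z \<in> centered_cube \<Longrightarrow> (\<And>l. \<bar>z $ l\<bar> * r \<le> 2 ^ i) \<Longrightarrow> norm (g z) \<le> G * 2 powr (real i * s)"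
    and pos: "0 < M" "0 < G"
  shows "norm (integral centered_cube (\<lambda>z. trig b z * g z))
    \<le> (1 + real CARD('n)) * 5 ^ CARD('n) * M * G * (real N / r) powr (real CARD('n) / 2)"
proof -
  let ?n = "CARD('n)" and ?Q = "centered_cube :: (real ^ 'n) set"
  let ?w = "weight p r :: real ^ 'n \<Rightarrow> real"
  define K where "K = (1 + real ?n) * 5 ^ ?n"
  define u where "u = (real N * r) powr (real ?n / 2)"
  \<comment> \<open>The product is bounded pointwise by expanding the square of
    \<open>L * weight p r z * x - y\<close> below. This value of \<open>L\<close> makes the bounds
    of the two resulting integrals equal, which yields Cauchy-Schwarz without taking roots of
    integrals.\<close>
  define L where "L = G / (M * u)"
  have Npos: "real N > 0" using N by simp
  have u: "u > 0" using Npos r by (simp add: u_def)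
  have uu: "u * u = (real N * r) ^ ?n"
    using Npos r by (simp add: u_def powr_add[symmetric] powr_realpow)
  have Lpos: "L > 0" using pos u by (simp add: L_def)
  have w1: "?w z \<ge> 1" for z by (rule weight_ge_1)
  then have wn: "?w z \<noteq> 0" for z by (metis not_one_le_zero)
  let ?A = "\<lambda>z. (norm (trig b z))\<^sup>2 * ?w z" and ?B = "\<lambda>z. (norm (g z))\<^sup>2 / ?w z"
  have iA: "?A integrable_on ?Q" and iB: "?B integrable_on ?Q"
    and iF: "(\<lambda>z. trig b z * g z) integrable_on ?Q"
    unfolding centered_cube_def
    by (intro integrable_continuous_UNIV continuous_intros cont; simp add: wn)+
  have "norm (integral ?Q (\<lambda>z. trig b z * g z)) \<le> integral ?Q (\<lambda>z. L / 2 * ?A z + 1 / (2 * L) * ?B z)"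
  proof (rule integral_norm_bound_integral)
    show "(\<lambda>z. L / 2 * ?A z + 1 / (2 * L) * ?B z) integrable_on ?Q"
      by (intro integrable_add integrable_on_mult_right iA iB)
    fix z assume "z \<in> ?Q"
    define x y where "x = norm (trig b z)" and "y = norm (g z)"
    have "0 \<le> (L * ?w z * x - y)\<^sup>2 / (2 * L * ?w z)"
      using Lpos w1[of z] by (intro divide_nonneg_nonneg mult_nonneg_nonneg) auto
    also have "\<dots> = L / 2 * (x\<^sup>2 * ?w z) + 1 / (2 * L) * (y\<^sup>2 / ?w z) - x * y"
      using Lpos wn[of z] by (simp add: field_simps power2_eq_square)
    finally show "norm (trig b z * g z) \<le> L / 2 * ?A z + 1 / (2 * L) * ?B z"
      by (simp add: norm_mult x_def y_def)
  qed (fact iF)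
  also have "\<dots> = L / 2 * integral ?Q ?A + 1 / (2 * L) * integral ?Q ?B"
    by (subst integral_add, (intro integrable_on_mult_right iA iB)+, simp only: integral_mult_right)
  also have "\<dots> \<le> L / 2 * (K * M\<^sup>2 * real N ^ ?n) + 1 / (2 * L) * (K * G\<^sup>2 / r ^ ?n)"
  proof (intro add_mono mult_left_mono)
    show "integral ?Q ?A \<le> K * M\<^sup>2 * real N ^ ?n"
      unfolding K_def by (rule integral_trig_weight_le[OF supp N r bM dM])
    have "integral ?Q ?B \<le> 2 * 2 ^ ?n * G\<^sup>2 / r ^ ?n"
      by (rule integral_div_weight_le[OF r p cont g])
    also have "\<dots> \<le> K * G\<^sup>2 / r ^ ?n"
    proof (intro divide_right_mono mult_right_mono)
      have "Suc 0 \<le> ?n" by (simp add: Suc_le_eq)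
      then show "2 * 2 ^ ?n \<le> K" unfolding K_def by (intro mult_mono power_mono) auto
    qed (use r in auto)
    finally show "integral ?Q ?B \<le> K * G\<^sup>2 / r ^ ?n" .
  qed (use Lpos in auto)
  also have "L / 2 * (K * M\<^sup>2 * real N ^ ?n) = K * M * G * (real N ^ ?n / u) / 2"
    using pos u by (simp add: L_def field_simps power2_eq_square)
  also have "1 / (2 * L) * (K * G\<^sup>2 / r ^ ?n) = K * M * G * (u / r ^ ?n) / 2"
    using pos u by (simp add: L_def field_simps power2_eq_square)
  also have "real N ^ ?n / u = u / r ^ ?n"
    using u r uu by (simp add: field_simps power_mult_distrib)
  also have "u / r ^ ?n = (real N / r) powr (real ?n / 2)"
  proof -
    have "r ^ ?n = r powr (real ?n / 2) * r powr (real ?n / 2)"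
      using r by (simp add: powr_add[symmetric] powr_realpow)
    then show ?thesis using r Npos by (simp add: u_def powr_mult powr_divide)
  qed
  finally show ?thesis by (simp add: K_def mult_ac)
qed

section \<open>Discrete Leibniz rule\<close>

lemma difference_mult:
  "difference j (\<lambda>\<xi>. f \<xi> * g \<xi>) = (\<lambda>\<xi>. difference j f \<xi> * g (\<xi> + axis j 1) + f \<xi> * difference j g \<xi>)"
  by (auto simp: difference_def algebra_simps)

lemma difference_funpow_add:
  "(difference j ^^ p) (\<lambda>\<xi>. f \<xi> + g \<xi>) = (\<lambda>\<xi>. (difference j ^^ p) f \<xi> + (difference j ^^ p) g \<xi>)"
  by (induction p) (auto simp: difference_def fun_eq_iff)

lemma difference_funpow_diff:
  "(difference j ^^ p) (\<lambda>\<xi>. f \<xi> - g \<xi>) = (\<lambda>\<xi>. (difference j ^^ p) f \<xi> - (difference j ^^ p) g \<xi>)"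
  by (induction p) (auto simp: difference_def fun_eq_iff)

lemma difference_funpow_shift:
  "(difference j ^^ p) (\<lambda>\<xi>. f (\<xi> + \<eta>)) \<xi> = (difference j ^^ p) f (\<xi> + \<eta>)"
  by (induction p arbitrary: \<xi>) (auto simp: difference_def add_ac)

text \<open>The binomial theorem is hidden in the induction: differencing one factor replaces (F, G)
  by (F a, G) or (F, G b), and the two bounds add up to F G (a + b) times the previous power. Each
  difference of \<open>f\<close> shifts \<open>g\<close> by one step, so \<open>g\<close> is
  controlled at the shifted points while \<open>f\<close> is controlled at the base point alone;
  this asymmetry is exploited in \<open>symbol_cutoff_wide_bound\<close>.\<close>

lemma norm_difference_funpow_mult_le:
  assumes "\<And>i. i \<le> p \<Longrightarrow> norm ((difference j ^^ i) f \<xi>) \<le> F * a ^ i"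
    and "\<And>i l. i + l \<le> p \<Longrightarrow> norm ((difference j ^^ i) g (\<xi> + axis j (int l))) \<le> G * b ^ i"
  shows "norm ((difference j ^^ p) (\<lambda>\<xi>. f \<xi> * g \<xi>) \<xi>) \<le> F * G * (a + b) ^ p"
  using assms
proof (induction p arbitrary: f g F G)
  case 0
  then show ?case
    using 0(1)[of 0] 0(2)[of 0 0] by (simp add: norm_mult mult_mono')
next
  case (Suc p)
  have ax: "\<xi> + axis j (int l) + axis j 1 = \<xi> + axis j (int (Suc l))" for l
    by (simp add: vec_eq_iff axis_def)
  have "norm ((difference j ^^ p) (\<lambda>\<xi>. difference j f \<xi> * g (\<xi> + axis j 1)) \<xi>) \<le> (F * a) * G * (a + b) ^ p"
  proof (rule Suc.IH)
    show "norm ((difference j ^^ i) (difference j f) \<xi>) \<le> F * a * a ^ i" if "i \<le> p" for i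
      using Suc.prems(1)[of "Suc i"] that by (simp add: funpow_swap1 mult_ac)
    show "norm ((difference j ^^ i) (\<lambda>\<xi>. g (\<xi> + axis j 1)) (\<xi> + axis j (int l))) \<le> G * b ^ i"
      if "i + l \<le> p" for i l
      using Suc.prems(2)[of i "Suc l"] that by (simp only: difference_funpow_shift ax)
  qed
  moreover have "norm ((difference j ^^ p) (\<lambda>\<xi>. f \<xi> * difference j g \<xi>) \<xi>) \<le> F * (G * b) * (a + b) ^ p"
  proof (rule Suc.IH)
    show "norm ((difference j ^^ i) f \<xi>) \<le> F * a ^ i" if "i \<le> p" for i
      using Suc.prems(1)[of i] that by simp
    show "norm ((difference j ^^ i) (difference j g) (\<xi> + axis j (int l))) \<le> G * b * b ^ i"
      if "i + l \<le> p" for i l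
      using Suc.prems(2)[of "Suc i" l] that by (simp add: funpow_swap1 mult_ac)
  qed
  moreover have "(difference j ^^ Suc p) (\<lambda>\<xi>. f \<xi> * g \<xi>) \<xi>
      = (difference j ^^ p) (\<lambda>\<xi>. difference j f \<xi> * g (\<xi> + axis j 1)) \<xi>
      + (difference j ^^ p) (\<lambda>\<xi>. f \<xi> * difference j g \<xi>) \<xi>"
    by (simp only: funpow_Suc_right o_def difference_mult difference_funpow_add)
  ultimately have "norm ((difference j ^^ Suc p) (\<lambda>\<xi>. f \<xi> * g \<xi>) \<xi>)
      \<le> (F * a) * G * (a + b) ^ p + F * (G * b) * (a + b) ^ p"
    by (simp only:) (rule norm_triangle_le, rule add_mono)
  then show ?case by (simp add: algebra_simps)
qed

section \<open>Cutoff functions from iterated averages\<close>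

definition forward_average :: "nat \<Rightarrow> (int \<Rightarrow> real) \<Rightarrow> int \<Rightarrow> real" where
  "forward_average R f t = (\<Sum>i<R. f (t + int i)) / real R"

lemma forward_average_bounds:
  assumes "1 \<le> R" and "\<And>t. 0 \<le> f t \<and> f t \<le> 1"
  shows "0 \<le> forward_average R f t \<and> forward_average R f t \<le> 1"
proof -
  have "(\<Sum>i<R. f (t + int i)) \<le> (\<Sum>i<R. 1)" by (intro sum_mono) (use assms in auto)
  moreover have "0 \<le> (\<Sum>i<R. f (t + int i))" by (intro sum_nonneg) (use assms in auto)
  ultimately show ?thesis using assms(1) by (simp add: forward_average_def)
qed

text \<open>Sliding the window by one step cancels all but its two end values. The resulting 1/R is
  the gain of every difference of the cutoffs.\<close>

lemma forward_average_diff: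
  assumes "1 \<le> R"
  shows "forward_average R f (t + 1) - forward_average R f t = (f (t + int R) - f t) / real R"
proof -
  have "(\<Sum>i<R. f (t + 1 + int i)) + f t = (\<Sum>i<R. f (t + int i)) + f (t + int R)"
    by (induction R) (auto simp: algebra_simps)
  then show ?thesis by (simp add: forward_average_def diff_divide_distrib[symmetric])
qed

lemma forward_average_funpow_const:
  assumes "1 \<le> R" and "\<And>t'. t \<le> t' \<Longrightarrow> t' \<le> t + int p * (int R - 1) \<Longrightarrow> f t' = c"
  shows "(forward_average R ^^ p) f t = c"
  using assms(2)
proof (induction p arbitrary: t)
  case (Suc p)
  have "(forward_average R ^^ p) f (t + int i) = c" if "i < R" for i
    by (rule Suc.IH, rule Suc.prems) (use that in \<open>auto simp: algebra_simps\<close>)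
  then show ?case using assms(1) by (simp add: forward_average_def[of R "(forward_average R ^^ p) f"])
qed auto

text \<open>
  Averaging \<open>q\<close> times the indicator of an interval of length comparable to \<open>R\<close> gives a cutoff whose
  differences up to order \<open>q\<close> have the size of the derivatives of a smooth bump at scale \<open>R\<close>.
\<close>

definition bump :: "nat \<Rightarrow> nat \<Rightarrow> int \<Rightarrow> real" where
  "bump q R = (forward_average R ^^ q) (\<lambda>t. if \<bar>t\<bar> \<le> 2 * int q * int R then 1 else 0)"

text \<open>The q averages look at most q (R - 1) steps ahead, so starting from the interval of
  radius 2 q R there is a plateau of radius q R, and nothing remains beyond 3 q R.\<close>

lemma bump_eq_1: "1 \<le> R \<Longrightarrow> \<bar>t\<bar> \<le> int q * int R \<Longrightarrow> bump q R t = 1"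
  unfolding bump_def
  by (rule forward_average_funpow_const) (auto simp: algebra_simps abs_if split: if_splits)

lemma bump_eq_0: "1 \<le> R \<Longrightarrow> \<bar>t\<bar> > 3 * int q * int R \<Longrightarrow> bump q R t = 0"
  unfolding bump_def
  by (rule forward_average_funpow_const) (auto simp: algebra_simps abs_if split: if_splits)

lemma bump_bounds:
  assumes "1 \<le> R"
  shows "0 \<le> bump q R t" "bump q R t \<le> 1"
proof -
  have "0 \<le> (forward_average R ^^ p) f t \<and> (forward_average R ^^ p) f t \<le> 1"
    if "\<And>t. 0 \<le> f t \<and> f t \<le> 1" for f t p
    using that by (induction p arbitrary: t) (simp_all add: forward_average_bounds[OF assms])
  then show "0 \<le> bump q R t" "bump q R t \<le> 1" unfolding bump_def by auto
qed

definition int_difference :: "(int \<Rightarrow> real) \<Rightarrow> int \<Rightarrow> real" where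
  "int_difference f t = f (t + 1) - f t"

lemma int_difference_average:
  "(int_difference ^^ i) (forward_average R f) = forward_average R ((int_difference ^^ i) f)"
proof (induction i)
  case (Suc i)
  have "int_difference (forward_average R g) = forward_average R (int_difference g)" for g
    by (auto simp: int_difference_def[abs_def] forward_average_def[abs_def] sum_subtractf diff_divide_distrib add_ac)
  then show ?case using Suc by simp
qed simp

lemma forward_average_abs_le:
  assumes "1 \<le> R" and "\<And>t. \<bar>f t\<bar> \<le> B"
  shows "\<bar>forward_average R f t\<bar> \<le> B"
proof -
  have "\<bar>\<Sum>i<R. f (t + int i)\<bar> \<le> (\<Sum>i<R. \<bar>f (t + int i)\<bar>)" by (rule sum_abs)
  also have "\<dots> \<le> (\<Sum>i<R. B)" by (intro sum_mono assms)
  finally show ?thesis using assms(1) by (simp add: forward_average_def field_simps)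
qed

text \<open>Differences commute with averages, so each difference can be paired with one average and
  gains 2/R; the p - i averages left over do not increase the supremum.\<close>

lemma int_difference_funpow_average_le:
  assumes R: "1 \<le> R" and "\<And>t. \<bar>f t\<bar> \<le> B" and "i \<le> p"
  shows "\<bar>(int_difference ^^ i) ((forward_average R ^^ p) f) t\<bar> \<le> B * (2 / real R) ^ i"
  using assms(3)
proof (induction p arbitrary: i t)
  case 0
  then show ?case using assms by simp
next
  case (Suc p)
  let ?g = "(forward_average R ^^ p) f"
  show ?case
  proof (cases i)
    case 0
    have "\<bar>?g t\<bar> \<le> B" for t using Suc.IH[of 0 t] by simp
    then show ?thesis using 0 by (simp add: forward_average_abs_le[OF R])
  next
    case (Suc i')
    let ?h = "(int_difference ^^ i') ?g"
    have h: "\<bar>?h t\<bar> \<le> B * (2 / real R) ^ i'" for t using Suc.IH[of i' t] \<open>i \<le> Suc p\<close> Suc by simp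
    have "(int_difference ^^ i) ((forward_average R ^^ Suc p) f) t = int_difference (forward_average R ?h) t"
      by (simp add: Suc int_difference_average)
    also have "\<dots> = (?h (t + int R) - ?h t) / real R"
      by (simp add: int_difference_def forward_average_diff[OF R])
    finally have "\<bar>(int_difference ^^ i) ((forward_average R ^^ Suc p) f) t\<bar> = \<bar>?h (t + int R) - ?h t\<bar> / real R"
      by simp
    also have "\<dots> \<le> (2 * (B * (2 / real R) ^ i')) / real R"
      using h[of "t + int R"] h[of t] by (intro divide_right_mono) auto
    finally show ?thesis by (simp add: Suc mult.left_commute)
  qed
qed

lemma int_difference_bump_le:
  "1 \<le> R \<Longrightarrow> i \<le> q \<Longrightarrow> \<bar>(int_difference ^^ i) (bump q R) t\<bar> \<le> (2 / real R) ^ i"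
  using int_difference_funpow_average_le[of R _ 1 i q t] unfolding bump_def by simp

definition cutoff :: "nat \<Rightarrow> nat \<Rightarrow> int ^ 'n \<Rightarrow> complex" where
  "cutoff q R \<xi> = of_real (\<Prod>i\<in>UNIV. bump q R (\<xi> $ i))"

lemma cutoff_eq_1: "1 \<le> R \<Longrightarrow> \<xi> \<in> lattice_box (q * R) \<Longrightarrow> cutoff q R \<xi> = 1"
  by (simp add: cutoff_def lattice_box_def bump_eq_1)

lemma cutoff_eq_0: "1 \<le> R \<Longrightarrow> \<xi> \<notin> lattice_box (3 * q * R) \<Longrightarrow> cutoff q R \<xi> = 0"
  unfolding cutoff_def lattice_box_def using bump_eq_0[of R q] by (auto simp: not_le mult.assoc)

text \<open>A difference in direction j acts on the j-th factor of the product only, and the other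
  factors lie in [0,1].\<close>

lemma norm_difference_cutoff_le:
  assumes R: "1 \<le> R" and i: "i \<le> q"
  shows "norm ((difference j ^^ i) (cutoff q R) \<xi>) \<le> (2 / real R) ^ i"
proof -
  let ?P = "\<lambda>\<xi>. \<Prod>l\<in>UNIV - {j}. bump q R (\<xi> $ l)"
  have "(difference j ^^ i) (cutoff q R) \<xi> = of_real ((int_difference ^^ i) (bump q R) (\<xi> $ j) * ?P \<xi>)"
  proof (induction i arbitrary: \<xi>)
    case 0
    then show ?case by (simp add: cutoff_def prod.remove[of UNIV j])
  next
    case (Suc i)
    have "?P (\<xi> + axis j 1) = ?P \<xi>" by (intro prod.cong) (auto simp: axis_def)
    then show ?case
      by (simp add: difference_def[of j "(difference j ^^ i) (cutoff q R)"] Suc int_difference_def[of "(int_difference ^^ i) (bump q R)"]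
          left_diff_distrib)
  qed
  also have "norm \<dots> = \<bar>(int_difference ^^ i) (bump q R) (\<xi> $ j)\<bar> * \<bar>?P \<xi>\<bar>"
    by (simp add: abs_mult norm_of_real del: of_real_mult)
  also have "\<dots> \<le> (2 / real R) ^ i * 1"
  proof (rule mult_mono)
    show "\<bar>?P \<xi>\<bar> \<le> 1" unfolding abs_prod by (intro prod_le_1) (use bump_bounds[OF R] in auto)
  qed (use int_difference_bump_le[OF R i] in auto)
  finally show ?thesis by simp
qed

section \<open>Dyadic pieces of a symbol\<close>

definition kernel_const :: "nat \<Rightarrow> real" where
  "kernel_const n = (1 + real n) * 5 ^ n"

lemma kernel_const_pos: "kernel_const n > 0"
  by (simp add: kernel_const_def add_pos_nonneg)

text \<open>Growth exponent 0: here 2p > n suffices, which is what the symbol offers with p =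
  k.\<close>

lemma sum_character_bound:
  fixes b :: "int ^ 'n \<Rightarrow> complex"
  assumes supp: "\<And>\<xi>. \<xi> \<notin> lattice_box N \<Longrightarrow> b \<xi> = 0" and N: "1 \<le> N" "p \<le> N" and r: "0 < r"
    and p: "CARD('n) + 1 \<le> 2 * p"
    and bM: "\<And>\<xi>. norm (b \<xi>) \<le> M" and dM: "\<And>j \<xi>. r ^ p * norm ((difference j ^^ p) b \<xi>) \<le> M"
    and cont: "continuous_on UNIV f" and per: "periodic f" and f: "\<And>x. norm (f x) \<le> G"
    and pos: "0 < M" "0 < G"
  shows "norm (\<Sum>\<xi>\<in>lattice_box N. character \<xi> x * b \<xi> * fourier_coeff f \<xi>)
    \<le> kernel_const CARD('n) * M * G * (real N / r) powr (real CARD('n) / 2)"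
proof -
  have "(\<Sum>\<xi>\<in>lattice_box N. character \<xi> x * b \<xi> * fourier_coeff f \<xi>)
      = integral centered_cube (\<lambda>z. trig b z * f (z + x))"
    unfolding centered_cube_def
    by (rule sum_character_fourier_coeff[OF finite_lattice_box _ cont per]) (use supp in auto)
  also have "norm \<dots> \<le> kernel_const CARD('n) * M * G * (real N / r) powr (real CARD('n) / 2)"
    unfolding kernel_const_def
  proof (rule kernel_bound[OF supp N r _ bM dM _ _ pos])
    show "real CARD('n) + 2 * 0 + 1 \<le> 2 * real p" using p by linarith
    show "continuous_on UNIV (\<lambda>z. f (z + x))"
      by (rule continuous_on_compose2[OF cont]) (auto intro!: continuous_intros)
  qed (use f in auto)
  finally show ?thesis .
qed

section \<open>Fourier coefficients of continuous functions\<close>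

lemma fourier_coeff_sum_character:
  assumes "finite S"
  shows "fourier_coeff (\<lambda>y. \<Sum>\<xi>\<in>S. c \<xi> * character \<xi> y) \<eta> = (if \<eta> \<in> S then c \<eta> else 0)"
proof -
  have "fourier_coeff (\<lambda>y. \<Sum>\<xi>\<in>S. c \<xi> * character \<xi> y) \<eta>
      = integral (cbox 0 One) (\<lambda>y. \<Sum>\<xi>\<in>S. c \<xi> * character (\<xi> - \<eta>) y)"
  proof -
    have "character (\<xi> - \<eta>) y = character \<xi> y * character \<eta> (- y)" for \<xi> y
      by (metis character_add_freq character_minus_freq diff_conv_add_uminus)
    then show ?thesis by (simp add: fourier_coeff_character_def sum_distrib_left mult_ac)
  qed
  also have "\<dots> = (\<Sum>\<xi>\<in>S. c \<xi> * integral (cbox 0 One) (character (\<xi> - \<eta>)))"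
    by (subst integral_sum[OF assms], rule integrable_continuous_UNIV, intro continuous_intros) simp
  also have "\<dots> = (if \<eta> \<in> S then c \<eta> else 0)"
    using assms by (simp add: integral_character if_distrib[of "(*) _"] cong: if_cong)
  finally show ?thesis .
qed

lemma fourier_coeff_const: "fourier_coeff (\<lambda>y. c) \<eta> = (if \<eta> = 0 then c else 0)"
  using fourier_coeff_sum_character[of "{0}" "\<lambda>_. c" \<eta>] by simp

lemma integrable_character_mult:
  "continuous_on UNIV f \<Longrightarrow> (\<lambda>x. character \<xi> (- x) * f x) integrable_on cbox a b"
  by (intro integrable_continuous_UNIV continuous_intros)

lemma fourier_coeff_add:
  assumes "continuous_on UNIV f" "continuous_on UNIV g"
  shows "fourier_coeff (\<lambda>y. f y + g y) \<xi> = fourier_coeff f \<xi> + fourier_coeff g \<xi>"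
  unfolding fourier_coeff_character_def distrib_left
  by (intro integral_add integrable_character_mult assms)

lemma fourier_coeff_diff:
  assumes "continuous_on UNIV f" "continuous_on UNIV g"
  shows "fourier_coeff (\<lambda>y. f y - g y) \<xi> = fourier_coeff f \<xi> - fourier_coeff g \<xi>"
  unfolding fourier_coeff_character_def right_diff_distrib
  by (intro integral_diff integrable_character_mult assms)

lemma fourier_coeff_cmult:
  "fourier_coeff (\<lambda>y. c * f y) \<xi> = c * fourier_coeff f \<xi>"
  by (simp add: fourier_coeff_character_def mult.left_commute)

lemma norm_fourier_coeff_le:
  assumes "continuous_on UNIV f" "\<And>x. norm (f x) \<le> G"
  shows "norm (fourier_coeff f \<xi>) \<le> G"
proof -
  have "norm (fourier_coeff f \<xi>) \<le> integral (cbox 0 One :: (real ^ 'a) set) (\<lambda>x. G)"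
    unfolding fourier_coeff_character_def
    by (rule integral_norm_bound_integral) (auto intro: integrable_character_mult assms simp: norm_mult)
  also have "\<dots> = G * measure lborel (cbox 0 One :: (real ^ 'a) set)"
    by simp
  also have "measure lborel (cbox 0 One :: (real ^ 'a) set) = 1"
    unfolding One_eq_ones by (subst content_cbox_cart) (auto simp: box_ne_empty interval_eq_empty_cart)
  finally show ?thesis by simp
qed

lemma norm_powr_le:
  fixes z :: "real ^ 'n"
  assumes r: "0 < r" and z: "\<And>l. \<bar>z $ l\<bar> * r \<le> 2 ^ i" and s: "0 \<le> s"
  shows "norm z powr s \<le> real CARD('n) powr s * r powr (- s) * 2 powr (real i * s)"
proof -
  have "norm z \<le> (\<Sum>l\<in>UNIV. \<bar>z $ l\<bar>)" by (rule norm_le_l1_cart)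
  also have "\<dots> \<le> (\<Sum>l\<in>(UNIV :: 'n set). 2 ^ i / r)"
    using z r by (intro sum_mono) (simp add: field_simps)
  finally have "norm z \<le> real CARD('n) * (2 ^ i / r)" by simp
  then have "norm z powr s \<le> (real CARD('n) * (2 ^ i / r)) powr s"
    by (intro powr_mono2 s) auto
  also have "\<dots> = real CARD('n) powr s * r powr (- s) * 2 powr (real i * s)"
    using r by (simp add: powr_mult powr_divide powr_minus field_simps powr_powr powr_realpow[symmetric])
  finally show ?thesis .
qed

text \<open>Since \<open>b 0 = 0\<close>, the kernel has mean zero and the constant
  \<open>f x\<close> can be subtracted from \<open>f\<close> at no cost. The kernel then meets an
  increment of size H |z|^s, and at scale 1/r this is worth r^(-s).\<close>

lemma sum_character_holder_bound:
  fixes b :: "int ^ 'n \<Rightarrow> complex"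
  assumes supp: "\<And>\<xi>. \<xi> \<notin> lattice_box N \<Longrightarrow> b \<xi> = 0" and N: "1 \<le> N" "p \<le> N" and r: "0 < r"
    and p: "real CARD('n) + 2 * s + 1 \<le> 2 * real p" and s: "0 \<le> s" and b0: "b 0 = 0"
    and bM: "\<And>\<xi>. norm (b \<xi>) \<le> M" and dM: "\<And>j \<xi>. r ^ p * norm ((difference j ^^ p) b \<xi>) \<le> M"
    and cont: "continuous_on UNIV f" and per: "periodic f"
    and f: "\<And>x h. norm (f (x + h) - f x) \<le> H * norm h powr s"
    and pos: "0 < M" "0 < H"
  shows "norm (\<Sum>\<xi>\<in>lattice_box N. character \<xi> x * b \<xi> * fourier_coeff f \<xi>)
    \<le> kernel_const CARD('n) * M * (real CARD('n) powr s * r powr (- s) * H) * (real N / r) powr (real CARD('n) / 2)"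
proof -
  let ?g = "\<lambda>y. f y - f x"
  have cg: "continuous_on UNIV ?g" by (intro continuous_intros cont)
  have "(\<Sum>\<xi>\<in>lattice_box N. character \<xi> x * b \<xi> * fourier_coeff f \<xi>)
      = (\<Sum>\<xi>\<in>lattice_box N. character \<xi> x * b \<xi> * fourier_coeff ?g \<xi>)"
    using b0 by (intro sum.cong refl) (auto simp: fourier_coeff_diff cont fourier_coeff_const)
  also have "\<dots> = integral centered_cube (\<lambda>z. trig b z * ?g (z + x))"
    unfolding centered_cube_def
    by (rule sum_character_fourier_coeff[OF finite_lattice_box _ cg])
       (use supp per in \<open>auto simp: periodic_def\<close>)
  also have "norm \<dots> \<le> kernel_const CARD('n) * M * (real CARD('n) powr s * r powr (- s) * H) * (real N / r) powr (real CARD('n) / 2)"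
    unfolding kernel_const_def
  proof (rule kernel_bound[OF supp N r p bM dM _ _ pos(1)])
    show "continuous_on UNIV (\<lambda>z. ?g (z + x))"
      by (rule continuous_on_compose2[OF cg]) (auto intro!: continuous_intros)
    show "0 < real CARD('n) powr s * r powr (- s) * H" using pos r by simp
    fix i and z :: "real ^ 'n" assume "\<And>l. \<bar>z $ l\<bar> * r \<le> 2 ^ i"
    then have "H * norm z powr s \<le> H * (real CARD('n) powr s * r powr (- s) * 2 powr (real i * s))"
      using pos by (intro mult_left_mono norm_powr_le[OF r _ s]) auto
    with f[of x z] show "norm (?g (z + x)) \<le> real CARD('n) powr s * r powr (- s) * H * 2 powr (real i * s)"
      by (simp add: add.commute mult_ac)
  qed
  finally show ?thesis .
qed

text \<open>Lives between the radii 8 q R and 48 q R. The ratio 2 of the two scales makes the annuli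
  with R = 2^j telescope.\<close>

definition cutoff_annulus :: "nat \<Rightarrow> nat \<Rightarrow> int ^ 'n \<Rightarrow> complex" where
  "cutoff_annulus q R \<xi> = cutoff q (16 * R) \<xi> - cutoff q (8 * R) \<xi>"

text \<open>Equal to 1 between the radii 3 q R and 64 q R, which contain the support of
  \<open>cutoff_annulus q R\<close> with room on both sides, and equal to 0 inside q R.\<close>

definition cutoff_wide :: "nat \<Rightarrow> nat \<Rightarrow> int ^ 'n \<Rightarrow> complex" where
  "cutoff_wide q R \<xi> = cutoff q (64 * R) \<xi> - cutoff q R \<xi>"

lemma lattice_box_mono: "N \<le> M \<Longrightarrow> lattice_box N \<subseteq> lattice_box M"
  by (fastforce simp: lattice_box_def intro: order_trans)

lemma notin_lattice_box_mono: "\<xi> \<notin> lattice_box M \<Longrightarrow> N \<le> M \<Longrightarrow> \<xi> \<notin> lattice_box N"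
  using lattice_box_mono by blast

lemma cutoff_annulus_outside:
  assumes "1 \<le> R" "\<xi> \<notin> lattice_box (48 * q * R)"
  shows "cutoff_annulus q R \<xi> = 0"
proof -
  have "\<xi> \<notin> lattice_box (3 * q * (8 * R))" by (rule notin_lattice_box_mono[OF assms(2)]) simp
  moreover have "\<xi> \<notin> lattice_box (3 * q * (16 * R))" by (rule notin_lattice_box_mono[OF assms(2)]) simp
  ultimately show ?thesis using assms(1) by (simp add: cutoff_annulus_def cutoff_eq_0)
qed

lemma cutoff_annulus_inside:
  assumes "1 \<le> R" "\<xi> \<in> lattice_box (8 * q * R)"
  shows "cutoff_annulus q R \<xi> = 0"
proof -
  have "\<xi> \<in> lattice_box (q * (8 * R))" "\<xi> \<in> lattice_box (q * (16 * R))"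
    by (rule subsetD[OF lattice_box_mono assms(2)]; simp)+
  then show ?thesis using assms(1) by (simp add: cutoff_annulus_def cutoff_eq_1)
qed

lemma cutoff_wide_outside:
  assumes "1 \<le> R" "\<xi> \<notin> lattice_box (192 * q * R)"
  shows "cutoff_wide q R \<xi> = 0"
proof -
  have "\<xi> \<notin> lattice_box (3 * q * R)" by (rule notin_lattice_box_mono[OF assms(2)]) simp
  moreover have "\<xi> \<notin> lattice_box (3 * q * (64 * R))" by (rule notin_lattice_box_mono[OF assms(2)]) simp
  ultimately show ?thesis using assms(1) by (simp add: cutoff_wide_def cutoff_eq_0)
qed

lemma cutoff_wide_inside:
  assumes "1 \<le> R" "\<xi> \<in> lattice_box (q * R)"
  shows "cutoff_wide q R \<xi> = 0"
proof -
  have "lattice_box (q * R) \<subseteq> lattice_box (q * (64 * R))" by (rule lattice_box_mono) simp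
  then show ?thesis using assms by (auto simp: cutoff_wide_def cutoff_eq_1)
qed

lemma cutoff_wide_annulus:
  assumes "1 \<le> R"
  shows "cutoff_wide q R \<xi> * cutoff_annulus q R \<xi> = cutoff_annulus q R \<xi>"
proof (cases "\<xi> \<in> lattice_box (48 * q * R) \<and> \<xi> \<notin> lattice_box (8 * q * R)")
  case True
  have "lattice_box (48 * q * R) \<subseteq> lattice_box (q * (64 * R))" by (rule lattice_box_mono) simp
  moreover have "\<xi> \<notin> lattice_box (3 * q * R)" by (rule notin_lattice_box_mono[OF conjunct2[OF True]]) simp
  ultimately have "cutoff_wide q R \<xi> = 1"
    using True assms by (auto simp: cutoff_wide_def cutoff_eq_1 cutoff_eq_0)
  then show ?thesis by simp
qed (use cutoff_annulus_inside[OF assms] cutoff_annulus_outside[OF assms] in auto)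

lemma norm_difference_cutoff_le2:
  assumes "1 \<le> R" "1 \<le> R1" "R \<le> R1" "1 \<le> R2" "R \<le> R2" "i \<le> q"
  shows "norm ((difference j ^^ i) (\<lambda>\<xi>. cutoff q R1 \<xi> - cutoff q R2 \<xi>) \<xi>) \<le> 2 * (2 / real R) ^ i"
proof -
  have *: "norm ((difference j ^^ i) (cutoff q R') \<xi>) \<le> (2 / real R) ^ i" if "1 \<le> R'" "R \<le> R'" for R'
  proof -
    have "norm ((difference j ^^ i) (cutoff q R') \<xi>) \<le> (2 / real R') ^ i"
      by (rule norm_difference_cutoff_le) fact+
    also have "\<dots> \<le> (2 / real R) ^ i" using that assms by (intro power_mono divide_left_mono) auto
    finally show ?thesis .
  qed
  show ?thesis
    unfolding difference_funpow_diff
    using norm_triangle_ineq4 *[of R1] *[of R2] assms by (smt (verit))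
qed

lemma norm_difference_cutoff_annulus_le:
  "1 \<le> R \<Longrightarrow> i \<le> q \<Longrightarrow> norm ((difference j ^^ i) (cutoff_annulus q R) \<xi>) \<le> 2 * (2 / real R) ^ i"
  unfolding cutoff_annulus_def[abs_def] by (rule norm_difference_cutoff_le2) auto

lemma norm_difference_cutoff_wide_le:
  "1 \<le> R \<Longrightarrow> i \<le> q \<Longrightarrow> norm ((difference j ^^ i) (cutoff_wide q R) \<xi>) \<le> 2 * (2 / real R) ^ i"
  unfolding cutoff_wide_def[abs_def] by (rule norm_difference_cutoff_le2) auto

text \<open>A Littlewood-Paley piece of \<open>f\<close>, written as a trigonometric polynomial so
  that its own Fourier coefficients can be read off.\<close>

definition dyadic_piece :: "nat \<Rightarrow> nat \<Rightarrow> (real ^ 'n \<Rightarrow> complex) \<Rightarrow> real ^ 'n \<Rightarrow> complex" where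
  "dyadic_piece q R f y = (\<Sum>\<xi>\<in>lattice_box (48 * q * R). cutoff_annulus q R \<xi> * fourier_coeff f \<xi> * character \<xi> y)"

text \<open>A pure cutoff behaves like a symbol with \<rho> = 1: with r = R and N = 48 q R the
  factor N/r is independent of R, and R enters only through the gain R^(-s).\<close>

lemma dyadic_piece_bound:
  fixes f :: "real ^ 'n \<Rightarrow> complex"
  assumes R: "1 \<le> R" and q: "1 \<le> q" "real CARD('n) + 2 * s + 1 \<le> 2 * real q" and s: "0 \<le> s"
    and cont: "continuous_on UNIV f" and per: "periodic f"
    and f: "\<And>x h. norm (f (x + h) - f x) \<le> H * norm h powr s" and H: "0 < H"
  shows "norm (dyadic_piece q R f x) \<le> kernel_const CARD('n) * (2 * 2 ^ q) *
    (real CARD('n) powr s * real R powr (- s) * H) * (48 * real q) powr (real CARD('n) / 2)"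
proof -
  have Rp: "0 < real R" using R by simp
  have "norm (\<Sum>\<xi>\<in>lattice_box (48 * q * R). character \<xi> x * cutoff_annulus q R \<xi> * fourier_coeff f \<xi>)
    \<le> kernel_const CARD('n) * (2 * 2 ^ q) * (real CARD('n) powr s * real R powr (- s) * H)
      * (real (48 * q * R) / real R) powr (real CARD('n) / 2)"
  proof (rule sum_character_holder_bound[OF _ _ _ Rp q(2) s _ _ _ cont per f _ H])
    show "cutoff_annulus q R 0 = 0" by (rule cutoff_annulus_inside[OF R]) (simp add: lattice_box_def)
    show "norm (cutoff_annulus q R \<xi>) \<le> 2 * 2 ^ q" for \<xi> :: "int ^ 'n"
    proof -
      have "norm (cutoff_annulus q R \<xi>) \<le> 2 * 1"
        using norm_difference_cutoff_annulus_le[OF R, of 0 q undefined \<xi>] by simp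
      also have "\<dots> \<le> 2 * 2 ^ q" by (intro mult_left_mono one_le_power) auto
      finally show ?thesis .
    qed
    show "real R ^ q * norm ((difference j ^^ q) (cutoff_annulus q R) \<xi>) \<le> 2 * 2 ^ q" for j and \<xi> :: "int ^ 'n"
      using norm_difference_cutoff_annulus_le[OF R order_refl[of q], of j \<xi>] Rp by (simp add: field_simps power_divide)
    show "1 \<le> 48 * q * R" "q \<le> 48 * q * R" using R q by auto
  qed (use cutoff_annulus_outside[OF R] in auto)
  then show ?thesis using R by (simp add: dyadic_piece_def mult_ac)
qed

section \<open>Increments of dyadic pieces\<close>

lemma norm_character_minus_1_le:
  "norm (character \<xi> h - 1) \<le> 2 * pi * (norm h * norm (of_lattice \<xi>))"
proof -
  have "norm (cis t - 1) \<le> \<bar>t\<bar>" for t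
    using dist_exp_i_1[of t] abs_sin_le_one[of "t/2"] abs_sin_x_le_abs_x[of "t/2"] by (simp add: cis_conv_exp)
  then have "norm (character \<xi> h - 1) \<le> \<bar>2 * pi * (h \<bullet> of_lattice \<xi>)\<bar>"
    unfolding character_def .
  also have "\<dots> = 2 * pi * \<bar>h \<bullet> of_lattice \<xi>\<bar>" by (simp add: abs_mult)
  also have "\<dots> \<le> 2 * pi * (norm h * norm (of_lattice \<xi>))"
    by (intro mult_left_mono Cauchy_Schwarz_ineq2) auto
  finally show ?thesis .
qed

lemma norm_of_lattice_le:
  fixes \<xi> :: "int ^ 'n"
  assumes "\<xi> \<in> lattice_box N" shows "norm (of_lattice \<xi>) \<le> real CARD('n) * real N"
proof -
  have "\<bar>of_lattice \<xi> $ i\<bar> \<le> real N" for i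
    using assms by (simp add: lattice_box_def flip: of_int_abs) (metis of_int_le_iff of_int_of_nat_eq)
  then have "(\<Sum>i\<in>UNIV. \<bar>of_lattice \<xi> $ i\<bar>) \<le> (\<Sum>i\<in>(UNIV :: 'n set). real N)" by (intro sum_mono)
  with norm_le_l1_cart[of "of_lattice \<xi>"] show ?thesis by simp
qed

lemma difference_character:
  "(difference j ^^ i) (\<lambda>\<xi>. character \<xi> h) \<xi> = (character (axis j 1) h - 1) ^ i * character \<xi> h"
  by (induction i arbitrary: \<xi>)
     (auto simp: difference_def[of j "(difference j ^^ i) g" for i g] character_add_freq algebra_simps)

text \<open>For i = 0 the gain |h| R comes from |\<xi>| <= n c R. For i > 0 the constant 1
  disappears and i factors |h| = (|h| R) / R remain; as |h| R <= 1, one factor |h| R may stand for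
  all of them.\<close>

lemma norm_difference_character_le:
  fixes \<xi> :: "int ^ 'n"
  assumes R: "1 \<le> R" and h: "norm h * real R \<le> 1" and \<xi>: "\<xi> \<in> lattice_box (c * R)" and c: "1 \<le> c"
  shows "norm ((difference j ^^ i) (\<lambda>\<xi>. character \<xi> h - 1) \<xi>)
    \<le> (2 * pi * real CARD('n) * real c * (norm h * real R)) * (2 * pi / real R) ^ i"
proof (cases i)
  case 0
  have "norm (character \<xi> h - 1) \<le> 2 * pi * (norm h * (real CARD('n) * real (c * R)))"
    by (rule order_trans[OF norm_character_minus_1_le]) (intro mult_left_mono norm_of_lattice_le \<xi>; simp)
  then show ?thesis using 0 by (simp add: mult_ac)
next
  case (Suc i')
  have pc: "1 \<le> real CARD('n) * real c"
    using c mult_mono[of 1 "real CARD('n)" 1 "real c"] by (simp add: Suc_le_eq)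
  have e: "norm (character (axis j 1) h - 1) \<le> 2 * pi * norm h"
    using norm_character_minus_1_le[of "axis j 1" h] by (simp add: of_lattice_axis norm_axis_1)
  have Rp: "0 < real R" using R by simp
  have "norm ((difference j ^^ i) (\<lambda>\<xi>. character \<xi> h - 1) \<xi>) = norm (character (axis j 1) h - 1) ^ i"
  proof -
    have "(difference j ^^ i) (\<lambda>\<xi>. 1 :: complex) = (\<lambda>\<xi>. 0)"
      unfolding Suc by (induction i') (auto simp: difference_def)
    then show ?thesis by (simp add: difference_funpow_diff difference_character norm_mult norm_power)
  qed
  also have "\<dots> \<le> (2 * pi * norm h) ^ i" by (intro power_mono e) auto
  also have "\<dots> = (norm h * real R) ^ i * (2 * pi / real R) ^ i"
    using Rp by (simp add: power_mult_distrib[symmetric] mult_ac)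
  also have "\<dots> \<le> (2 * pi * real CARD('n) * real c * (norm h * real R)) * (2 * pi / real R) ^ i"
  proof (intro mult_right_mono)
    have "(norm h * real R) ^ i \<le> (norm h * real R) ^ 1"
      using h Suc by (intro power_decreasing) auto
    also have "\<dots> = 1 * (norm h * real R)" by simp
    also have "\<dots> \<le> (2 * pi * real CARD('n) * real c) * (norm h * real R)"
    proof (intro mult_right_mono)
      have "1 * 1 \<le> (2 * pi) * (real CARD('n) * real c)"
        using pc pi_gt3 by (intro mult_mono) auto
      then show "1 \<le> 2 * pi * real CARD('n) * real c" by (simp add: mult_ac)
    qed auto
    finally show "(norm h * real R) ^ i \<le> 2 * pi * real CARD('n) * real c * (norm h * real R)" .
  qed auto
  finally show ?thesis .
qed

text \<open>Translation by h is the multiplier \<open>character \<xi> h\<close>, so an increment is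
  again a character sum, with coefficients that are a factor |h| R smaller than those of the
  annulus. The product rule for differences adds the rates 2 pi / R and 2 / R.\<close>

lemma dyadic_piece_difference_bound:
  fixes f :: "real ^ 'n \<Rightarrow> complex"
  assumes R: "1 \<le> R" and q: "1 \<le> q" "real CARD('n) + 2 * s + 1 \<le> 2 * real q" and s: "0 \<le> s"
    and cont: "continuous_on UNIV f" and per: "periodic f"
    and f: "\<And>x h. norm (f (x + h) - f x) \<le> H * norm h powr s" and H: "0 < H"
    and h: "h \<noteq> 0" "norm h * real R \<le> 1"
  shows "norm (dyadic_piece q R f (x + h) - dyadic_piece q R f x) \<le>
    kernel_const CARD('n) * (2 * pi * real CARD('n) * real (49 * q) * (norm h * real R) * 2 * (2 * pi + 2) ^ q) *
    (real CARD('n) powr s * real R powr (- s) * H) * (48 * real q) powr (real CARD('n) / 2)"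
proof -
  have Rp: "0 < real R" using R by simp
  define F where "F = 2 * pi * real CARD('n) * real (49 * q) * (norm h * real R)"
  have F: "0 < F" using h q Rp by (simp add: F_def)
  let ?b = "\<lambda>\<xi> :: int ^ 'n. (character \<xi> h - 1) * cutoff_annulus q R \<xi>"
  have out: "?b \<xi> = 0" if "\<xi> \<notin> lattice_box (48 * q * R)" for \<xi>
    using cutoff_annulus_outside[OF R that] by simp
  have diff: "norm ((difference j ^^ i) ?b \<xi>) \<le> F * 2 * ((2 * pi + 2) / real R) ^ i" if i: "i \<le> q" for i j \<xi>
  \<comment> \<open>The coefficients vanish outside 48 q R, and at most q <= q R forward steps lead
    back into that box; so the differences vanish outside 49 q R.\<close>
  proof (cases "\<xi> \<in> lattice_box (49 * q * R)")
    case True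
    have "norm ((difference j ^^ i) ?b \<xi>) \<le> F * 2 * (2 * pi / real R + 2 / real R) ^ i"
    proof (rule norm_difference_funpow_mult_le)
      show "norm ((difference j ^^ i') (\<lambda>\<xi>. character \<xi> h - 1) \<xi>) \<le> F * (2 * pi / real R) ^ i'" for i'
        unfolding F_def by (rule norm_difference_character_le[OF R h(2)]) (use True q in auto)
      show "norm ((difference j ^^ i') (cutoff_annulus q R) (\<xi> + axis j (int l))) \<le> 2 * (2 / real R) ^ i'"
        if "i' + l \<le> i" for i' l
        using that i by (intro norm_difference_cutoff_annulus_le R) auto
    qed
    then show ?thesis by (simp add: add_divide_distrib)
  next
    case False
    have "48 * q * R + i \<le> 48 * q * R + q * R" using i R by (simp add: order_trans[OF i])
    then have "\<xi> \<notin> lattice_box (48 * q * R + i)"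
      by (intro notin_lattice_box_mono[OF False]) simp
    from difference_outside_box[OF out this] show ?thesis using F by simp
  qed
  have "dyadic_piece q R f (x + h) - dyadic_piece q R f x
      = (\<Sum>\<xi>\<in>lattice_box (48 * q * R). character \<xi> x * ?b \<xi> * fourier_coeff f \<xi>)"
    by (simp add: dyadic_piece_def sum_subtractf[symmetric] character_add algebra_simps)
  also have "norm \<dots> \<le> kernel_const CARD('n) * (F * 2 * (2 * pi + 2) ^ q) *
    (real CARD('n) powr s * real R powr (- s) * H) * (real (48 * q * R) / real R) powr (real CARD('n) / 2)"
  proof (rule sum_character_holder_bound[OF out _ _ Rp q(2) s _ _ _ cont per f _ H])
    show "1 \<le> 48 * q * R" "q \<le> 48 * q * R" using R q by auto
    show "(character 0 h - 1) * cutoff_annulus q R 0 = 0" by simp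
    show "norm (?b \<xi>) \<le> F * 2 * (2 * pi + 2) ^ q" for \<xi>
    proof -
      have "norm (?b \<xi>) \<le> F * 2 * 1" using diff[of 0 undefined \<xi>] by simp
      also have "\<dots> \<le> F * 2 * (2 * pi + 2) ^ q"
        using F pi_gt3 by (intro mult_left_mono one_le_power) auto
      finally show ?thesis .
    qed
    show "real R ^ q * norm ((difference j ^^ q) ?b \<xi>) \<le> F * 2 * (2 * pi + 2) ^ q" for j \<xi>
      using diff[of q j \<xi>] Rp by (simp add: field_simps power_divide)
    show "0 < F * 2 * (2 * pi + 2) ^ q" using F pi_gt3 by (simp add: add_pos_pos)
  qed
  finally show ?thesis using R by (simp add: F_def)
qed

lemma dyadic_piece_periodic: "periodic (dyadic_piece q R f)"
  by (simp add: periodic_def dyadic_piece_def periodicD[OF periodic_character])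

lemma dyadic_piece_continuous: "continuous_on UNIV (dyadic_piece q R f)"
  unfolding dyadic_piece_def[abs_def] by (intro continuous_intros)

lemma japanese_bracket_ge_1: "1 \<le> japanese_bracket \<xi>"
  by (simp add: japanese_bracket_def)

lemma japanese_bracket_ge_nth: "real_of_int \<bar>\<xi> $ i\<bar> \<le> japanese_bracket \<xi>"
proof -
  have "real_of_int \<bar>\<xi> $ i\<bar> \<le> norm (of_lattice \<xi>)"
    using component_le_norm_cart[of "of_lattice \<xi>" i] by simp
  also have "\<dots> \<le> japanese_bracket \<xi>" unfolding japanese_bracket_def by (rule real_le_rsqrt) simp
  finally show ?thesis .
qed

text \<open>Order -n(1-\<rho>)/2 and type \<rho>, tested on pure differences in one direction. The
  order is the one that cancels the factor (N/r)^(n/2) of \<open>kernel_bound\<close> for N of order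
  R and r = R^\<rho>.\<close>

definition symbol_bound :: "nat \<Rightarrow> real \<Rightarrow> real \<Rightarrow> (int ^ 'n \<Rightarrow> complex) \<Rightarrow> bool" where
  "symbol_bound k \<rho> L a \<longleftrightarrow> (\<forall>j i \<xi>. i \<le> k \<longrightarrow>
     norm ((difference j ^^ i) a \<xi>)
       \<le> L * japanese_bracket \<xi> powr (- (real CARD('n) / 2 * (1 - \<rho>)) - \<rho> * real i))"

lemma symbol_cutoff_wide_bound:
  fixes a :: "int ^ 'n \<Rightarrow> complex" and g :: "real ^ 'n \<Rightarrow> complex"
  assumes a: "symbol_bound k \<rho> L a" and L: "0 < L" and \<rho>: "0 \<le> \<rho>" "\<rho> \<le> 1"
    and k: "CARD('n) + 1 \<le> 2 * k" and R: "1 \<le> R"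
    and cont: "continuous_on UNIV g" and per: "periodic g" and g: "\<And>x. norm (g x) \<le> G" and G: "0 < G"
  shows "norm (\<Sum>\<xi>\<in>lattice_box (192 * Suc k * R). character \<xi> x * (a \<xi> * cutoff_wide (Suc k) R \<xi>) * fourier_coeff g \<xi>)
    \<le> kernel_const CARD('n) * (2 * 3 ^ k * L) * G * (192 * (real k + 1)) powr (real CARD('n) / 2)"
proof -
  let ?n = "real CARD('n)" and ?\<psi> = "cutoff_wide (Suc k) R :: int ^ 'n \<Rightarrow> complex"
  define e where "e = ?n / 2 * (1 - \<rho>)"
  have e: "0 \<le> e" using \<rho> by (simp add: e_def)
  define r where "r = real R powr \<rho>"
  have Rp: "0 < real R" "1 \<le> real R" using R by auto
  have r: "0 < r" using Rp by (simp add: r_def)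
  have rR: "r \<le> real R" unfolding r_def using powr_mono[OF \<rho>(2) Rp(2)] Rp by simp
  define M where "M = 2 * 3 ^ k * L * real R powr (- e)"
  \<comment> \<open>This is why the cutoffs use q = k + 1: a nonzero value forces a coordinate
    beyond (k + 1) R, and going back at most k <= k R steps still leaves R. Hence the bracket is at
    least R at the base point of any difference that meets the support.\<close>
  have big: "real R \<le> japanese_bracket \<xi>" if "?\<psi> (\<xi> + axis j (int l)) \<noteq> 0" "l \<le> k" for \<xi> j l
  proof -
    have "\<xi> + axis j (int l) \<notin> lattice_box (Suc k * R)" using cutoff_wide_inside[OF R] that(1) by blast
    then obtain i where i: "\<bar>(\<xi> + axis j (int l)) $ i\<bar> > int (Suc k * R)"
      by (auto simp: lattice_box_def not_le)
    have "\<bar>(\<xi> + axis j (int l)) $ i\<bar> \<le> \<bar>\<xi> $ i\<bar> + int k"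
      using that(2) by (auto simp: axis_def)
    moreover have "int k \<le> int k * int R" using mult_left_mono[of 1 "int R" "int k"] R by simp
    ultimately have "int R \<le> \<bar>\<xi> $ i\<bar>" using i by (simp add: algebra_simps)
    then have "real R \<le> real_of_int \<bar>\<xi> $ i\<bar>" by linarith
    with japanese_bracket_ge_nth[of \<xi> i] show ?thesis by linarith
  qed
  have diff: "norm ((difference j ^^ i) (\<lambda>\<xi>. a \<xi> * ?\<psi> \<xi>) \<xi>) \<le> L * real R powr (- e) * 2 * (3 / r) ^ i"
    if i: "i \<le> k" for i j \<xi>
  \<comment> \<open>Either the cutoff is nonzero at one of the i + 1 points entering the difference,
    and \<open>big\<close> applies at \<xi>, or the difference is 0.\<close>
  proof (cases "\<exists>l\<le>i. ?\<psi> (\<xi> + axis j (int l)) \<noteq> 0")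
    case True
    then have RJ: "real R \<le> japanese_bracket \<xi>" using big i by (meson order_trans)
    have "norm ((difference j ^^ i) (\<lambda>\<xi>. a \<xi> * ?\<psi> \<xi>) \<xi>) \<le> L * real R powr (- e) * 2 * (1 / r + 2 / real R) ^ i"
    proof (rule norm_difference_funpow_mult_le)
      fix i' assume i': "i' \<le> i"
      have "norm ((difference j ^^ i') a \<xi>) \<le> L * japanese_bracket \<xi> powr (- e - \<rho> * real i')"
        using a i i' unfolding symbol_bound_def e_def by (meson order_trans)
      also have "\<dots> \<le> L * real R powr (- e - \<rho> * real i')"
      proof (intro mult_left_mono powr_mono2')
        show "- e - \<rho> * real i' \<le> 0" using e mult_nonneg_nonneg[OF \<rho>(1), of "real i'"] by linarith
      qed (use L RJ Rp in auto)
      also have "real R powr (- e - \<rho> * real i') = real R powr (- e) * (1 / r) ^ i'"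
        using Rp by (simp add: r_def powr_diff powr_powr[symmetric] powr_realpow power_one_over field_simps)
      finally show "norm ((difference j ^^ i') a \<xi>) \<le> L * real R powr (- e) * (1 / r) ^ i'" by simp
    next
      fix i' l assume "i' + l \<le> i"
      then show "norm ((difference j ^^ i') ?\<psi> (\<xi> + axis j (int l))) \<le> 2 * (2 / real R) ^ i'"
        using i by (intro norm_difference_cutoff_wide_le R) auto
    qed
    also have "\<dots> \<le> L * real R powr (- e) * 2 * (3 / r) ^ i"
    proof (intro mult_left_mono power_mono)
      have "2 / real R \<le> 2 / r" using rR r by (intro divide_left_mono) auto
      then show "1 / r + 2 / real R \<le> 3 / r" by (simp add: field_simps)
    qed (use L r in auto)
    finally show ?thesis .
  next
    case False
    then have "(difference j ^^ i) (\<lambda>\<xi>. a \<xi> * ?\<psi> \<xi>) \<xi> = 0" by (intro difference_eq_0) auto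
    then show ?thesis using L r by simp
  qed
  have kpos: "1 \<le> k" using k by simp
  have "norm (\<Sum>\<xi>\<in>lattice_box (192 * Suc k * R). character \<xi> x * (a \<xi> * ?\<psi> \<xi>) * fourier_coeff g \<xi>)
    \<le> kernel_const CARD('n) * M * G * (real (192 * Suc k * R) / r) powr (?n / 2)"
  proof (rule sum_character_bound[where p=k])
    show "a \<xi> * ?\<psi> \<xi> = 0" if "\<xi> \<notin> lattice_box (192 * Suc k * R)" for \<xi>
      using cutoff_wide_outside[OF R that] by simp
    have "k * 1 \<le> Suc k * R" by (intro mult_mono) (use R in auto)
    then have "k \<le> 192 * (Suc k * R)" by linarith
    then show "k \<le> 192 * Suc k * R" by (simp only: mult.assoc)
    show "1 \<le> 192 * Suc k * R" using R by simp
    show "norm (a \<xi> * ?\<psi> \<xi>) \<le> M" for \<xi>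
    proof -
      have "norm (a \<xi> * ?\<psi> \<xi>) \<le> L * real R powr (- e) * 2 * 1" using diff[of 0 undefined \<xi>] by simp
      also have "\<dots> \<le> L * real R powr (- e) * 2 * 3 ^ k" using L by (intro mult_left_mono one_le_power) auto
      finally show ?thesis by (simp add: M_def mult_ac)
    qed
    show "r ^ k * norm ((difference j ^^ k) (\<lambda>\<xi>. a \<xi> * ?\<psi> \<xi>) \<xi>) \<le> M" for j \<xi>
      using diff[of k j \<xi>] r by (simp add: M_def field_simps power_divide)
    show "0 < M" using L Rp by (simp add: M_def)
  qed (use assms r in auto)
  \<comment> \<open>The loss R^e of the kernel estimate; it meets the factor R^(-e) contained in
    \<open>M\<close>.\<close>
  also have "(real (192 * Suc k * R) / r) powr (?n / 2) = (192 * (real k + 1)) powr (?n / 2) * real R powr e"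
  proof -
    have "real (192 * Suc k * R) / r = (192 * (real k + 1)) * real R powr (1 - \<rho>)"
      using Rp by (simp add: r_def powr_diff field_simps)
    then show ?thesis by (simp add: powr_mult powr_powr e_def mult_ac)
  qed
  also have "kernel_const CARD('n) * M * G * ((192 * (real k + 1)) powr (?n / 2) * real R powr e)
      = kernel_const CARD('n) * (2 * 3 ^ k * L) * G * (192 * (real k + 1)) powr (?n / 2) * (real R powr (- e) * real R powr e)"
    by (simp add: M_def)
  also have "real R powr (- e) * real R powr e = 1" using Rp by (simp flip: powr_add)
  finally show ?thesis by simp
qed

definition block :: "nat \<Rightarrow> nat \<Rightarrow> (int ^ 'n \<Rightarrow> complex) \<Rightarrow> (real ^ 'n \<Rightarrow> complex) \<Rightarrow> real ^ 'n \<Rightarrow> complex" where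
  "block q R a f x = (\<Sum>\<xi>\<in>lattice_box (48 * q * R). character \<xi> x * a \<xi> * cutoff_annulus q R \<xi> * fourier_coeff f \<xi>)"

text \<open>The wide cutoff can be inserted for free because it is 1 wherever the annulus is
  nonzero. The factor \<open>d\<close> is 1 when \<open>g\<close> is a dyadic piece of
  \<open>f\<close>, and \<open>character \<xi> h - 1\<close> when \<open>g\<close> is the increment
  of that piece.\<close>

lemma block_eq_wide:
  assumes R: "1 \<le> R"
    and c: "\<And>\<xi>. \<xi> \<in> lattice_box (48 * q * R) \<Longrightarrow> fourier_coeff g \<xi> = d \<xi> * cutoff_annulus q R \<xi> * fourier_coeff f \<xi>"
    and c0: "\<And>\<xi>. \<xi> \<notin> lattice_box (48 * q * R) \<Longrightarrow> fourier_coeff g \<xi> = 0"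
  shows "(\<Sum>\<xi>\<in>lattice_box (192 * q * R). character \<xi> x * (a \<xi> * cutoff_wide q R \<xi>) * fourier_coeff g \<xi>)
    = block q R (\<lambda>\<xi>. a \<xi> * d \<xi>) f x"
proof -
  have sub: "lattice_box (48 * q * R) \<subseteq> (lattice_box (192 * q * R) :: (int ^ 'a) set)" by (rule lattice_box_mono) simp
  have "(\<Sum>\<xi>\<in>lattice_box (192 * q * R). character \<xi> x * (a \<xi> * cutoff_wide q R \<xi>) * fourier_coeff g \<xi>)
      = (\<Sum>\<xi>\<in>lattice_box (48 * q * R). character \<xi> x * (a \<xi> * cutoff_wide q R \<xi>) * fourier_coeff g \<xi>)"
    by (rule sum.mono_neutral_right[OF _ sub]) (auto simp: c0)
  also have "\<dots> = block q R (\<lambda>\<xi>. a \<xi> * d \<xi>) f x"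
    unfolding block_def
  proof (intro sum.cong refl)
    fix \<xi> :: "int ^ 'a" assume "\<xi> \<in> lattice_box (48 * q * R)"
    then have "character \<xi> x * (a \<xi> * cutoff_wide q R \<xi>) * fourier_coeff g \<xi>
      = character \<xi> x * (a \<xi> * d \<xi>) * (cutoff_wide q R \<xi> * cutoff_annulus q R \<xi>) * fourier_coeff f \<xi>"
      by (simp add: c mult_ac)
    then show "character \<xi> x * (a \<xi> * cutoff_wide q R \<xi>) * fourier_coeff g \<xi>
      = character \<xi> x * (a \<xi> * d \<xi>) * cutoff_annulus q R \<xi> * fourier_coeff f \<xi>"
      by (simp only: cutoff_wide_annulus[OF R])
  qed
  finally show ?thesis .
qed

definition holder_with :: "real \<Rightarrow> real \<Rightarrow> (real ^ 'n \<Rightarrow> complex) \<Rightarrow> bool" where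
  "holder_with s H f \<longleftrightarrow> continuous_on UNIV f \<and> periodic f \<and> 0 < H \<and>
     (\<forall>x h. norm (f (x + h) - f x) \<le> H * norm h powr s)"

text \<open>The bound must be uniform in \<open>a\<close> and \<open>L\<close>: the symbol will be
  \<sigma> frozen at x, with \<open>L\<close> fixed, or its change between x and x + h, with
  \<open>L\<close> proportional to |h|. In both parts the symbol acts on a trigonometric polynomial,
  namely a dyadic piece of \<open>f\<close> or its increment, through the supremum of the latter
  only.\<close>

lemma block_bound:
  assumes \<rho>: "0 \<le> \<rho>" "\<rho> \<le> 1" and k: "CARD('n) + 1 \<le> 2 * k" and s: "0 \<le> s" "s \<le> 1"
  shows "\<exists>B>0.
    (\<forall>R a L f H x. 1 \<le> R \<longrightarrow> symbol_bound k \<rho> L a \<longrightarrow> 0 < L \<longrightarrow> holder_with s H (f :: real ^ 'n \<Rightarrow> complex) \<longrightarrow>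
      norm (block (Suc k) R a f x) \<le> B * L * H * real R powr (- s)) \<and>
    (\<forall>R a L f H x h. 1 \<le> R \<longrightarrow> symbol_bound k \<rho> L a \<longrightarrow> 0 < L \<longrightarrow> holder_with s H (f :: real ^ 'n \<Rightarrow> complex) \<longrightarrow>
      norm h * real R \<le> 1 \<longrightarrow>
      norm (block (Suc k) R a f (x + h) - block (Suc k) R a f x)
        \<le> B * L * H * real R powr (- s) * (norm h * real R))"
proof -
  let ?n = "CARD('n)" and ?q = "Suc k"
  let ?c = "(48 * real ?q) powr (real ?n / 2)" and ?ns = "real ?n powr s"
  define C0 where "C0 = kernel_const ?n * (2 * 2 ^ ?q) * ?ns * ?c"
  define C1 where "C1 = kernel_const ?n * (2 * pi * real ?n * real (49 * ?q) * 2 * (2 * pi + 2) ^ ?q) * ?ns * ?c"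
  define C2 where "C2 = kernel_const ?n * (2 * 3 ^ k) * (192 * (real k + 1)) powr (real ?n / 2)"
  have pos: "0 < C0" "0 < C1" "0 < C2"
    using kernel_const_pos pi_gt3 by (simp_all add: C0_def C1_def C2_def add_pos_pos)
  define B where "B = C2 * C0 + C2 * C1"
  have BC: "C2 * C0 \<le> B" "C2 * C1 \<le> B" using pos by (simp_all add: B_def)
  \<comment> \<open>One more difference than the symbol has absorbs the growth |z|^s, since 2 s <=
    2.\<close>
  have q: "1 \<le> ?q" "real ?n + 2 * s + 1 \<le> 2 * real ?q" using k s by simp_all
  show ?thesis
  proof (intro exI[of _ B] conjI allI impI)
    show "0 < B" using pos by (simp add: B_def add_pos_pos)
  next
    fix R :: nat and L H x and a :: "int ^ 'n \<Rightarrow> complex" and f :: "real ^ 'n \<Rightarrow> complex"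
    assume R: "1 \<le> R" and a: "symbol_bound k \<rho> L a" and L: "0 < L" and "holder_with s H f"
    then have cont: "continuous_on UNIV f" and per: "periodic f" and H: "0 < H"
      and f: "\<And>x h. norm (f (x + h) - f x) \<le> H * norm h powr s"
      by (auto simp: holder_with_def)
    define G where "G = C0 * H * real R powr (- s)"
    have "block ?q R a f x = (\<Sum>\<xi>\<in>lattice_box (192 * ?q * R).
        character \<xi> x * (a \<xi> * cutoff_wide ?q R \<xi>) * fourier_coeff (dyadic_piece ?q R f) \<xi>)"
      by (subst block_eq_wide[OF R, where d="\<lambda>_. 1" and f=f])
         (simp_all add: dyadic_piece_def[abs_def] fourier_coeff_sum_character)
    also have "norm \<dots> \<le> kernel_const ?n * (2 * 3 ^ k * L) * G * (192 * (real k + 1)) powr (real ?n / 2)"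
    proof (rule symbol_cutoff_wide_bound[OF a L \<rho> k R dyadic_piece_continuous dyadic_piece_periodic])
      show "norm (dyadic_piece ?q R f x) \<le> G" for x
        using dyadic_piece_bound[OF R q s(1) cont per f H, of x] by (simp add: G_def C0_def mult_ac)
      show "0 < G" using pos H R by (simp add: G_def)
    qed
    also have "\<dots> = (C2 * C0) * (L * H * real R powr (- s))" by (simp add: C2_def G_def)
    also have "\<dots> \<le> B * (L * H * real R powr (- s))" using BC L H by (intro mult_right_mono) auto
    finally show "norm (block ?q R a f x) \<le> B * L * H * real R powr (- s)" by (simp add: mult_ac)
  next
    fix R :: nat and L H x and h :: "real ^ 'n" and a :: "int ^ 'n \<Rightarrow> complex" and f :: "real ^ 'n \<Rightarrow> complex"
    assume R: "1 \<le> R" and a: "symbol_bound k \<rho> L a" and L: "0 < L" and "holder_with s H f"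
    then have cont: "continuous_on UNIV f" and per: "periodic f" and H: "0 < H"
      and f: "\<And>x h. norm (f (x + h) - f x) \<le> H * norm h powr s"
      by (auto simp: holder_with_def)
    assume hR: "norm h * real R \<le> 1"
    show "norm (block ?q R a f (x + h) - block ?q R a f x) \<le> B * L * H * real R powr (- s) * (norm h * real R)"
    proof (cases "h = 0")
      case False
      define G where "G = C1 * H * real R powr (- s) * (norm h * real R)"
      let ?g = "\<lambda>y. dyadic_piece ?q R f (y + h) - dyadic_piece ?q R f y"
      have g: "?g = (\<lambda>y. \<Sum>\<xi>\<in>lattice_box (48 * ?q * R).
          (character \<xi> h - 1) * cutoff_annulus ?q R \<xi> * fourier_coeff f \<xi> * character \<xi> y)"
        by (simp add: dyadic_piece_def sum_subtractf[symmetric] character_add algebra_simps fun_eq_iff)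
      have "block ?q R a f (x + h) - block ?q R a f x = block ?q R (\<lambda>\<xi>. a \<xi> * (character \<xi> h - 1)) f x"
        by (simp add: block_def sum_subtractf[symmetric] character_add algebra_simps)
      also have "\<dots> = (\<Sum>\<xi>\<in>lattice_box (192 * ?q * R).
          character \<xi> x * (a \<xi> * cutoff_wide ?q R \<xi>) * fourier_coeff ?g \<xi>)"
        by (subst block_eq_wide[OF R, where d="\<lambda>\<xi>. character \<xi> h - 1" and f=f])
           (simp_all only: g fourier_coeff_sum_character finite_lattice_box if_True if_False simp_thms)
      also have "norm \<dots> \<le> kernel_const ?n * (2 * 3 ^ k * L) * G * (192 * (real k + 1)) powr (real ?n / 2)"
      proof (rule symbol_cutoff_wide_bound[OF a L \<rho> k R])
        show "continuous_on UNIV ?g" unfolding g by (intro continuous_intros)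
        show "periodic ?g" unfolding g by (simp add: periodic_def periodicD[OF periodic_character])
        show "norm (?g x) \<le> G" for x
          using dyadic_piece_difference_bound[OF R q s(1) cont per f H False hR, of x]
          by (simp add: G_def C1_def mult_ac)
        show "0 < G" using pos H R False by (simp add: G_def)
      qed
      also have "\<dots> = (C2 * C1) * (L * H * real R powr (- s) * (norm h * real R))" by (simp add: C2_def G_def)
      also have "\<dots> \<le> B * (L * H * real R powr (- s) * (norm h * real R))" using BC L H by (intro mult_right_mono) auto
      finally show ?thesis by (simp add: mult_ac)
    qed simp
  qed
qed

section \<open>Hoelder spaces\<close>

definition nearest_shift :: "real ^ 'n \<Rightarrow> real ^ 'n" where
  "nearest_shift h = h - of_lattice (\<chi> i. round (h $ i))"

text \<open>Rounding minimizes all coordinate distances simultaneously, so the infimum over the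
  lattice is attained.\<close>

lemma torus_norm_eq: "torus_norm h = norm (nearest_shift h)"
proof -
  have "norm (nearest_shift h) \<le> norm (h - of_lattice z)" for z
    by (rule norm_le_componentwise_cart) (simp add: nearest_shift_def round_diff_minimal)
  then have "norm (nearest_shift h) \<le> torus_norm h"
    unfolding torus_norm_def by (intro cINF_greatest) auto
  moreover have "torus_norm h \<le> norm (nearest_shift h)"
    unfolding torus_norm_def nearest_shift_def by (rule cINF_lower) (auto intro!: bdd_belowI[of _ 0])
  ultimately show ?thesis by simp
qed

lemma norm_nearest_shift_le: "norm (nearest_shift h) \<le> norm h"
proof (rule norm_le_componentwise_cart)
  fix i
  show "norm (nearest_shift h $ i) \<le> norm (h $ i)"
    using round_diff_minimal[of "h $ i" 0] by (simp add: nearest_shift_def)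
qed

lemma periodic_nearest_shift: "periodic f \<Longrightarrow> f (x + nearest_shift h) = f (x + h)"
  using periodicD[of f "x + nearest_shift h" "\<chi> i. round (h $ i)"] by (simp add: nearest_shift_def)

lemma holder_quotient_nonneg: "0 \<le> holder_quotient s f p"
  by (simp add: holder_quotient_def split: prod.split)

text \<open>Periodicity allows h to be replaced by its nearest shift, on which Euclidean and torus
  length agree. If the shift is 0, the quotient is 0 because
  \<open>0 powr (- s) = 0\<close>.\<close>

lemma holder_quotient_le:
  assumes "periodic f" and "\<And>x h. norm (f (x + h) - f x) \<le> H * norm h powr s" and "0 \<le> H"
  shows "holder_quotient s f p \<le> H"
proof -
  obtain x h where p: "p = (x, h)" by (cases p)
  have "holder_quotient s f p = norm (f (x + nearest_shift h) - f x) * norm (nearest_shift h) powr (- s)"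
    by (simp add: p holder_quotient_def torus_norm_eq periodic_nearest_shift[OF assms(1)])
  also have "\<dots> \<le> H * norm (nearest_shift h) powr s * norm (nearest_shift h) powr (- s)"
    by (intro mult_right_mono assms) auto
  also have "\<dots> \<le> H"
    using assms(3) by (cases "nearest_shift h = 0") (simp_all add: mult.assoc flip: powr_add)
  finally show ?thesis .
qed

lemma holder_spaceD:
  assumes f: "f \<in> holder_space s" and s: "0 \<le> s"
  shows "norm (f (x + h) - f x) \<le> (SUP p. holder_quotient s f p) * norm h powr s"
proof -
  have per: "periodic f" and bdd: "bdd_above (range (holder_quotient s f))"
    using f by (auto simp: holder_space_def)
  let ?H = "SUP p. holder_quotient s f p"
  have le: "holder_quotient s f p \<le> ?H" for p by (rule cSUP_upper[OF _ bdd]) simp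
  have H: "0 \<le> ?H" using le[of undefined] holder_quotient_nonneg[of s f undefined] by linarith
  show ?thesis
  proof (cases "nearest_shift h = 0")
    case True
    then have "f (x + h) = f x" using periodic_nearest_shift[OF per, of x h] by simp
    then show ?thesis using H by simp
  next
    case False
    have "norm (f (x + h) - f x) = holder_quotient s f (x, h) * norm (nearest_shift h) powr s"
      using False by (simp add: holder_quotient_def torus_norm_eq mult.assoc flip: powr_add)
    also have "\<dots> \<le> ?H * norm h powr s"
      by (intro mult_mono le powr_mono2 norm_nearest_shift_le s H) auto
    finally show ?thesis .
  qed
qed

lemma holder_continuous:
  fixes f :: "real ^ 'n \<Rightarrow> complex"
  assumes f: "\<And>x h. norm (f (x + h) - f x) \<le> H * norm h powr s" and s: "0 < s"
  shows "continuous_on UNIV f"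
proof (rule continuous_at_imp_continuous_on, rule ballI)
  fix x :: "real ^ 'n"
  have "((\<lambda>y. H * norm (y - x) powr s) \<longlongrightarrow> H * 0) (at x)"
  proof (intro tendsto_mult tendsto_const tendsto_zero_powrI)
    show "((\<lambda>y. norm (y - x)) \<longlongrightarrow> 0) (at x)"
      by (rule tendsto_norm_zero[OF LIM_zero[OF tendsto_ident_at]])
    show "((\<lambda>y. s) \<longlongrightarrow> s) (at x)" by simp
  qed (use s in auto)
  then have lim: "((\<lambda>y. H * norm (y - x) powr s) \<longlongrightarrow> 0) (at x)" by simp
  have "norm (f y - f x) \<le> H * norm (y - x) powr s" for y
    using f[of x "y - x"] by simp
  then have "((\<lambda>y. f y - f x) \<longlongrightarrow> 0) (at x)"
    by (intro Lim_null_comparison[OF always_eventually lim] allI)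
  then show "isCont f x" by (simp add: isCont_def LIM_zero_iff)
qed

lemma periodic_bounded:
  fixes f :: "real ^ 'n \<Rightarrow> complex"
  assumes cont: "continuous_on UNIV f" and per: "periodic f"
  shows "bdd_above (range (\<lambda>x. norm (f x)))"
proof -
  have "compact (f ` cbox 0 One)"
    by (intro compact_continuous_image compact_cbox continuous_on_subset[OF cont]) simp
  then obtain B where B: "\<And>x. x \<in> cbox 0 One \<Longrightarrow> norm (f x) \<le> B"
    by (meson bounded_iff compact_imp_bounded imageI)
  have "norm (f x) \<le> B" for x
  proof -
    define z where "z = (\<chi> i. \<lfloor>x $ i\<rfloor>)"
    have "x - of_lattice z \<in> cbox 0 One"
      unfolding One_eq_ones mem_box_cart z_def by (auto simp: algebra_simps) linarith
    with B have "norm (f (x - of_lattice z)) \<le> B" by blast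
    then show ?thesis using periodicD[OF per, of "x - of_lattice z" z] by simp
  qed
  then show ?thesis by (auto intro!: bdd_aboveI[of _ B])
qed

text \<open>Let \<open>J\<close> be the first index with t 2^J > 1. The terms are at most D t^s (t
  2^j)^(1-s) below \<open>J\<close> and D t^s (t 2^j)^(-s) from \<open>J\<close> on. Both bounds
  decay geometrically away from \<open>J\<close>, with ratios \<open>a\<close> and \<open>b\<close>
  below 1 because 0 < s < 1, and \<open>E\<close> is the sum of the two series.\<close>

lemma dyadic_sum_bound:
  fixes s :: real
  assumes s: "0 < s" "s < 1"
  shows "\<exists>E>0. \<forall>t D d. 0 < t \<longrightarrow> 0 \<le> D \<longrightarrow> (\<forall>j. 0 \<le> d j) \<longrightarrow> (\<forall>j. d j \<le> D * (2 ^ j) powr (- s)) \<longrightarrow>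
      (\<forall>j. t * 2 ^ j \<le> 1 \<longrightarrow> d j \<le> D * (2 ^ j) powr (- s) * (t * 2 ^ j)) \<longrightarrow>
      summable d \<and> suminf d \<le> E * D * t powr s"
proof -
  define a b where "a = (2 :: real) powr (- (1 - s))" and "b = (2 :: real) powr (- s)"
  have ab: "0 < a" "a < 1" "0 < b" "b < 1"
    using s powr_less_mono[of "- (1 - s)" 0 2] powr_less_mono[of "- s" 0 2] by (simp_all add: a_def b_def)
  have pw: "(2 ^ j) powr u = (2 powr u) ^ j" for j :: nat and u :: real
    by (simp add: powr_powr powr_realpow[symmetric] mult.commute)
  define E where "E = 1 / (1 - a) + 1 / (1 - b)"
  show ?thesis
  proof (intro exI[of _ E] conjI[of "E > 0"] allI impI)
    show "0 < E" using ab by (simp add: E_def add_pos_pos)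
  next
    fix t D :: real and d :: "nat \<Rightarrow> real"
    assume t: "0 < t" and D: "0 \<le> D" and "\<forall>j. 0 \<le> d j" and "\<forall>j. d j \<le> D * (2 ^ j) powr (- s)"
      and "\<forall>j. t * 2 ^ j \<le> 1 \<longrightarrow> d j \<le> D * (2 ^ j) powr (- s) * (t * 2 ^ j)"
    then have d0: "0 \<le> d j" and d1: "d j \<le> D * (2 ^ j) powr (- s)"
      and d2: "t * 2 ^ j \<le> 1 \<Longrightarrow> d j \<le> D * (2 ^ j) powr (- s) * (t * 2 ^ j)" for j by auto
    have sum: "summable d"
    proof (rule summable_comparison_test')
      show "summable (\<lambda>j. D * b ^ j)" using ab by (intro summable_mult summable_geometric) auto
      show "norm (d j) \<le> D * b ^ j" for j using d0[of j] d1[of j] by (simp add: pw b_def)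
    qed
    define J where "J = (LEAST j. t * 2 ^ j > 1)"
    have "\<exists>j. t * 2 ^ j > 1"
      using real_arch_pow[of 2 "1 / t"] t by (auto simp: field_simps)
    then have J: "t * 2 ^ J > 1" unfolding J_def by (rule LeastI_ex)
    have small: "t * 2 ^ j \<le> 1" if "j < J" for j
      using not_less_Least[of j "\<lambda>j. t * 2 ^ j > 1"] that by (auto simp: J_def)
    have tpos: "0 < t * 2 ^ j" for j using t by simp
    have split: "D * (2 ^ j) powr (- s) = D * t powr s * (t * 2 ^ j) powr (- s)" for j
      using t by (simp add: powr_mult mult_ac flip: powr_add)
    have first: "d j \<le> D * t powr s * a ^ (J - Suc j)" if j: "j < J" for j
    proof -
      have "d j \<le> D * t powr s * ((t * 2 ^ j) powr (- s) * (t * 2 ^ j))"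
        using d2[OF small[OF j]] by (simp add: split mult_ac)
      also have "(t * 2 ^ j) powr (- s) * (t * 2 ^ j) = (t * 2 ^ j) powr (1 - s)"
        using tpos[of j] powr_add[of "t * 2 ^ j" "- s" 1] by simp
      \<comment> \<open>Count down from the last small index: t 2^(J-1) <= 1, and J - 1 - j further
        halvings lead to t 2^j.\<close>
      also have "t * 2 ^ j = t * 2 ^ (J - 1) / 2 ^ (J - Suc j)"
        using j by (simp add: power_add[symmetric] field_simps)
      also have "\<dots> powr (1 - s) \<le> (1 / 2 ^ (J - Suc j)) powr (1 - s)"
        using small[of "J - 1"] j s t by (intro powr_mono2 divide_right_mono) auto
      also have "\<dots> = a ^ (J - Suc j)"
      proof -
        have "a = 1 / 2 powr (1 - s)" unfolding a_def by (rule powr_minus_divide)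
        then show ?thesis by (simp add: powr_divide pw power_divide)
      qed
      finally show ?thesis using D by (simp add: mult_left_mono)
    qed
    have second: "d (j + J) \<le> D * t powr s * b ^ j" for j
    proof -
      have "d (j + J) \<le> D * t powr s * (t * 2 ^ (j + J)) powr (- s)"
        using d1[of "j + J"] by (simp only: split)
      also have "(t * 2 ^ (j + J)) powr (- s) \<le> (2 ^ j) powr (- s)"
      proof (rule powr_mono2')
        have "2 ^ j * 1 \<le> 2 ^ j * (t * 2 ^ J)" using J by (intro mult_left_mono) auto
        then show "2 ^ j \<le> t * 2 ^ (j + J)" by (simp add: power_add mult_ac)
      qed (use s in auto)
      finally show ?thesis using D by (simp add: mult_left_mono pw b_def)
    qed
    have "suminf d = (\<Sum>j. d (j + J)) + (\<Sum>j<J. d j)"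
      by (rule suminf_split_initial_segment[OF sum])
    also have "(\<Sum>j<J. d j) \<le> (\<Sum>j<J. D * t powr s * a ^ (J - Suc j))"
      by (intro sum_mono first) simp
    also have "\<dots> = D * t powr s * (\<Sum>j<J. a ^ j)"
      using sum.nat_diff_reindex[of "\<lambda>j. a ^ j" J] by (simp add: sum_distrib_left[symmetric])
    also have "(\<Sum>j<J. a ^ j) \<le> (\<Sum>j. a ^ j)"
      using ab by (intro sum_le_suminf summable_geometric) auto
    also have "(\<Sum>j. a ^ j) = 1 / (1 - a)" using ab by (intro suminf_geometric) auto
    also have "(\<Sum>j. d (j + J)) \<le> (\<Sum>j. D * t powr s * b ^ j)"
      using ab by (intro suminf_le second summable_ignore_initial_segment sum summable_mult summable_geometric) auto
    also have "\<dots> = D * t powr s * (1 / (1 - b))"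
      using ab by (simp add: suminf_mult suminf_geometric summable_geometric)
    finally have "suminf d \<le> D * t powr s * (1 / (1 - b)) + D * t powr s * (1 / (1 - a))"
      using D by (simp add: mult_left_mono)
    also have "\<dots> = E * D * t powr s" by (simp add: E_def algebra_simps)
    finally show "summable d \<and> suminf d \<le> E * D * t powr s" using sum by blast
  qed
qed

section \<open>The extended operator\<close>

definition low_block :: "nat \<Rightarrow> (int ^ 'n \<Rightarrow> complex) \<Rightarrow> (real ^ 'n \<Rightarrow> complex) \<Rightarrow> real ^ 'n \<Rightarrow> complex" where
  "low_block q a f x = (\<Sum>\<xi>\<in>lattice_box (24 * q). character \<xi> x * a \<xi> * cutoff q 8 \<xi> * fourier_coeff f \<xi>)"

text \<open>Smooth functions are not dense in the Hoelder space, so an extension cannot be obtained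
  by continuity. It is given instead by a series with the symbol frozen at x, which converges for
  every Hoelder function.\<close>

definition holder_extension ::
    "nat \<Rightarrow> (real ^ 'n \<Rightarrow> int ^ 'n \<Rightarrow> complex) \<Rightarrow> (real ^ 'n \<Rightarrow> complex) \<Rightarrow> real ^ 'n \<Rightarrow> complex" where
  "holder_extension q \<sigma> f x = low_block q (\<sigma> x) f x + (\<Sum>j. block q (2 ^ j) (\<sigma> x) f x)"

lemma symbol_bound_norm_le:
  assumes "symbol_bound k \<rho> L a" "0 \<le> L" "\<rho> \<le> 1"
  shows "norm (a \<xi>) \<le> L"
proof -
  let ?e = "- (real CARD('a) / 2 * (1 - \<rho>))"
  have "norm (a \<xi>) \<le> L * japanese_bracket \<xi> powr ?e"
    using assms(1) unfolding symbol_bound_def by (metis (no_types, lifting) diff_zero funpow_0 le0 mult_zero_right of_nat_0)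
  also have "japanese_bracket \<xi> powr ?e \<le> japanese_bracket \<xi> powr 0"
    using assms by (intro powr_mono japanese_bracket_ge_1) auto
  also have "\<dots> \<le> 1" by simp
  finally show ?thesis using assms(2) by (simp add: mult_left_mono)
qed

lemma norm_cutoff_le_1: "1 \<le> R \<Longrightarrow> norm (cutoff q R \<xi>) \<le> 1"
  using norm_difference_cutoff_le[of R 0 q undefined \<xi>] by simp

lemma low_block_bounds:
  fixes f :: "real ^ 'n \<Rightarrow> complex"
  assumes f: "\<And>\<xi>. norm (fourier_coeff f \<xi>) \<le> G" and G: "0 \<le> G"
  shows "(\<And>\<xi>. norm (a \<xi>) \<le> L) \<Longrightarrow> 0 \<le> L \<Longrightarrow> norm (low_block q a f x) \<le> real (card (lattice_box (24 * q) :: (int ^ 'n) set)) * L * G"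
    and "(\<And>\<xi>. norm (a \<xi>) \<le> L) \<Longrightarrow> 0 \<le> L \<Longrightarrow> norm (low_block q a f (x + h) - low_block q a f x)
      \<le> real (card (lattice_box (24 * q) :: (int ^ 'n) set)) * (2 * pi * (norm h * (real CARD('n) * real (24 * q)))) * L * G"
proof -
  assume a: "\<And>\<xi>. norm (a \<xi>) \<le> L" and L: "0 \<le> L"
  have le: "norm (u * a \<xi> * cutoff q 8 \<xi> * fourier_coeff f \<xi>) \<le> U * L * G" if "norm u \<le> U" for u U \<xi>
  proof -
    have "norm u * norm (a \<xi>) * norm (cutoff q 8 \<xi>) * norm (fourier_coeff f \<xi>) \<le> U * L * 1 * G"
      using order_trans[OF norm_ge_zero that] L
      by (intro mult_mono mult_nonneg_nonneg that a f norm_cutoff_le_1) auto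
    then show ?thesis by (simp add: norm_mult)
  qed
  show "norm (low_block q a f x) \<le> real (card (lattice_box (24 * q) :: (int ^ 'n) set)) * L * G"
  proof -
    have "norm (low_block q a f x) \<le> (\<Sum>\<xi>\<in>(lattice_box (24 * q) :: (int ^ 'n) set). 1 * L * G)"
      unfolding low_block_def by (rule sum_norm_le, rule le) simp
    then show ?thesis by simp
  qed
  let ?U = "2 * pi * (norm h * (real CARD('n) * real (24 * q)))"
  have "low_block q a f (x + h) - low_block q a f x
      = (\<Sum>\<xi>\<in>lattice_box (24 * q). (character \<xi> x * (character \<xi> h - 1)) * a \<xi> * cutoff q 8 \<xi> * fourier_coeff f \<xi>)"
    by (simp add: low_block_def sum_subtractf[symmetric] character_add algebra_simps)
  also have "norm \<dots> \<le> (\<Sum>\<xi>\<in>(lattice_box (24 * q) :: (int ^ 'n) set). ?U * L * G)"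
  proof (rule sum_norm_le, rule le)
    fix \<xi> :: "int ^ 'n" assume "\<xi> \<in> lattice_box (24 * q)"
    then have "2 * pi * (norm h * norm (of_lattice \<xi>)) \<le> ?U"
      by (intro mult_left_mono norm_of_lattice_le) auto
    with norm_character_minus_1_le[of \<xi> h] have "norm (character \<xi> h - 1) \<le> ?U"
      by (rule order_trans)
    then show "norm (character \<xi> x * (character \<xi> h - 1)) \<le> ?U"
      by (simp add: norm_mult)
  qed
  finally show "norm (low_block q a f (x + h) - low_block q a f x)
      \<le> real (card (lattice_box (24 * q) :: (int ^ 'n) set)) * ?U * L * G"
    by (simp add: mult_ac)
qed

lemma holder_extension_bound:
  fixes \<sigma> :: "real ^ 'n \<Rightarrow> int ^ 'n \<Rightarrow> complex"
  assumes \<rho>: "0 \<le> \<rho>" "\<rho> \<le> 1" and k: "CARD('n) + 1 \<le> 2 * k" and s: "0 < s" "s < 1" and L: "0 < L"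
    and sym: "\<And>x. symbol_bound k \<rho> L (\<sigma> x)"
    and dsym: "\<And>x h. h \<noteq> 0 \<Longrightarrow> symbol_bound k \<rho> (L * norm h) (\<lambda>\<xi>. \<sigma> (x + h) \<xi> - \<sigma> x \<xi>)"
  shows "\<exists>B>0. \<forall>f H. holder_with s H f \<and> (\<forall>x. norm (f x) \<le> H) \<longrightarrow>
    (\<forall>x. summable (\<lambda>j. block (Suc k) (2 ^ j) (\<sigma> x) f x)) \<and>
    (\<forall>x. norm (holder_extension (Suc k) \<sigma> f x) \<le> B * H) \<and>
    (\<forall>x h. norm (holder_extension (Suc k) \<sigma> f (x + h) - holder_extension (Suc k) \<sigma> f x) \<le> B * H * norm h powr s)"
proof -
  let ?q = "Suc k"
  have s': "0 \<le> s" "s \<le> 1" using s by auto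
  obtain B1 where B1: "0 < B1"
    "\<And>R a L f H x. 1 \<le> R \<Longrightarrow> symbol_bound k \<rho> L a \<Longrightarrow> 0 < L \<Longrightarrow> holder_with s H (f :: real ^ 'n \<Rightarrow> complex) \<Longrightarrow>
      norm (block (Suc k) R a f x) \<le> B1 * L * H * real R powr (- s)"
    "\<And>R a L f H x h. 1 \<le> R \<Longrightarrow> symbol_bound k \<rho> L a \<Longrightarrow> 0 < L \<Longrightarrow> holder_with s H (f :: real ^ 'n \<Rightarrow> complex) \<Longrightarrow>
      norm h * real R \<le> 1 \<Longrightarrow>
      norm (block (Suc k) R a f (x + h) - block (Suc k) R a f x) \<le> B1 * L * H * real R powr (- s) * (norm h * real R)"
    using block_bound[OF \<rho> k s'] by blast
  obtain E where E: "0 < E" and E2: "\<forall>t D d. 0 < t \<longrightarrow> 0 \<le> D \<longrightarrow> (\<forall>j. 0 \<le> d j) \<longrightarrow> (\<forall>j. d j \<le> D * (2 ^ j) powr (- s)) \<longrightarrow>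
      (\<forall>j. t * 2 ^ j \<le> 1 \<longrightarrow> d j \<le> D * (2 ^ j) powr (- s) * (t * 2 ^ j)) \<longrightarrow>
      summable d \<and> suminf d \<le> E * D * t powr s"
    using dyadic_sum_bound[OF s] by blast
  define P where "P f H \<longleftrightarrow> holder_with s H f \<and> (\<forall>x. norm (f x) \<le> H)" for f :: "real ^ 'n \<Rightarrow> complex" and H
  define cd where "cd = real (card (lattice_box (24 * ?q) :: (int ^ 'n) set))"
  define U where "U = 2 * pi * (real CARD('n) * real (24 * ?q))"
  define B0 where "B0 = cd * L + E * (B1 * L)"
  define B2 where "B2 = cd * L + cd * U * L + E * (2 * B1 * L)"
  have cd: "0 \<le> cd" and U: "0 \<le> U" by (simp_all add: cd_def U_def)
  have B0: "0 < B0" using cd L B1(1) E by (simp add: B0_def add_nonneg_pos)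
  have B2: "0 < B2" using cd U L B1(1) E by (simp add: B2_def add_nonneg_pos)
  have cont: "continuous_on UNIV f" if "P f H" for f H
    using that by (auto simp: P_def holder_with_def)
  have fc: "norm (fourier_coeff f \<xi>) \<le> H" if "P f H" for f H \<xi>
    using norm_fourier_coeff_le[OF cont[OF that]] that by (auto simp: P_def)
  have blk: "norm (block ?q (2 ^ j) (\<sigma> x) f y) \<le> B1 * L * H * (2 ^ j) powr (- s)" if "P f H" for f H j x y
    using B1(2)[of "2 ^ j" L "\<sigma> x" H f y, OF _ sym L] that by (simp add: P_def)
  have sa: "norm (\<sigma> x \<xi>) \<le> L" for x \<xi>
    using symbol_bound_norm_le[OF sym] L \<rho> by simp
  \<comment> \<open>The dyadic sum with t = 1: the condition t 2^j <= 1 then concerns j = 0 only,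
    where the linear bound coincides with the uniform one.\<close>
  have sums: "summable (\<lambda>j. norm (block ?q (2 ^ j) (\<sigma> x) f x)) \<and>
      (\<Sum>j. norm (block ?q (2 ^ j) (\<sigma> x) f x)) \<le> E * (B1 * L * H) * 1 powr s" if "P f H" for f H x
  proof (rule E2[rule_format])
    fix j :: nat assume "1 * (2 :: real) ^ j \<le> 1"
    then have "(2 :: real) ^ j = 1" using one_le_power[of "2 :: real" j] by linarith
    then show "norm (block ?q (2 ^ j) (\<sigma> x) f x) \<le> B1 * L * H * (2 ^ j) powr (- s) * (1 * 2 ^ j)"
      using blk[OF that, of j x x] by simp
  qed (use that blk L B1(1) in \<open>auto simp: P_def holder_with_def\<close>)
  have sup: "norm (holder_extension ?q \<sigma> f x) \<le> B0 * H" if "P f H" for f H x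
  proof -
    have H: "0 < H" using that by (simp add: P_def holder_with_def)
    have "norm (holder_extension ?q \<sigma> f x) \<le> norm (low_block ?q (\<sigma> x) f x) + norm (\<Sum>j. block ?q (2 ^ j) (\<sigma> x) f x)"
      unfolding holder_extension_def by (rule norm_triangle_ineq)
    also have "norm (low_block ?q (\<sigma> x) f x) \<le> cd * L * H"
      unfolding cd_def by (rule low_block_bounds(1)[OF fc[OF that] _ sa]) (use H L in auto)
    also have "norm (\<Sum>j. block ?q (2 ^ j) (\<sigma> x) f x) \<le> (\<Sum>j. norm (block ?q (2 ^ j) (\<sigma> x) f x))"
      by (rule summable_norm) (use sums[OF that] in blast)
    also have "\<dots> \<le> E * (B1 * L * H)" using sums[OF that, of x] by simp
    finally show ?thesis by (simp add: B0_def algebra_simps)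
  qed
  have dif1: "norm (holder_extension ?q \<sigma> f (x + h) - holder_extension ?q \<sigma> f x) \<le> B2 * H * norm h powr s"
    if P: "P f H" and h: "h \<noteq> 0" "norm h \<le> 1" for f H x h
  proof -
    have H: "0 < H" using P by (simp add: P_def holder_with_def)
    have hn: "0 < norm h" using h by simp
    have hs: "norm h \<le> norm h powr s"
      using powr_mono'[of s 1 "norm h"] s h by simp
    let ?\<tau> = "\<lambda>\<xi>. \<sigma> (x + h) \<xi> - \<sigma> x \<xi>"
    have L': "0 < L * norm h" using L hn by simp
    have st: "norm (?\<tau> \<xi>) \<le> L * norm h" for \<xi>
      using symbol_bound_norm_le[OF dsym[OF h(1)]] L' \<rho> by simp
    \<comment> \<open>Here and in each block below, the increment is split into the change of the
      symbol with the argument fixed at x + h, and the translation of the argument with the symbol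
      fixed at x.\<close>
    have lin: "low_block ?q (\<sigma> (x + h)) f (x + h) - low_block ?q (\<sigma> x) f x
       = low_block ?q ?\<tau> f (x + h) + (low_block ?q (\<sigma> x) f (x + h) - low_block ?q (\<sigma> x) f x)"
      by (simp add: low_block_def sum_subtractf[symmetric] sum.distrib[symmetric] algebra_simps)
    have "norm (low_block ?q (\<sigma> (x + h)) f (x + h) - low_block ?q (\<sigma> x) f x)
        \<le> cd * (L * norm h) * H + cd * (U * norm h) * L * H"
      unfolding lin
    proof (rule norm_triangle_le, rule add_mono)
      show "norm (low_block ?q ?\<tau> f (x + h)) \<le> cd * (L * norm h) * H"
        unfolding cd_def by (rule low_block_bounds(1)[OF fc[OF P] _ st]) (use H L in auto)
      show "norm (low_block ?q (\<sigma> x) f (x + h) - low_block ?q (\<sigma> x) f x) \<le> cd * (U * norm h) * L * H"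
        using low_block_bounds(2)[where a="\<sigma> x" and L=L and f=f and G=H and h=h and x=x and q="?q"] fc[OF P] H L sa
        by (simp add: cd_def U_def mult_ac)
    qed
    also have "\<dots> = (cd * L + cd * U * L) * H * norm h" by (simp add: algebra_simps)
    also have "\<dots> \<le> (cd * L + cd * U * L) * H * norm h powr s"
      using cd U L H by (intro mult_left_mono hs mult_nonneg_nonneg add_nonneg_nonneg) auto
    finally have low: "norm (low_block ?q (\<sigma> (x + h)) f (x + h) - low_block ?q (\<sigma> x) f x)
        \<le> (cd * L + cd * U * L) * H * norm h powr s" .
    let ?d = "\<lambda>j. block ?q (2 ^ j) (\<sigma> (x + h)) f (x + h) - block ?q (2 ^ j) (\<sigma> x) f x"
    have sd: "summable (\<lambda>j. norm (?d j)) \<and> (\<Sum>j. norm (?d j)) \<le> E * (2 * B1 * L * H) * norm h powr s"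
    proof (rule E2[rule_format, OF hn])
      show "norm (?d j) \<le> 2 * B1 * L * H * (2 ^ j) powr (- s)" for j
        using norm_triangle_ineq4[of "block ?q (2 ^ j) (\<sigma> (x + h)) f (x + h)" "block ?q (2 ^ j) (\<sigma> x) f x"]
          blk[OF P, of j "x + h" "x + h"] blk[OF P, of j x x] by linarith
      fix j :: nat assume j: "norm h * 2 ^ j \<le> 1"
      have "?d j = block ?q (2 ^ j) ?\<tau> f (x + h)
          + (block ?q (2 ^ j) (\<sigma> x) f (x + h) - block ?q (2 ^ j) (\<sigma> x) f x)"
        by (simp add: block_def sum_subtractf[symmetric] sum.distrib[symmetric] algebra_simps)
      also have "norm \<dots> \<le> B1 * (L * norm h) * H * (2 ^ j) powr (- s) + B1 * L * H * (2 ^ j) powr (- s) * (norm h * 2 ^ j)"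
      proof (rule norm_triangle_le, rule add_mono)
        show "norm (block ?q (2 ^ j) ?\<tau> f (x + h)) \<le> B1 * (L * norm h) * H * (2 ^ j) powr (- s)"
          using B1(2)[of "2 ^ j" "L * norm h" ?\<tau> H f "x + h", OF _ dsym[OF h(1)] L'] P by (simp add: P_def)
        show "norm (block ?q (2 ^ j) (\<sigma> x) f (x + h) - block ?q (2 ^ j) (\<sigma> x) f x)
            \<le> B1 * L * H * (2 ^ j) powr (- s) * (norm h * 2 ^ j)"
          using B1(3)[of "2 ^ j" L "\<sigma> x" H f h x, OF _ sym L] P j by (simp add: P_def)
      qed
      \<comment> \<open>The change of the symbol gains |h| at every scale, and |h| <= |h| 2^j brings
        it under the bound for the translation part.\<close>
      also have "B1 * (L * norm h) * H * (2 ^ j) powr (- s) = B1 * L * H * (2 ^ j) powr (- s) * (norm h * 1)"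
        by simp
      also have "\<dots> \<le> B1 * L * H * (2 ^ j) powr (- s) * (norm h * 2 ^ j)"
        using B1(1) L H by (intro mult_left_mono) auto
      finally show "norm (?d j) \<le> 2 * B1 * L * H * (2 ^ j) powr (- s) * (norm h * 2 ^ j)" by (simp add: mult_ac)
    qed (use B1 L H in auto)
    have "holder_extension ?q \<sigma> f (x + h) - holder_extension ?q \<sigma> f x
        = (low_block ?q (\<sigma> (x + h)) f (x + h) - low_block ?q (\<sigma> x) f x) + (\<Sum>j. ?d j)"
      unfolding holder_extension_def using sums[OF P]
      by (subst suminf_diff[symmetric]) (auto intro: summable_norm_cancel)
    also have "norm \<dots> \<le> (cd * L + cd * U * L) * H * norm h powr s + E * (2 * B1 * L * H) * norm h powr s"
    proof (rule norm_triangle_le, rule add_mono[OF low])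
      show "norm (\<Sum>j. ?d j) \<le> E * (2 * B1 * L * H) * norm h powr s"
        using summable_norm[of ?d] sd by linarith
    qed
    also have "\<dots> = B2 * H * norm h powr s" by (simp add: B2_def algebra_simps)
    finally show ?thesis .
  qed
  \<comment> \<open>\<open>B2\<close> serves increments with |h| <= 1; for |h| > 1 two values of
    size \<open>B0 * H\<close> are enough, since |h|^s >= 1.\<close>
  define B where "B = 2 * B0 + B2"
  show ?thesis
  proof (intro exI[of _ B] conjI[of "B > 0"] allI impI)
    show "0 < B" using B0 B2 by (simp add: B_def)
  next
    fix f :: "real ^ 'n \<Rightarrow> complex" and H
    assume "holder_with s H f \<and> (\<forall>x. norm (f x) \<le> H)"
    then have P: "P f H" by (simp add: P_def)
    then have H: "0 < H" by (simp add: P_def holder_with_def)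
    have 1: "summable (\<lambda>j. block (Suc k) (2 ^ j) (\<sigma> x) f x)" for x
      by (rule summable_norm_cancel[OF conjunct1[OF sums[OF P]]])
    have "B0 * H \<le> B * H" using B0 B2 H by (intro mult_right_mono) (auto simp: B_def)
    then have 2: "norm (holder_extension (Suc k) \<sigma> f x) \<le> B * H" for x
      using sup[OF P, of x] by linarith
    have 3: "norm (holder_extension (Suc k) \<sigma> f (x + h) - holder_extension (Suc k) \<sigma> f x) \<le> B * H * norm h powr s" for x h
    proof (cases "h = 0")
      case False
      show ?thesis
      proof (cases "norm h \<le> 1")
        case True
        have "B2 * H * norm h powr s \<le> B * H * norm h powr s"
          using B0 H by (intro mult_right_mono) (auto simp: B_def)
        with dif1[OF P False True, of x] show ?thesis by linarith
      next
        case big: False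
        have "norm (holder_extension ?q \<sigma> f (x + h) - holder_extension ?q \<sigma> f x) \<le> B0 * H + B0 * H"
          by (rule norm_triangle_le_diff, rule add_mono; rule sup[OF P])
        also have "\<dots> \<le> B * H * 1" using B2 H by (simp add: B_def algebra_simps)
        also have "\<dots> \<le> B * H * norm h powr s"
          using big s H B0 B2 by (intro mult_left_mono ge_one_powr_ge_zero) (auto simp: B_def)
        finally show ?thesis .
      qed
    qed simp
    from 1 2 3 show "(\<forall>x. summable (\<lambda>j. block (Suc k) (2 ^ j) (\<sigma> x) f x)) \<and>
      (\<forall>x. norm (holder_extension (Suc k) \<sigma> f x) \<le> B * H) \<and>
      (\<forall>x h. norm (holder_extension (Suc k) \<sigma> f (x + h) - holder_extension (Suc k) \<sigma> f x) \<le> B * H * norm h powr s)"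
      by blast
  qed
qed

section \<open>Smooth functions\<close>

lemma partial_deriv_eq:
  assumes "(f has_derivative D) (at x)"
  shows "partial_deriv j f x = D (axis j 1)"
proof -
  interpret bounded_linear D using assms by (rule has_derivative_bounded_linear)
  have "((\<lambda>t. f (x + t *\<^sub>R axis j 1)) has_derivative (\<lambda>t. D (t *\<^sub>R axis j 1))) (at 0)"
    by (rule has_derivative_compose[where f="\<lambda>t. x + t *\<^sub>R axis j 1"])
       (use assms in \<open>auto intro!: derivative_eq_intros\<close>)
  then show ?thesis
    unfolding partial_deriv_def
    by (intro vector_derivative_at) (simp add: has_vector_derivative_def scaleR)
qed

lemma has_vector_derivative_line:
  assumes "f differentiable (at (x + t *\<^sub>R axis j 1))"
  shows "((\<lambda>t. f (x + t *\<^sub>R axis j 1)) has_vector_derivative partial_deriv j f (x + t *\<^sub>R axis j 1)) (at t)"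
proof -
  obtain D where D: "(f has_derivative D) (at (x + t *\<^sub>R axis j 1))"
    using assms by (auto simp: differentiable_def)
  interpret bounded_linear D using D by (rule has_derivative_bounded_linear)
  have "((\<lambda>t. f (x + t *\<^sub>R axis j 1)) has_derivative (\<lambda>t. D (t *\<^sub>R axis j 1))) (at t)"
    by (rule has_derivative_compose[where f="\<lambda>t. x + t *\<^sub>R axis j 1"])
       (use D in \<open>auto intro!: derivative_eq_intros\<close>)
  then show ?thesis
    by (simp add: has_vector_derivative_def scaleR partial_deriv_eq[OF D])
qed

lemma norm_diff_le_partial_deriv:
  fixes f :: "real ^ 'n \<Rightarrow> complex"
  assumes diff: "\<And>x. f differentiable (at x)" and K: "\<And>x p. norm (partial_deriv p f x) \<le> K"
  shows "norm (f (x + h) - f x) \<le> real CARD('n) * K * norm h"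
proof -
  define f' where "f' x = (SOME D. (f has_derivative D) (at x))" for x
  have f': "(f has_derivative f' x) (at x)" for x
    using diff[of x] unfolding f'_def differentiable_def by (rule someI_ex)
  have on: "onorm (f' y) \<le> real CARD('n) * K" for y
  proof (rule onorm_le)
    fix v :: "real ^ 'n"
    interpret bounded_linear "f' y" using f' by (rule has_derivative_bounded_linear)
    have "v = (\<Sum>p\<in>UNIV. v $ p *\<^sub>R axis p 1)"
      by (simp add: vec_eq_iff axis_def if_distrib[of "(*) _"] cong: if_cong)
    then have "f' y v = (\<Sum>p\<in>UNIV. v $ p *\<^sub>R f' y (axis p 1))"
      by (metis (no_types, lifting) scaleR sum sum.cong)
    also have "norm \<dots> \<le> (\<Sum>p\<in>(UNIV :: 'n set). norm v * K)"
    proof (rule sum_norm_le)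
      fix p
      have "norm (v $ p *\<^sub>R f' y (axis p 1)) = \<bar>v $ p\<bar> * norm (partial_deriv p f y)"
        by (simp add: partial_deriv_eq[OF f'])
      also have "\<dots> \<le> norm v * K"
        by (intro mult_mono component_le_norm_cart K) auto
      finally show "norm (v $ p *\<^sub>R f' y (axis p 1)) \<le> norm v * K" .
    qed
    finally show "norm (f' y v) \<le> real CARD('n) * K * norm v" by (simp add: mult_ac)
  qed
  show ?thesis
    using differentiable_bound[of UNIV f f' "real CARD('n) * K" "x + h" x] f' on by simp
qed

lemma smooth_torus_periodic: "f \<in> smooth_torus \<Longrightarrow> periodic f"
  by (simp add: smooth_torus_def)

lemma smooth_torus_differentiable: "f \<in> smooth_torus \<Longrightarrow> f differentiable (at x)"
  unfolding smooth_torus_def differentiable_on_def by (auto dest!: spec[of _ "[]"])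

lemma smooth_torus_continuous: "f \<in> smooth_torus \<Longrightarrow> continuous_on UNIV f"
  using differentiable_imp_continuous_on[of f UNIV]
  by (auto simp: smooth_torus_def dest!: spec[of _ "[]"])

lemma smooth_torus_partial_deriv: "f \<in> smooth_torus \<Longrightarrow> partial_deriv j f \<in> smooth_torus"
proof -
  assume f: "f \<in> smooth_torus"
  have "f (x + of_lattice z + t *\<^sub>R axis j 1) = f (x + t *\<^sub>R axis j 1)" for x z t
    using periodicD[OF smooth_torus_periodic[OF f], of "x + t *\<^sub>R axis j 1" z] by (simp add: add_ac)
  then have "periodic (partial_deriv j f)"
    by (simp add: periodic_def partial_deriv_def)
  moreover have "foldr partial_deriv js (partial_deriv j f) = foldr partial_deriv (js @ [j]) f" for js
    by simp
  ultimately show ?thesis using f by (simp add: smooth_torus_def del: foldr_append)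
qed

text \<open>Instead of integrating by parts, differentiate t |-> integral of
  \<open>character \<xi> (- x) * f (x + t e_j)\<close> at 0 in two ways: under the integral sign,
  and after translation invariance has turned it into \<open>character \<xi> (t e_j)\<close> times
  the coefficient of \<open>f\<close>.\<close>

lemma fourier_coeff_partial_deriv:
  assumes f: "f \<in> smooth_torus"
  shows "fourier_coeff (partial_deriv j f) \<xi> = 2 * pi * \<i> * of_int (\<xi> $ j) * fourier_coeff f \<xi>"
proof -
  let ?e = "axis j 1 :: real ^ 'a"
  note cont = smooth_torus_continuous[OF f]
    and contd = smooth_torus_continuous[OF smooth_torus_partial_deriv[OF f], of j]
  let ?F = "\<lambda>t. integral (cbox 0 One) (\<lambda>x. character \<xi> (- x) * f (x + t *\<^sub>R ?e))"
  have "(?F has_vector_derivative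
      integral (cbox 0 One) (\<lambda>x. character \<xi> (- x) * partial_deriv j f (x + 0 *\<^sub>R ?e))) (at 0 within UNIV)"
  proof (rule leibniz_rule_vector_derivative[where fx="\<lambda>t x. character \<xi> (- x) * partial_deriv j f (x + t *\<^sub>R ?e)"])
    fix t and x :: "real ^ 'a"
    show "((\<lambda>t. character \<xi> (- x) * f (x + t *\<^sub>R ?e)) has_vector_derivative
        character \<xi> (- x) * partial_deriv j f (x + t *\<^sub>R ?e)) (at t within UNIV)"
      by (intro has_vector_derivative_mult_right)
         (use has_vector_derivative_line[OF smooth_torus_differentiable[OF f]] in auto)
  next
    fix t
    show "(\<lambda>x. character \<xi> (- x) * f (x + t *\<^sub>R ?e)) integrable_on cbox 0 One"
      by (intro integrable_character_mult continuous_on_compose2[OF cont] continuous_intros) auto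
  next
    show "continuous_on (UNIV \<times> cbox 0 One) (\<lambda>(t, x). character \<xi> (- x) * partial_deriv j f (x + t *\<^sub>R ?e))"
      unfolding case_prod_unfold
      by (intro continuous_intros continuous_on_compose2[OF contd]) auto
  qed auto
  then have 1: "(?F has_vector_derivative fourier_coeff (partial_deriv j f) \<xi>) (at 0)"
    by (simp add: fourier_coeff_character_def)
  have F: "?F t = cis (2 * pi * of_int (\<xi> $ j) * t) * fourier_coeff f \<xi>" for t
  proof -
    have "integral (cbox 0 (0 + ones)) (\<lambda>x. character \<xi> (- (x + t *\<^sub>R ?e)) * f (x + t *\<^sub>R ?e)) = fourier_coeff f \<xi>"
      unfolding fourier_coeff_character_def
      by (rule integral_periodic_shift[where f="\<lambda>x. character \<xi> (- x) * f x"])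
         (intro continuous_intros cont periodic_mult periodic_character_minus smooth_torus_periodic[OF f])+
    moreover have "character \<xi> (- x) * f (x + t *\<^sub>R ?e)
        = character \<xi> (t *\<^sub>R ?e) * (character \<xi> (- (x + t *\<^sub>R ?e)) * f (x + t *\<^sub>R ?e))" for x
      using character_add[of \<xi> "t *\<^sub>R ?e" "- (x + t *\<^sub>R ?e)"] by simp
    then have "(\<lambda>x. character \<xi> (- x) * f (x + t *\<^sub>R ?e))
        = (\<lambda>x. character \<xi> (t *\<^sub>R ?e) * (character \<xi> (- (x + t *\<^sub>R ?e)) * f (x + t *\<^sub>R ?e)))"
      by (rule ext)
    ultimately have "?F t = character \<xi> (t *\<^sub>R ?e) * fourier_coeff f \<xi>"
      by (simp only: integral_mult_right One_eq_ones add_0_left)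
    then show ?thesis by (simp add: character_def inner_axis' mult_ac)
  qed
  have 2: "(?F has_vector_derivative 2 * pi * \<i> * of_int (\<xi> $ j) * fourier_coeff f \<xi>) (at 0)"
  proof -
    have "((\<lambda>t. cis (2 * pi * of_int (\<xi> $ j) * t)) has_vector_derivative \<i> * complex_of_real (2 * pi * of_int (\<xi> $ j))) (at 0)"
    proof -
      have "((\<lambda>t. exp (\<i> * of_real (2 * pi * of_int (\<xi> $ j) * t))) has_derivative
          (\<lambda>h. exp (\<i> * of_real (2 * pi * of_int (\<xi> $ j) * 0)) * (\<i> * of_real (2 * pi * of_int (\<xi> $ j) * h)))) (at 0)"
        by (rule has_derivative_compose[OF _ has_field_derivative_imp_has_derivative[OF DERIV_exp]])
           (auto intro!: derivative_eq_intros)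
      then show ?thesis
        by (simp add: cis_conv_exp has_vector_derivative_def scaleR_conv_of_real mult_ac)
    qed
    from has_vector_derivative_mult_left[OF this, of "fourier_coeff f \<xi>"] show ?thesis
      unfolding F by (simp add: mult_ac)
  qed
  show ?thesis by (rule vector_derivative_unique_at[OF 1 2])
qed

lemma fourier_coeff_decay:
  fixes f :: "real ^ 'n \<Rightarrow> complex"
  assumes f: "f \<in> smooth_torus"
  obtains S where "0 \<le> S" "\<And>j \<xi>. real_of_int \<bar>\<xi> $ j\<bar> ^ N * norm (fourier_coeff f \<xi>) \<le> S"
    "\<And>\<xi>. norm (fourier_coeff f \<xi>) \<le> S"
proof -
  have sm: "(partial_deriv j ^^ i) f \<in> smooth_torus" for i j
    by (induction i) (auto intro: f smooth_torus_partial_deriv)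
  have fc: "fourier_coeff ((partial_deriv j ^^ i) f) \<xi> = (2 * pi * \<i> * of_int (\<xi> $ j)) ^ i * fourier_coeff f \<xi>" for i j \<xi>
    by (induction i) (simp_all add: fourier_coeff_partial_deriv[OF sm])
  have "\<exists>B. \<forall>x. norm ((partial_deriv j ^^ i) f x) \<le> B" for i j
    using periodic_bounded[OF smooth_torus_continuous[OF sm] smooth_torus_periodic[OF sm]]
    by (auto simp: bdd_above_def)
  then obtain B where B: "\<And>i j x. norm ((partial_deriv j ^^ i) f x) \<le> B i j" by metis
  have B0: "0 \<le> B i j" for i j using order_trans[OF norm_ge_zero B] .
  \<comment> \<open>The second summand bounds \<open>f\<close> itself; with no derivative taken any
    direction will do, hence \<open>undefined\<close>.\<close>
  define S where "S = (\<Sum>j\<in>UNIV. B N j) + B 0 undefined"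
  have BS: "B N j \<le> (\<Sum>j\<in>UNIV. B N j)" for j by (rule member_le_sum) (auto intro: B0)
  show ?thesis
  proof
    show "0 \<le> S" by (simp add: S_def sum_nonneg B0)
    have "norm (fourier_coeff f \<xi>) \<le> B 0 undefined" for \<xi>
      using norm_fourier_coeff_le[OF smooth_torus_continuous[OF f], of "B 0 undefined"] B[where i=0 and j=undefined] by simp
    moreover have "0 \<le> (\<Sum>j\<in>UNIV. B N j)" by (simp add: sum_nonneg B0)
    ultimately show "norm (fourier_coeff f \<xi>) \<le> S" for \<xi> by (auto simp: S_def intro: add_increasing)
    fix j \<xi>
    have "real_of_int \<bar>\<xi> $ j\<bar> ^ N * norm (fourier_coeff f \<xi>) \<le> (2 * pi * real_of_int \<bar>\<xi> $ j\<bar>) ^ N * norm (fourier_coeff f \<xi>)"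
      using pi_gt3 by (intro mult_right_mono power_mono) (auto intro: mult_right_mono[of 1 "2 * pi", simplified])
    also have "\<dots> = norm (fourier_coeff ((partial_deriv j ^^ N) f) \<xi>)"
      by (simp add: fc norm_mult norm_power)
    also have "\<dots> \<le> B N j" by (rule norm_fourier_coeff_le[OF smooth_torus_continuous[OF sm] B])
    also have "\<dots> \<le> S" using BS[of j] B0[of 0 undefined] by (simp add: S_def)
    finally show "real_of_int \<bar>\<xi> $ j\<bar> ^ N * norm (fourier_coeff f \<xi>) \<le> S" .
  qed
qed

lemma finite_subset_lattice_box:
  fixes X :: "(int ^ 'n) set"
  assumes X: "finite X"
  shows "\<exists>m. X \<subseteq> lattice_box m"
proof (intro exI subsetI)
  fix \<xi> assume \<xi>: "\<xi> \<in> X"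
  have "\<bar>\<xi> $ i\<bar> \<le> int (nat (\<Sum>\<xi>\<in>X. \<Sum>i\<in>UNIV. \<bar>\<xi> $ i\<bar>))" for i
  proof -
    have "\<bar>\<xi> $ i\<bar> \<le> (\<Sum>i\<in>UNIV. \<bar>\<xi> $ i\<bar>)" by (rule member_le_sum) auto
    also have "\<dots> \<le> (\<Sum>\<xi>\<in>X. \<Sum>i\<in>UNIV. \<bar>\<xi> $ i\<bar>)"
      by (rule member_le_sum[OF \<xi>]) (auto simp: sum_nonneg X)
    finally show ?thesis by linarith
  qed
  then show "\<xi> \<in> lattice_box (nat (\<Sum>\<xi>\<in>X. \<Sum>i\<in>UNIV. \<bar>\<xi> $ i\<bar>))"
    unfolding lattice_box_def by blast
qed

text \<open>Decay of order n + 1 beats the growth of the lattice: the shell between the boxes 2^J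
  and 2^(J+1) has at most (6 * 2^J)^n points, each with a coefficient of size at most S / 2^(J
  (n+1)), so it contributes O(2^(-J)).\<close>

lemma fourier_coeff_summable:
  fixes f :: "real ^ 'n \<Rightarrow> complex"
  assumes f: "f \<in> smooth_torus"
  shows "(\<lambda>\<xi>. norm (fourier_coeff f \<xi>)) summable_on UNIV"
proof -
  let ?n = "CARD('n)" and ?c = "\<lambda>\<xi>. norm (fourier_coeff f \<xi>)"
  let ?B = "\<lambda>J. lattice_box (2 ^ J) :: (int ^ 'n) set"
  obtain S where S: "0 \<le> S" "\<And>j \<xi>. real_of_int \<bar>\<xi> $ j\<bar> ^ (?n + 1) * ?c \<xi> \<le> S" "\<And>\<xi>. ?c \<xi> \<le> S"
    using fourier_coeff_decay[OF f, of "?n + 1"] by blast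
  have card: "real (card (?B J)) \<le> (3 * 2 ^ J) ^ ?n" for J
  proof -
    have "real (card (?B J)) \<le> real ((2 * 2 ^ J + 1) ^ ?n)" by (rule of_nat_mono[OF card_lattice_box_le])
    also have "\<dots> \<le> (3 * 2 ^ J) ^ ?n" unfolding of_nat_power by (intro power_mono) auto
    finally show ?thesis .
  qed
  have shell: "sum ?c (?B (Suc J) - ?B J) \<le> 6 ^ ?n * S * (1/2) ^ J" for J
  proof -
    have le: "?c \<xi> \<le> S / (2 ^ J) ^ (?n + 1)" if "\<xi> \<in> ?B (Suc J) - ?B J" for \<xi>
    proof -
      have "\<xi> \<notin> ?B J" using that by simp
      then obtain j where "\<not> \<bar>\<xi> $ j\<bar> \<le> int (2 ^ J)" unfolding lattice_box_def by blast
      then have "real (2 ^ J) \<le> real_of_int \<bar>\<xi> $ j\<bar>" by linarith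
      then have "2 ^ J \<le> real_of_int \<bar>\<xi> $ j\<bar>" by simp
      then have "(2 ^ J) ^ (?n + 1) * ?c \<xi> \<le> real_of_int \<bar>\<xi> $ j\<bar> ^ (?n + 1) * ?c \<xi>"
        by (intro mult_right_mono power_mono) auto
      also have "\<dots> \<le> S" by (rule S)
      finally show ?thesis by (simp add: field_simps)
    qed
    have "sum ?c (?B (Suc J) - ?B J) \<le> real (card (?B (Suc J) - ?B J)) * (S / (2 ^ J) ^ (?n + 1))"
      by (rule sum_bounded_above[OF le])
    also have "\<dots> \<le> (3 * 2 ^ Suc J) ^ ?n * (S / (2 ^ J) ^ (?n + 1))"
    proof (intro mult_right_mono)
      have "card (?B (Suc J) - ?B J) \<le> card (?B (Suc J))" by (rule card_mono) auto
      with card[of "Suc J"] show "real (card (?B (Suc J) - ?B J)) \<le> (3 * 2 ^ Suc J) ^ ?n" by linarith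
    qed (use S in auto)
    also have "3 * 2 ^ Suc J = 6 * (2 :: real) ^ J" by simp
    also have "(6 * (2 :: real) ^ J) ^ ?n * (S / (2 ^ J) ^ (?n + 1)) = 6 ^ ?n * S * (1/2) ^ J"
      by (simp add: power_mult_distrib power_one_over)
    finally show ?thesis .
  qed
  have bound: "sum ?c (?B J) \<le> 3 ^ ?n * S + 6 ^ ?n * S * (\<Sum>i<J. (1/2) ^ i)" for J
  proof (induction J)
    case 0
    have "sum ?c (?B 0) \<le> real (card (?B 0)) * S" by (rule sum_bounded_above[OF S(3)])
    also have "\<dots> \<le> 3 ^ ?n * S" using card[of 0] S by (intro mult_right_mono) auto
    finally show ?case by simp
  next
    case (Suc J)
    have sub: "?B J \<subseteq> ?B (Suc J)" by (rule lattice_box_mono) simp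
    have "sum ?c (?B (Suc J)) = sum ?c (?B (Suc J) - ?B J) + sum ?c (?B J)"
      by (rule sum.subset_diff[OF sub]) simp
    with shell[of J] Suc show ?case by (simp add: algebra_simps)
  qed
  show ?thesis
  proof (rule nonneg_bdd_above_summable_on)
    show "bdd_above (sum ?c ` {F. F \<subseteq> UNIV \<and> finite F})"
    proof (rule bdd_aboveI2)
      fix F :: "(int ^ 'n) set" assume "F \<in> {F. F \<subseteq> UNIV \<and> finite F}"
      then have F: "finite F" by simp
      obtain m where "F \<subseteq> lattice_box m" using finite_subset_lattice_box[OF F] by blast
      moreover have "lattice_box m \<subseteq> ?B m" by (rule lattice_box_mono) (rule less_imp_le[OF less_exp])
      ultimately have J: "F \<subseteq> ?B m" by blast
      have "sum ?c F \<le> sum ?c (?B m)" by (rule sum_mono2[OF _ J]) auto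
      also have "\<dots> \<le> 3 ^ ?n * S + 6 ^ ?n * S * (\<Sum>i<m. (1/2) ^ i)" by (rule bound)
      also have "\<dots> \<le> 3 ^ ?n * S + 6 ^ ?n * S * 2"
        using S by (intro add_left_mono mult_left_mono) (auto simp: sum_gp_strict)
      finally show "sum ?c F \<le> 3 ^ ?n * S + 6 ^ ?n * S * 2" .
    qed
  qed auto
qed

section \<open>Characters as test functions: the symbol recovered from the operator\<close>

lemma character_has_derivative:
  "(character \<xi> has_derivative (\<lambda>h. 2 * pi * \<i> * of_real (h \<bullet> of_lattice \<xi>) * character \<xi> x)) (at x)"
proof -
  have "((\<lambda>x. exp (\<i> * of_real (2 * pi * (x \<bullet> of_lattice \<xi>)))) has_derivative
      (\<lambda>h. exp (\<i> * of_real (2 * pi * (x \<bullet> of_lattice \<xi>))) * (\<i> * of_real (2 * pi * (h \<bullet> of_lattice \<xi>))))) (at x)"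
    by (rule has_derivative_compose[OF _ has_field_derivative_imp_has_derivative[OF DERIV_exp]])
       (auto intro!: derivative_eq_intros)
  then show ?thesis by (simp add: character_def[abs_def] cis_conv_exp mult_ac)
qed

lemma character_smooth: "character \<xi> \<in> smooth_torus"
proof -
  have "\<exists>c. foldr partial_deriv js (character \<xi>) = (\<lambda>x. c * character \<xi> x)" for js
  proof (induction js)
    case Nil
    show ?case by (rule exI[of _ 1]) simp
  next
    case (Cons j js)
    then obtain c where c: "foldr partial_deriv js (character \<xi>) = (\<lambda>x. c * character \<xi> x)" by blast
    have "partial_deriv j (\<lambda>x. c * character \<xi> x) x = (c * (2 * pi * \<i> * of_int (\<xi> $ j))) * character \<xi> x" for x
      by (subst partial_deriv_eq[OF has_derivative_mult_right[OF character_has_derivative]])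
         (simp add: inner_axis')
    then show ?case using c by auto
  qed
  moreover have "(\<lambda>x. c * character \<xi> x) differentiable_on UNIV" for c
    using has_derivative_mult_right[OF character_has_derivative]
    by (auto simp: differentiable_on_def differentiable_def intro: has_derivative_at_withinI)
  ultimately have "foldr partial_deriv js (character \<xi>) differentiable_on UNIV" for js by metis
  then show ?thesis by (simp add: smooth_torus_def periodic_character)
qed

lemma psdo_character:
  assumes "psdo_with_symbol A \<sigma>"
  shows "A (character \<xi>) x = character \<xi> x * \<sigma> x \<xi>"
proof -
  have fc: "fourier_coeff (character \<xi>) \<eta> = (if \<eta> = \<xi> then 1 else 0)" for \<eta>
    using fourier_coeff_sum_character[of "{\<xi>}" "\<lambda>_. 1" \<eta>] by simp
  have "A (character \<xi>) x = (\<Sum>\<^sub>\<infinity>\<eta>. character \<eta> x * \<sigma> x \<eta> * fourier_coeff (character \<xi>) \<eta>)"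
    using assms character_smooth unfolding psdo_with_symbol_def character_def[symmetric] by blast
  also have "\<dots> = (\<Sum>\<^sub>\<infinity>\<eta>\<in>{\<xi>}. character \<eta> x * \<sigma> x \<eta>)"
    by (rule infsum_cong_neutral) (auto simp: fc)
  finally show ?thesis by simp
qed

text \<open>\<open>partial_deriv\<close> is total, so bounds on it say nothing about
  differentiability. That comes from A preserving smoothness, because \<sigma>(x,\<xi>) is
  \<open>character (- \<xi>) x\<close> times the value of A at \<open>character \<xi>\<close>. The
  mean value inequality for \<sigma> rests on this.\<close>

lemma symbol_differentiable:
  assumes "psdo_with_symbol A \<sigma>"
  shows "(\<lambda>y. (difference j ^^ i) (\<sigma> y) \<xi>) differentiable (at x)"
proof (induction i arbitrary: \<xi>)
  case 0
  have "A (character \<xi>) \<in> smooth_torus" using assms character_smooth by (auto simp: psdo_with_symbol_def)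
  then have "A (character \<xi>) differentiable (at x)" by (rule smooth_torus_differentiable)
  moreover have "(\<lambda>y. character (- \<xi>) y) differentiable (at x)"
    using character_has_derivative unfolding differentiable_def by blast
  ultimately have "(\<lambda>y. character (- \<xi>) y * A (character \<xi>) y) differentiable (at x)"
    by (rule differentiable_mult[rotated])
  moreover have "character (- \<xi>) y * A (character \<xi>) y = \<sigma> y \<xi>" for y
    using character_cancel[of \<xi> y]
    by (simp add: psdo_character[OF assms] character_minus_freq mult.assoc[symmetric] mult.commute)
  ultimately show ?case by simp
next
  case (Suc i)
  then show ?case
    by (simp add: difference_def[of j "(difference j ^^ i) g" for g] differentiable_diff)
qed

lemma mi_compose_axis: "mi_compose D (axis j i) f = (D j ^^ i) f"
proof -
  have "foldr (\<lambda>l. D l ^^ (axis j i $ l)) xs f = (if j \<in> set xs then (D j ^^ i) f else f)" if "distinct xs" for xs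
    using that by (induction xs) (auto simp: axis_def)
  then show ?thesis by (simp add: mi_compose_def)
qed

lemma mi_length_axis: "mi_length (axis j i) = i"
  by (simp add: mi_length_def axis_def)

section \<open>Agreement of the series with the operator on smooth functions\<close>

lemma filterlim_lattice_box:
  assumes "1 \<le> c"
  shows "filterlim (\<lambda>J. lattice_box (c * 2 ^ J) :: (int ^ 'n) set) (finite_subsets_at_top UNIV) sequentially"
  unfolding filterlim_finite_subsets_at_top
proof (intro allI impI)
  fix X :: "(int ^ 'n) set" assume "finite X \<and> X \<subseteq> UNIV"
  then obtain m where "X \<subseteq> lattice_box m" using finite_subset_lattice_box by blast
  moreover have "m \<le> c * 2 ^ J" if "m \<le> J" for J
  proof -
    have "m \<le> 2 ^ J" using that less_exp[of J] by linarith
    also have "\<dots> \<le> c * 2 ^ J" using assms by simp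
    finally show ?thesis .
  qed
  ultimately have "X \<subseteq> lattice_box (c * 2 ^ J)" if "m \<le> J" for J
    using lattice_box_mono that by blast
  then show "\<forall>\<^sub>F J in sequentially. finite (lattice_box (c * 2 ^ J) :: (int ^ 'n) set)
      \<and> X \<subseteq> lattice_box (c * 2 ^ J) \<and> lattice_box (c * 2 ^ J) \<subseteq> (UNIV :: (int ^ 'n) set)"
    by (auto intro: eventually_sequentiallyI)
qed

text \<open>Telescoping: the annulus at 2^j is the cutoff at scale 8 * 2^(j+1) minus that at 8 *
  2^j, and the low block supplies the initial cutoff at scale 8.\<close>

lemma low_block_plus_blocks:
  assumes q: "1 \<le> q"
  shows "low_block q a f x + (\<Sum>j<J. block q (2 ^ j) a f x)
    = (\<Sum>\<xi>\<in>lattice_box (24 * q * 2 ^ J). character \<xi> x * a \<xi> * cutoff q (8 * 2 ^ J) \<xi> * fourier_coeff f \<xi>)"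
proof (induction J)
  case 0
  then show ?case by (simp add: low_block_def)
next
  case (Suc J)
  let ?R = "2 ^ J :: nat"
  let ?t = "\<lambda>\<xi>. character \<xi> x * a \<xi> * cutoff q (8 * ?R) \<xi> * fourier_coeff f \<xi>"
  have R: "1 \<le> 8 * ?R" by simp
  have "(\<Sum>\<xi>\<in>lattice_box (24 * q * ?R). ?t \<xi>) = (\<Sum>\<xi>\<in>lattice_box (48 * q * ?R). ?t \<xi>)"
  proof (rule sum.mono_neutral_left)
    show "lattice_box (24 * q * ?R) \<subseteq> (lattice_box (48 * q * ?R) :: (int ^ 'a) set)" by (rule lattice_box_mono) simp
    show "\<forall>\<xi>\<in>lattice_box (48 * q * ?R) - lattice_box (24 * q * ?R). ?t \<xi> = 0"
    proof
      fix \<xi> :: "int ^ 'a" assume "\<xi> \<in> lattice_box (48 * q * ?R) - lattice_box (24 * q * ?R)"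
      then have "\<xi> \<notin> lattice_box (3 * q * (8 * ?R))" by (simp add: mult_ac)
      then have "cutoff q (8 * ?R) \<xi> = 0" by (rule cutoff_eq_0[OF R])
      then show "?t \<xi> = 0" by simp
    qed
  qed simp
  with Suc have "low_block q a f x + (\<Sum>j<Suc J. block q (2 ^ j) a f x)
    = (\<Sum>\<xi>\<in>lattice_box (48 * q * ?R). ?t \<xi>) + block q ?R a f x"
    by (simp add: add.assoc[symmetric])
  also have "\<dots> = (\<Sum>\<xi>\<in>lattice_box (48 * q * ?R). character \<xi> x * a \<xi> * cutoff q (16 * ?R) \<xi> * fourier_coeff f \<xi>)"
    unfolding block_def sum.distrib[symmetric] by (simp add: cutoff_annulus_def algebra_simps)
  finally show ?case by (simp add: mult_ac)
qed

text \<open>A partial sum of the series is a smoothly truncated Fourier sum: the truncation is 1 on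
  the box 8 q 2^J and 0 outside 24 q 2^J. It differs from the sharp sum over the small box by at
  most the sum of norms between the two boxes, which tends to 0 because the series converges
  absolutely.\<close>

lemma holder_extension_smooth:
  assumes q: "1 \<le> q" and a: "\<And>\<xi>. norm (\<sigma> x \<xi>) \<le> L" and f: "f \<in> smooth_torus"
  shows "holder_extension q \<sigma> f x = (\<Sum>\<^sub>\<infinity>\<xi>. character \<xi> x * \<sigma> x \<xi> * fourier_coeff f \<xi>)"
proof -
  let ?t = "\<lambda>\<xi>. character \<xi> x * \<sigma> x \<xi> * fourier_coeff f \<xi>"
  have L: "0 \<le> L" using order_trans[OF norm_ge_zero a] .
  have abs: "(\<lambda>\<xi>. norm (?t \<xi>)) summable_on UNIV"
  proof (rule summable_on_comparison_test)
    show "(\<lambda>\<xi>. L * norm (fourier_coeff f \<xi>)) summable_on UNIV"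
      by (intro summable_on_cmult_right fourier_coeff_summable f)
    show "norm (?t \<xi>) \<le> L * norm (fourier_coeff f \<xi>)" for \<xi>
      using a by (simp add: norm_mult mult_right_mono)
  qed auto
  let ?l = "\<Sum>\<^sub>\<infinity>\<xi>. ?t \<xi>" and ?m = "\<Sum>\<^sub>\<infinity>\<xi>. norm (?t \<xi>)"
  have lim: "(\<lambda>J. sum ?t (lattice_box (c * 2 ^ J))) \<longlonglongrightarrow> ?l"
    and limn: "(\<lambda>J. sum (\<lambda>\<xi>. norm (?t \<xi>)) (lattice_box (c * 2 ^ J))) \<longlonglongrightarrow> ?m" if "1 \<le> c" for c
    using filterlim_compose[OF infsum_tendsto[OF abs_summable_summable[OF abs]] filterlim_lattice_box[OF that]]
      filterlim_compose[OF infsum_tendsto[OF abs] filterlim_lattice_box[OF that]] by auto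
  let ?S = "\<lambda>J. low_block q (\<sigma> x) f x + (\<Sum>j<J. block q (2 ^ j) (\<sigma> x) f x)"
  have "(\<lambda>J. ?S J - sum ?t (lattice_box (8 * q * 2 ^ J))) \<longlonglongrightarrow> 0"
  proof (rule Lim_null_comparison)
    have "(\<lambda>J. sum (\<lambda>\<xi>. norm (?t \<xi>)) (lattice_box (24 * q * 2 ^ J)) - sum (\<lambda>\<xi>. norm (?t \<xi>)) (lattice_box (8 * q * 2 ^ J)))
        \<longlonglongrightarrow> ?m - ?m"
      using q by (intro tendsto_diff limn) auto
    then show "(\<lambda>J. sum (\<lambda>\<xi>. norm (?t \<xi>)) (lattice_box (24 * q * 2 ^ J)) - sum (\<lambda>\<xi>. norm (?t \<xi>)) (lattice_box (8 * q * 2 ^ J)))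
        \<longlonglongrightarrow> 0" by simp
    show "\<forall>\<^sub>F J in sequentially. norm (?S J - sum ?t (lattice_box (8 * q * 2 ^ J)))
        \<le> sum (\<lambda>\<xi>. norm (?t \<xi>)) (lattice_box (24 * q * 2 ^ J)) - sum (\<lambda>\<xi>. norm (?t \<xi>)) (lattice_box (8 * q * 2 ^ J))"
    proof (rule always_eventually, rule allI)
      fix J
      let ?I = "lattice_box (8 * q * 2 ^ J) :: (int ^ 'a) set" and ?O = "lattice_box (24 * q * 2 ^ J) :: (int ^ 'a) set"
      have sub: "?I \<subseteq> ?O" by (rule lattice_box_mono) simp
      let ?u = "\<lambda>\<xi>. cutoff q (8 * 2 ^ J) \<xi> * ?t \<xi>"
      have R: "1 \<le> (8 :: nat) * 2 ^ J" by simp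
      have "?S J = sum ?u ?O" unfolding low_block_plus_blocks[OF q] by (simp add: mult_ac)
      also have "\<dots> = sum ?u (?O - ?I) + sum ?u ?I" by (rule sum.subset_diff[OF sub]) simp
      also have "sum ?u ?I = sum ?t ?I"
      proof (intro sum.cong refl)
        fix \<xi> assume "\<xi> \<in> ?I"
        then have "\<xi> \<in> lattice_box (q * (8 * 2 ^ J))" by (simp add: mult_ac)
        then have "cutoff q (8 * 2 ^ J) \<xi> = 1" by (rule cutoff_eq_1[OF R])
        then show "?u \<xi> = ?t \<xi>" by simp
      qed
      finally have "norm (?S J - sum ?t ?I) = norm (sum ?u (?O - ?I))" by simp
      also have "\<dots> \<le> (\<Sum>\<xi>\<in>?O - ?I. norm (?t \<xi>))"
      proof (rule sum_norm_le)
        fix \<xi>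
        have "norm (cutoff q (8 * 2 ^ J) \<xi>) * norm (?t \<xi>) \<le> 1 * norm (?t \<xi>)"
          by (intro mult_right_mono norm_cutoff_le_1 R) auto
        then show "norm (?u \<xi>) \<le> norm (?t \<xi>)" by (simp add: norm_mult mult_ac)
      qed
      also have "\<dots> = sum (\<lambda>\<xi>. norm (?t \<xi>)) ?O - sum (\<lambda>\<xi>. norm (?t \<xi>)) ?I"
        by (rule sum_diff[OF _ sub]) simp
      finally show "norm (?S J - sum ?t ?I) \<le> sum (\<lambda>\<xi>. norm (?t \<xi>)) ?O - sum (\<lambda>\<xi>. norm (?t \<xi>)) ?I" .
    qed
  qed
  from tendsto_add[OF this lim[of "8 * q"]] q have "?S \<longlonglongrightarrow> ?l" by simp
  then have "(\<lambda>J. ?S J - low_block q (\<sigma> x) f x) \<longlonglongrightarrow> ?l - low_block q (\<sigma> x) f x"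
    by (intro tendsto_diff tendsto_const)
  then have "(\<lambda>j. block q (2 ^ j) (\<sigma> x) f x) sums (?l - low_block q (\<sigma> x) f x)"
    by (simp add: sums_def)
  then show ?thesis by (simp add: holder_extension_def sums_iff)
qed

section \<open>Boundedness on the Hoelder space\<close>

lemma holder_extension_periodic:
  assumes "\<And>\<xi>. periodic (\<lambda>x. \<sigma> x \<xi>)"
  shows "periodic (holder_extension q \<sigma> f)"
proof -
  have "\<sigma> (x + of_lattice z) = \<sigma> x" for x z
    using assms by (simp add: periodic_def fun_eq_iff)
  then show ?thesis
    by (simp add: periodic_def holder_extension_def low_block_def block_def periodicD[OF periodic_character])
qed

text \<open>The estimates above ask for a positive constant, but the norm vanishes for f = 0. The
  slack \<open>e\<close> provides positivity and is removed at the end by letting it tend to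
  0.\<close>

lemma holder_norm_bounds:
  assumes f: "f \<in> holder_space s" and s: "0 < s" and e: "0 < e"
  shows "holder_with s (holder_norm s f + e) f" and "norm (f x) \<le> holder_norm s f + e" and "0 \<le> holder_norm s f"
proof -
  let ?Q = "SUP p. holder_quotient s f p" and ?M = "SUP x. norm (f x)"
  have per: "periodic f" and bdd: "bdd_above (range (holder_quotient s f))" using f by (auto simp: holder_space_def)
  have Q: "norm (f (x + h) - f x) \<le> ?Q * norm h powr s" for x h
    using holder_spaceD[OF f] s by simp
  have cont: "continuous_on UNIV f" by (rule holder_continuous[OF Q s])
  have M: "norm (f x) \<le> ?M" for x by (rule cSUP_upper[OF _ periodic_bounded[OF cont per]]) simp
  have Q0: "0 \<le> ?Q" using cSUP_upper[OF _ bdd, of undefined] holder_quotient_nonneg[of s f undefined] by force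
  have M0: "0 \<le> ?M" using order_trans[OF norm_ge_zero M] .
  show "norm (f x) \<le> holder_norm s f + e" using M[of x] Q0 e by (simp add: holder_norm_def)
  show "0 \<le> holder_norm s f" using Q0 M0 by (simp add: holder_norm_def)
  have "norm (f (x + h) - f x) \<le> (holder_norm s f + e) * norm h powr s" for x h
    by (rule order_trans[OF Q mult_right_mono]) (use M0 e in \<open>auto simp: holder_norm_def\<close>)
  then show "holder_with s (holder_norm s f + e) f"
    using cont per e Q0 M0 by (auto simp: holder_with_def holder_norm_def)
qed

lemma holder_extension_bounded_operator:
  fixes \<sigma> :: "real ^ 'n \<Rightarrow> int ^ 'n \<Rightarrow> complex"
  assumes \<rho>: "0 \<le> \<rho>" "\<rho> \<le> 1" and k: "CARD('n) + 1 \<le> 2 * k" and s: "0 < s" "s < 1" and L: "0 < L"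
    and per: "\<And>\<xi>. periodic (\<lambda>x. \<sigma> x \<xi>)"
    and sym: "\<And>x. symbol_bound k \<rho> L (\<sigma> x)"
    and dsym: "\<And>x h. h \<noteq> 0 \<Longrightarrow> symbol_bound k \<rho> (L * norm h) (\<lambda>\<xi>. \<sigma> (x + h) \<xi> - \<sigma> x \<xi>)"
  shows "bounded_operator_on (holder_space s) (holder_norm s) (holder_extension (Suc k) \<sigma>)"
proof -
  let ?T = "holder_extension (Suc k) \<sigma>"
  obtain B where B: "0 < B" and ex: "\<forall>f H. holder_with s H f \<and> (\<forall>x. norm (f x) \<le> H) \<longrightarrow>
    (\<forall>x. summable (\<lambda>j. block (Suc k) (2 ^ j) (\<sigma> x) f x)) \<and>
    (\<forall>x. norm (?T f x) \<le> B * H) \<and> (\<forall>x h. norm (?T f (x + h) - ?T f x) \<le> B * H * norm h powr s)"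
    using holder_extension_bound[OF \<rho> k s L sym dsym] by blast
  have facts: "summable (\<lambda>j. block (Suc k) (2 ^ j) (\<sigma> x) f x)" "norm (?T f x) \<le> B * (holder_norm s f + e)"
    "norm (?T f (x + h) - ?T f x) \<le> B * (holder_norm s f + e) * norm h powr s" "continuous_on UNIV f"
    if "f \<in> holder_space s" "0 < e" for f and e :: real and x h :: "real ^ 'n"
    using ex holder_norm_bounds(1,2)[OF that(1) s(1) that(2)] unfolding holder_with_def by blast+
  have quot: "holder_quotient s (?T f) p \<le> B * (holder_norm s f + e)" if f: "f \<in> holder_space s" and e: "0 < e" for f e p
    using holder_norm_bounds(3)[OF f s(1) e] B e
    by (intro holder_quotient_le holder_extension_periodic per facts(3)[OF f e]) auto
  show ?thesis
    unfolding bounded_operator_on_def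
  proof (intro conjI ballI allI)
    fix f :: "real ^ 'n \<Rightarrow> complex" assume f: "f \<in> holder_space s"
    show "?T f \<in> holder_space s"
      using holder_extension_periodic[OF per] quot[OF f zero_less_one]
      by (auto simp: holder_space_def intro!: bdd_aboveI)
    fix g :: "real ^ 'n \<Rightarrow> complex" assume g: "g \<in> holder_space s"
    note c = facts(4)[OF f zero_less_one] facts(4)[OF g zero_less_one]
    have "block q R a (\<lambda>x. f x + g x) x = block q R a f x + block q R a g x"
      "low_block q a (\<lambda>x. f x + g x) x = low_block q a f x + low_block q a g x" for q R a x
      by (simp_all add: block_def low_block_def fourier_coeff_add[OF c] distrib_left sum.distrib)
    then show "?T (\<lambda>x. f x + g x) = (\<lambda>x. ?T f x + ?T g x)"
      by (simp add: holder_extension_def fun_eq_iff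
          suminf_add[OF facts(1)[OF f zero_less_one] facts(1)[OF g zero_less_one], symmetric])
  next
    fix c and f :: "real ^ 'n \<Rightarrow> complex" assume f: "f \<in> holder_space s"
    have "block q R a (\<lambda>x. c * f x) x = c * block q R a f x"
      "low_block q a (\<lambda>x. c * f x) x = c * low_block q a f x" for q R a x
      by (simp_all add: block_def low_block_def fourier_coeff_cmult sum_distrib_left mult_ac)
    then show "?T (\<lambda>x. c * f x) = (\<lambda>x. c * ?T f x)"
      by (simp add: holder_extension_def fun_eq_iff suminf_mult[OF facts(1)[OF f zero_less_one]] distrib_left)
  next
    show "\<exists>K. \<forall>f\<in>holder_space s. holder_norm s (?T f) \<le> K * holder_norm s f"
    proof (intro exI[of _ "2 * B"] ballI)
      fix f :: "real ^ 'n \<Rightarrow> complex" assume f: "f \<in> holder_space s"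
      show "holder_norm s (?T f) \<le> 2 * B * holder_norm s f"
      proof (rule field_le_epsilon)
        fix e :: real assume e: "0 < e"
        \<comment> \<open>Each of the two suprema exceeds its share by
          \<open>B * ?e = e / 2\<close>.\<close>
        let ?e = "e / (2 * B)"
        have e': "0 < ?e" using e B by simp
        have "(SUP p. holder_quotient s (?T f) p) \<le> B * (holder_norm s f + ?e)"
          by (rule cSUP_least) (auto intro: quot[OF f e'])
        moreover have "(SUP x. norm (?T f x)) \<le> B * (holder_norm s f + ?e)"
          by (rule cSUP_least) (auto intro: facts(2)[OF f e'])
        ultimately have "holder_norm s (?T f) \<le> 2 * (B * (holder_norm s f + ?e))"
          by (simp add: holder_norm_def)
        also have "\<dots> = 2 * B * holder_norm s f + e" using B by (simp add: field_simps)
        finally show "holder_norm s (?T f) \<le> 2 * B * holder_norm s f + e" .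
      qed
    qed
  qed
qed

theorem corollary3p9:
  fixes A :: "(real ^ ('n :: {finite, linorder}) \<Rightarrow> complex) \<Rightarrow> (real ^ ('n :: _) \<Rightarrow> complex)"
    and \<sigma> :: "real ^ ('n :: _) \<Rightarrow> int ^ ('n :: _) \<Rightarrow> complex"
    and C :: "nat ^ ('n :: _) \<Rightarrow> real"
    and m \<rho> \<delta> :: real
    and l k :: nat
  assumes "0 < \<rho>" "\<rho> \<le> 1"
    and "0 \<le> \<delta>" "\<delta> \<le> 1"
    and "1 \<le> l"
    and "k = CARD('n) div 2 + 1"
    and "\<And>\<xi>. periodic (\<lambda>x. \<sigma> x \<xi>)"
    and "psdo_with_symbol A \<sigma>"
    and "\<And>\<alpha> \<beta> x \<xi>. mi_length \<alpha> \<le> k \<Longrightarrow> mi_length \<beta> \<le> l \<Longrightarrow>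
           norm (mi_compose partial_deriv \<beta> (\<lambda>y. mi_compose difference \<alpha> (\<sigma> y) \<xi>) x)
             \<le> C \<alpha> * japanese_bracket \<xi> powr
                 (- m - \<rho> * real (mi_length \<alpha>) + \<delta> * real (mi_length \<beta>))"
    and "m \<ge> \<delta> * real l + real CARD('n) / 2 * (1 - \<rho>)"
  shows "\<forall>s. 0 < s \<and> s < 1 \<longrightarrow>
           (\<exists>T. bounded_operator_on (holder_space s) (holder_norm s) T \<and>
                (\<forall>f\<in>smooth_torus. T f = A f))"
proof (intro allI impI)
  fix s :: real assume "0 < s \<and> s < 1"
  then have s: "0 < s" "s < 1" by auto
  let ?n = "real CARD('n)"
  let ?e = "\<lambda>i. - (?n / 2 * (1 - \<rho>)) - \<rho> * real i"
  \<comment> \<open>A single constant for the finitely many pure multi-indices in question; the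
    summand 1 makes it positive.\<close>
  define L0 where "L0 = 1 + (\<Sum>j\<in>UNIV. \<Sum>i\<le>k. \<bar>C (axis j i)\<bar>)"
  \<comment> \<open>The factor n comes from the mean value inequality in
    \<open>norm_diff_le_partial_deriv\<close>, which adds up n partial derivatives.\<close>
  define L where "L = ?n * L0"
  have L0: "1 \<le> L0" by (simp add: L0_def sum_nonneg)
  have n: "1 \<le> ?n" by (simp add: Suc_le_eq)
  have L0L: "L0 \<le> L" using mult_right_mono[OF n, of L0] L0 by (simp add: L_def)
  have Lpos: "0 < L" using L0 L0L by simp
  have C: "C (axis j i) \<le> L0" if "i \<le> k" for j i
  proof -
    have "\<bar>C (axis j i)\<bar> \<le> (\<Sum>i\<le>k. \<bar>C (axis j i)\<bar>)" by (rule member_le_sum) (use that in auto)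
    also have "\<dots> \<le> (\<Sum>j\<in>UNIV. \<Sum>i\<le>k. \<bar>C (axis j i)\<bar>)"
      by (rule member_le_sum) (auto simp: sum_nonneg)
    finally show ?thesis by (simp add: L0_def)
  qed
  text \<open>Since \<open>\<delta> \<le> \<delta> l\<close>, one derivative in \<open>x\<close> still leaves the order \<open>- n (1 - \<rho>) / 2\<close>.\<close>
  have est: "norm ((partial_deriv p ^^ b) (\<lambda>y. (difference j ^^ i) (\<sigma> y) \<xi>) x) \<le> L0 * japanese_bracket \<xi> powr ?e i"
    if i: "i \<le> k" and b: "b \<le> 1" for p b j i x \<xi>
  proof -
    have "norm ((partial_deriv p ^^ b) (\<lambda>y. (difference j ^^ i) (\<sigma> y) \<xi>) x)
        \<le> C (axis j i) * japanese_bracket \<xi> powr (- m - \<rho> * real i + \<delta> * real b)"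
      using assms(9)[of "axis j i" "axis p b" \<xi> x] i b assms(5)
      by (simp only: mi_compose_axis mi_length_axis)
    also have "\<dots> \<le> L0 * japanese_bracket \<xi> powr (- m - \<rho> * real i + \<delta> * real b)"
      by (intro mult_right_mono C i) auto
    also have "\<dots> \<le> L0 * japanese_bracket \<xi> powr ?e i"
    proof (intro mult_left_mono powr_mono japanese_bracket_ge_1)
      have "\<delta> * real b \<le> \<delta> * real l" using assms(3,5) b by (intro mult_left_mono) auto
      then show "- m - \<rho> * real i + \<delta> * real b \<le> ?e i" using assms(10) by linarith
    qed (use L0 in auto)
    finally show ?thesis .
  qed
  have sym: "symbol_bound k \<rho> L (\<sigma> x)" for x
    unfolding symbol_bound_def
  proof (intro allI impI)
    fix j i \<xi> assume i: "i \<le> k"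
    have "norm ((difference j ^^ i) (\<sigma> x) \<xi>) \<le> L0 * japanese_bracket \<xi> powr ?e i"
      using est[OF i, of 0 undefined j \<xi> x] by simp
    also have "\<dots> \<le> L * japanese_bracket \<xi> powr ?e i" by (intro mult_right_mono L0L) auto
    finally show "norm ((difference j ^^ i) (\<sigma> x) \<xi>) \<le> L * japanese_bracket \<xi> powr ?e i" .
  qed
  have dsym: "symbol_bound k \<rho> (L * norm h) (\<lambda>\<xi>. \<sigma> (x + h) \<xi> - \<sigma> x \<xi>)" for x h
    unfolding symbol_bound_def
  proof (intro allI impI)
    fix j i \<xi> assume i: "i \<le> k"
    let ?b = "\<lambda>y. (difference j ^^ i) (\<sigma> y) \<xi>"
    have "norm (?b (x + h) - ?b x) \<le> ?n * (L0 * japanese_bracket \<xi> powr ?e i) * norm h"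
      using est[OF i, of 1 _ j \<xi>]
      by (intro norm_diff_le_partial_deriv symbol_differentiable[OF assms(8)]) simp
    then show "norm ((difference j ^^ i) (\<lambda>\<xi>. \<sigma> (x + h) \<xi> - \<sigma> x \<xi>) \<xi>)
        \<le> L * norm h * japanese_bracket \<xi> powr ?e i"
      by (simp add: difference_funpow_diff L_def mult_ac)
  qed
  \<comment> \<open>k is the least integer with 2k > n: the threshold for integrating the reciprocal
    of the weight.\<close>
  have k: "CARD('n) + 1 \<le> 2 * k" using assms(6) by linarith
  have \<rho>: "0 \<le> \<rho>" using assms(1) by simp
  have "bounded_operator_on (holder_space s) (holder_norm s) (holder_extension (Suc k) \<sigma>)"
    by (rule holder_extension_bounded_operator[OF \<rho> assms(2) k s Lpos assms(7) sym dsym])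
  moreover have "holder_extension (Suc k) \<sigma> f = A f" if f: "f \<in> smooth_torus" for f
  proof
    fix x
    have "holder_extension (Suc k) \<sigma> f x = (\<Sum>\<^sub>\<infinity>\<xi>. character \<xi> x * \<sigma> x \<xi> * fourier_coeff f \<xi>)"
      by (rule holder_extension_smooth[OF _ symbol_bound_norm_le[OF sym] f]) (use Lpos assms(2) in auto)
    also have "\<dots> = A f x"
      using assms(8) f by (simp add: psdo_with_symbol_def character_def)
    finally show "holder_extension (Suc k) \<sigma> f x = A f x" .
  qed
  ultimately show "\<exists>T. bounded_operator_on (holder_space s) (holder_norm s) T \<and> (\<forall>f\<in>smooth_torus. T f = A f)"
    by blast
qed

end
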